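(* Let $\mathbb{H}$ be a definite quaternion algebra over $\mathbb{Q}$ with maximal order $\mathcal{O}_{\mathbb{H}}$ and let $g\ge1$. The set of principally polarized right $\mathcal{O}_{\mathbb{H}}$-submodules of $\mathbb{H}^g$ is in one-to-one correspondence with $\mathrm{GU}_g(\widehat{\mathbb{H}})/\mathrm{GU}_g(\mathcal{O}_{\widehat{\mathbb{H}}})$, the module corresponding to the coset $[M]$ being $\kappa(M)=M\mathcal{O}_{\widehat{\mathbb{H}}}^g\cap\mathbb{H}^g$.
   Context: $\widehat{\mathbb{Z}}$ is the profinite completion of $\mathbb{Z}$, $\mathcal{O}_{\widehat{\mathbb{H}}}=\mathcal{O}_{\mathbb{H}}\otimes\widehat{\mathbb{Z}}$ and $\widehat{\mathbb{H}}=\mathcal{O}_{\widehat{\mathbb{H}}}\otimes\mathbb{Q}$ (finite adèles of $\mathbb{H}$). For a matrix $M$, $M^\dagger=\overline{M}^t$ (main involution applied entrywise, then transpose). For an algebra $B$ with this anti-involution and fixed ring $R$ (so $R=\mathbb{Q}$, $\widehat{\mathbb{Q}}$, $\widehat{\mathbb{Z}}$ for $B=\mathbb{H},\widehat{\mathbb{H}},\mathcal{O}_{\widehat{\mathbb{H}}}$), $\mathrm{GU}_g(B)=\{M\in\mathrm{Mat}_{g\times g}(B): M^\dagger M=\lambda\,\mathrm{Id}\text{ with }\lambda\in R^\times\}$. A finitely generated right $\mathcal{O}_{\mathbb{H}}$-submodule $L\subset\mathbb{H}^g$ with $L\otimes\mathbb{Q}=\mathbb{H}^g$ is principally polarized if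 there exists $c\in\mathbb{Q}^\times$ such that the hermitian form $(x,y)\mapsto c\,x^\dagger y$ restricted to $L$ is $\mathcal{O}_{\mathbb{H}}$-valued and unimodular. *)

theory Defs
  imports "HOL-Analysis.Analysis" "HOL-Library.Multiset"
begin

class scaleQ =
  fixes scaleQ :: "rat \<Rightarrow> 'a \<Rightarrow> 'a" (infixr \<open>*\<^sub>Q\<close> 75)

class rat_vector = scaleQ + ab_group_add +
  assumes scaleQ_add_right: "a *\<^sub>Q (x + y) = a *\<^sub>Q x + a *\<^sub>Q y"
    and scaleQ_add_left: "(a + b) *\<^sub>Q x = a *\<^sub>Q x + b *\<^sub>Q x"
    and scaleQ_scaleQ: "a *\<^sub>Q b *\<^sub>Q x = (a * b) *\<^sub>Q x"
    and scaleQ_one: "1 *\<^sub>Q x = x"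

class rat_algebra_1 = rat_vector + ring_1 +
  assumes mult_scaleQ_left: "a *\<^sub>Q x * y = a *\<^sub>Q (x * y)"
    and mult_scaleQ_right: "x * a *\<^sub>Q y = a *\<^sub>Q (x * y)"

interpretation rat_vector: vector_space "scaleQ :: rat \<Rightarrow> 'a \<Rightarrow> 'a::rat_vector"
  by unfold_locales (simp_all add: scaleQ_add_right scaleQ_add_left scaleQ_scaleQ scaleQ_one)

interpretation rat_self: vector_space "(*) :: rat \<Rightarrow> rat \<Rightarrow> rat"
  by unfold_locales (simp_all add: algebra_simps)

instantiation vec :: (rat_vector, finite) rat_vector
begin

definition scaleQ_vec :: "rat \<Rightarrow> 'a ^ 'b \<Rightarrow> 'a ^ 'b"
  where "q *\<^sub>Q x = (\<chi> i. q *\<^sub>Q (x $ i))"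

instance
  by standard
    (simp_all add: scaleQ_vec_def vec_eq_iff scaleQ_add_right scaleQ_add_left scaleQ_scaleQ
      scaleQ_one)

end

class involution_ring = ring_1 +
  fixes invol :: "'a \<Rightarrow> 'a"
  assumes invol_add: "invol (x + y) = invol x + invol y"
    and invol_mult: "invol (x * y) = invol y * invol x"
    and invol_one: "invol 1 = 1"
    and invol_invol: "invol (invol x) = x"

text \<open>
  A quaternion algebra over the rationals, together with its main involution.  The latter is the
  unique anti-involution for which all \<open>x + invol x\<close> (reduced traces) and \<open>x * invol x\<close> (reduced
  norms) are rational scalars.
\<close>

class quaternion_algebra = rat_algebra_1 + involution_ring +
  assumes quaternion_basis:
    "\<exists>i j a b. a \<noteq> 0 \<and> b \<noteq> 0 \<and> i * i = a *\<^sub>Q 1 \<and> j * j = b *\<^sub>Q 1 \<and> j * i = - (i * j) \<and>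
       (\<forall>x. \<exists>t u v w. x = t *\<^sub>Q 1 + u *\<^sub>Q i + v *\<^sub>Q j + w *\<^sub>Q (i * j)) \<and>
       (\<forall>t u v w. t *\<^sub>Q 1 + u *\<^sub>Q i + v *\<^sub>Q j + w *\<^sub>Q (i * j) = 0
          \<longrightarrow> t = 0 \<and> u = 0 \<and> v = 0 \<and> w = 0)"
    and trace_rational: "\<exists>t. x + invol x = t *\<^sub>Q 1"
    and norm_rational: "\<exists>n. x * invol x = n *\<^sub>Q 1"

text \<open>
  Multisets of pairs are the formal sums of pure tensors, i.e. the free commutative monoid on
  pairs.  Modulo biadditivity this monoid is already a group, since \<open>(a, b) + (- a, b)\<close> is
  identified with the empty sum.
\<close>

inductive tensor_rel ::
  "('a::ab_group_add \<times> 'b::ab_group_add) multiset \<Rightarrow> ('a \<times> 'b) multiset \<Rightarrow> bool" where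
  tensor_rel_refl: "tensor_rel X X"
| tensor_rel_sym: "tensor_rel X Y \<Longrightarrow> tensor_rel Y X"
| tensor_rel_trans: "tensor_rel X Y \<Longrightarrow> tensor_rel Y Z \<Longrightarrow> tensor_rel X Z"
| tensor_rel_plus: "tensor_rel X Y \<Longrightarrow> tensor_rel X' Y' \<Longrightarrow> tensor_rel (X + X') (Y + Y')"
| tensor_rel_add_left: "tensor_rel {#(a + a', b)#} {#(a, b), (a', b)#}"
| tensor_rel_add_right: "tensor_rel {#(a, b + b')#} {#(a, b), (a, b')#}"
| tensor_rel_zero_left: "tensor_rel {#(0, b)#} {#}"
| tensor_rel_zero_right: "tensor_rel {#(a, 0)#} {#}"

quotient_type (overloaded) ('a, 'b) tensor =
  "('a::ab_group_add \<times> 'b::ab_group_add) multiset" / tensor_rel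
  by (rule equivpI)
    (auto simp: reflp_def symp_def transp_def
      intro: tensor_rel_refl tensor_rel_sym tensor_rel_trans)

lift_definition tensor :: "'a::ab_group_add \<Rightarrow> 'b::ab_group_add \<Rightarrow> ('a, 'b) tensor"
  is "\<lambda>a b. {#(a, b)#}" .

lemma tensor_rel_image_mset:
  assumes "tensor_rel X Y"
    and "\<And>a a'. f (a + a') = f a + f a'" "\<And>b b'. g (b + b') = g b + g b'"
  shows "tensor_rel (image_mset (map_prod f g) X) (image_mset (map_prod f g) Y)"
proof -
  have f0: "f 0 = 0" and g0: "g 0 = 0"
    using assms(2)[of 0 0] assms(3)[of 0 0] by simp_all
  show ?thesis
    using assms(1)
  proof induction
    case (tensor_rel_sym X Y)
    show ?case by (rule tensor_rel.tensor_rel_sym) fact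
  next
    case (tensor_rel_trans X Y Z)
    show ?case by (rule tensor_rel.tensor_rel_trans) fact+
  next
    case (tensor_rel_plus X Y X' Y')
    then show ?case by (simp add: tensor_rel.tensor_rel_plus)
  next
    case (tensor_rel_add_left a a' b)
    show ?case using tensor_rel.tensor_rel_add_left[of "f a" "f a'" "g b"] by (simp add: assms(2))
  next
    case (tensor_rel_add_right a b b')
    show ?case using tensor_rel.tensor_rel_add_right[of "f a" "g b" "g b'"] by (simp add: assms(3))
  qed (simp_all add: f0 g0 tensor_rel_refl tensor_rel_zero_left tensor_rel_zero_right)
qed

instantiation tensor :: (ab_group_add, ab_group_add) ab_group_add
begin

lift_definition zero_tensor :: "('a, 'b) tensor" is "{#}" .

lift_definition plus_tensor :: "('a, 'b) tensor \<Rightarrow> ('a, 'b) tensor \<Rightarrow> ('a, 'b) tensor"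
  is "(+)" by (rule tensor_rel_plus)

lift_definition uminus_tensor :: "('a, 'b) tensor \<Rightarrow> ('a, 'b) tensor"
  is "image_mset (map_prod uminus id)"
  by (rule tensor_rel_image_mset) simp_all

definition minus_tensor :: "('a, 'b) tensor \<Rightarrow> ('a, 'b) tensor \<Rightarrow> ('a, 'b) tensor"
  where "x - y = x + - (y :: ('a, 'b) tensor)"

lemma tensor_rel_uminus:
  fixes X :: "('a \<times> 'b) multiset"
  shows "tensor_rel (image_mset (map_prod uminus id) X + X) {#}"
proof (induction X)
  case empty
  show ?case by (simp add: tensor_rel_refl)
next
  case (add p X)
  obtain a b where p: "p = (a, b)" by force
  have "tensor_rel {#(- a + a, b)#} {#(- a, b), (a, b)#}"
    by (rule tensor_rel_add_left)
  then have "tensor_rel {#(- a, b), (a, b)#} {#}"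
    using tensor_rel_zero_left[of b] by (auto intro: tensor_rel_sym tensor_rel_trans)
  from tensor_rel_plus[OF this add] show ?case
    by (simp add: p add_mset_commute)
qed

instance
proof
  fix a b c :: "('a, 'b) tensor"
  show "a + b + c = a + (b + c)" by transfer (simp add: add.assoc tensor_rel_refl)
  show "a + b = b + a" by transfer (simp add: add.commute tensor_rel_refl)
  show "0 + a = a" by transfer (simp add: tensor_rel_refl)
  show "- a + a = 0" by transfer (rule tensor_rel_uminus)
  show "a - b = a + - b" by (rule minus_tensor_def)
qed

end

lemma tensor_add_left: "tensor (a + a') b = tensor a b + tensor a' b"
  by transfer (metis tensor_rel_add_left add_mset_add_single union_commute)

lemma tensor_add_right: "tensor a (b + b') = tensor a b + tensor a b'"
  by transfer (metis tensor_rel_add_right add_mset_add_single union_commute)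

lemma tensor_induct [case_names zero add]:
  assumes "P 0" "\<And>a b x. P x \<Longrightarrow> P (tensor a b + x)"
  shows "P x"
proof -
  have "P (abs_tensor X)" for X
  proof (induction X)
    case empty
    then show ?case using assms(1) by (simp add: zero_tensor_def)
  next
    case (add p X)
    obtain a b where p: "p = (a, b)" by force
    show ?case
      using assms(2)[OF add, of a b]
      by (simp add: p tensor.abs_eq plus_tensor.abs_eq)
  qed
  then show ?thesis by (metis Quotient3_abs_rep Quotient3_tensor)
qed

definition mset_mult :: "('a::times \<times> 'b::times) multiset \<Rightarrow> ('a \<times> 'b) multiset \<Rightarrow> ('a \<times> 'b) multiset"
  where "mset_mult X Y = (\<Sum>p\<in>#X. image_mset (map_prod ((*) (fst p)) ((*) (snd p))) Y)"

lemma mset_mult_simps [simp]: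
  "mset_mult {#} Y = {#}"
  "mset_mult X {#} = {#}"
  "mset_mult (X + X') Y = mset_mult X Y + mset_mult X' Y"
  "mset_mult X (Y + Y') = mset_mult X Y + mset_mult X Y'"
  "mset_mult {#p#} {#q#} = {#(fst p * fst q, snd p * snd q)#}"
  by (simp_all add: mset_mult_def sum_mset.distrib map_prod_def split_beta)

lemma mset_mult_add_mset [simp]:
  "NO_MATCH {#} X \<Longrightarrow> mset_mult (add_mset p X) Y = mset_mult {#p#} Y + mset_mult X Y"
  "NO_MATCH {#} Y \<Longrightarrow> mset_mult X (add_mset q Y) = mset_mult X {#q#} + mset_mult X Y"
  using mset_mult_simps(3)[of "{#p#}" X Y] mset_mult_simps(4)[of X "{#q#}" Y] by simp_all

lemma tensor_rel_mult_right:
  fixes Y :: "('a::ring \<times> 'b::ring) multiset"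
  assumes "tensor_rel Y Y'"
  shows "tensor_rel (mset_mult X Y) (mset_mult X Y')"
proof (induction X)
  case empty
  show ?case by (simp add: tensor_rel_refl)
next
  case (add p X)
  have "tensor_rel (mset_mult {#p#} Y) (mset_mult {#p#} Y')"
    unfolding mset_mult_def using assms
    by (simp add: tensor_rel_image_mset distrib_left)
  from tensor_rel_plus[OF this add] show ?case
    using mset_mult_simps(3)[of "{#p#}" X] by simp
qed

lemma mset_mult_alt:
  "mset_mult X Y = (\<Sum>q\<in>#Y. image_mset (map_prod (\<lambda>a. a * fst q) (\<lambda>b. b * snd q)) X)"
proof (induction Y)
  case (add q Y)
  have "mset_mult X {#q#} = image_mset (map_prod (\<lambda>a. a * fst q) (\<lambda>b. b * snd q)) X"
    by (simp add: mset_mult_def map_prod_def case_prod_unfold)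
  then show ?case
    using add mset_mult_simps(4)[of X "{#q#}" Y] by simp
qed simp

lemma tensor_rel_mult_left:
  fixes Y :: "('a::ring \<times> 'b::ring) multiset"
  assumes "tensor_rel X X'"
  shows "tensor_rel (mset_mult X Y) (mset_mult X' Y)"
proof (induction Y)
  case empty
  show ?case by (simp add: tensor_rel_refl)
next
  case (add p Y)
  have "tensor_rel (mset_mult X {#p#}) (mset_mult X' {#p#})"
    unfolding mset_mult_alt using assms
    by (simp add: tensor_rel_image_mset distrib_right)
  from tensor_rel_plus[OF this add] show ?case
    using mset_mult_simps(4)[of _ "{#p#}" Y] by simp
qed

instantiation tensor :: (ring, ring) ring
begin

lift_definition times_tensor :: "('a, 'b) tensor \<Rightarrow> ('a, 'b) tensor \<Rightarrow> ('a, 'b) tensor"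
  is mset_mult
  by (rule tensor_rel_trans[OF tensor_rel_mult_left tensor_rel_mult_right])

lemma tensor_mult_distrib:
  fixes x y z :: "('a, 'b) tensor"
  shows "(x + y) * z = x * z + y * z" "x * (y + z) = x * y + x * z"
    "0 * x = 0" "x * 0 = 0"
  by (transfer, simp add: tensor_rel_refl)+

lemma tensor_mult_tensor:
  fixes a c :: 'a and b d :: 'b
  shows "tensor a b * tensor c d = tensor (a * c) (b * d)"
  by transfer (simp add: tensor_rel_refl)

instance
proof
  fix x y z :: "('a, 'b) tensor"
  have 1: "tensor a b * tensor c d * z = tensor a b * (tensor c d * z)" for a b c d
    by (induction z rule: tensor_induct)
      (simp_all add: tensor_mult_distrib tensor_mult_tensor mult.assoc)
  have 2: "tensor a b * y * z = tensor a b * (y * z)" for a b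
    by (induction y rule: tensor_induct) (simp_all add: tensor_mult_distrib 1)
  show "x * y * z = x * (y * z)"
    by (induction x rule: tensor_induct) (simp_all add: tensor_mult_distrib 2)
qed (simp_all add: tensor_mult_distrib)

end

lemma tensor_rel_eval:
  fixes f :: "'a::ab_group_add \<Rightarrow> rat" and X Y :: "('a \<times> 'b::ring_1) multiset"
  defines "E \<equiv> \<lambda>N X. \<Sum>p\<in>#X. of_int \<lfloor>of_nat N * f (fst p)\<rfloor> * snd p"
  assumes "tensor_rel X Y" and f: "\<And>a a'. f (a + a') = f a + f a'"
  shows "\<exists>m>0. \<forall>N. m dvd N \<longrightarrow> E N X = E N Y"
  using assms(2)
proof induction
  case (tensor_rel_trans X Y Z)
  then obtain m k where "m > 0" "\<forall>N. m dvd N \<longrightarrow> E N X = E N Y"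
    "k > 0" "\<forall>N. k dvd N \<longrightarrow> E N Y = E N Z" by blast
  then show ?case
    by (intro exI[of _ "m * k"]) (metis dvd_mult_left dvd_mult_right nat_0_less_mult_iff)
next
  case (tensor_rel_plus X Y X' Y')
  then obtain m k where "m > 0" "\<forall>N. m dvd N \<longrightarrow> E N X = E N Y"
    "k > 0" "\<forall>N. k dvd N \<longrightarrow> E N X' = E N Y'" by blast
  moreover have "E N (U + V) = E N U + E N V" for N U V
    by (simp add: E_def)
  ultimately show ?case
    by (intro exI[of _ "m * k"]) (metis dvd_mult_left dvd_mult_right nat_0_less_mult_iff)
next
  case (tensor_rel_add_left a a' b)
  have *: "\<exists>m>0. \<forall>N. m dvd N \<longrightarrow> of_nat N * q \<in> \<int>" for q :: rat
  proof -
    obtain c d where q: "quotient_of q = (c, d)" by force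
    have d: "d > 0" "q = of_int c / of_int d"
      using quotient_of_denom_pos[OF q] quotient_of_div[OF q] by auto
    have "of_nat N * q \<in> \<int>" if N: "nat d dvd N" for N
    proof -
      from N obtain k where "N = nat d * k" by blast
      then have "of_nat N * q = of_int (int k * c)"
        using d by (simp add: of_nat_nat)
      then show ?thesis by (metis Ints_of_int)
    qed
    then show ?thesis using d by (intro exI[of _ "nat d"]) auto
  qed
  from *[of "f a"] *[of "f a'"] obtain m k where mk: "m > 0" "k > 0"
    "\<And>N. m dvd N \<Longrightarrow> of_nat N * f a \<in> \<int>" "\<And>N. k dvd N \<Longrightarrow> of_nat N * f a' \<in> \<int>" by blast
  have "E N {#(a + a', b)#} = E N {#(a, b), (a', b)#}" if "m * k dvd N" for N
  proof -
    have "of_nat N * f a \<in> \<int>" "of_nat N * f a' \<in> \<int>"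
      using mk(3)[OF dvd_mult_left[OF that]] mk(4)[OF dvd_mult_right[OF that]] by auto
    then obtain u v :: int where "of_nat N * f a = of_int u" "of_nat N * f a' = of_int v"
      by (elim Ints_cases)
    moreover from this have "of_nat N * f (a + a') = of_int (u + v)"
      by (simp add: f distrib_left)
    ultimately show ?thesis
      by (simp only: E_def) (simp del: of_int_add add: of_int_add[where 'a = 'b] distrib_right)
  qed
  then show ?case using mk(1,2) by (intro exI[of _ "m * k"]) simp
next
  case (tensor_rel_zero_left b)
  have "f 0 = 0" using f[of 0 0] by simp
  then show ?case by (intro exI[of _ 1]) (simp add: E_def)
qed (auto simp: E_def distrib_left intro: exI[of _ 1])

instantiation tensor :: (rat_algebra_1, ring_char_0) ring_1
begin

definition one_tensor :: "('a, 'b) tensor"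
  where "1 = tensor 1 1"

instance
proof
  fix x :: "('a, 'b) tensor"
  show "1 * x = x"
    by (induction x rule: tensor_induct)
      (simp_all add: one_tensor_def tensor_mult_distrib tensor_mult_tensor)
  show "x * 1 = x"
    by (induction x rule: tensor_induct)
      (simp_all add: one_tensor_def tensor_mult_distrib tensor_mult_tensor)
  show "(0 :: ('a, 'b) tensor) \<noteq> 1"
  proof
    assume "(0 :: ('a, 'b) tensor) = 1"
    then have rel: "tensor_rel {#(1 :: 'a, 1 :: 'b)#} {#}"
      unfolding one_tensor_def by transfer (rule tensor_rel_sym)
    interpret P: vector_space_pair "scaleQ :: rat \<Rightarrow> 'a \<Rightarrow> 'a" "(*) :: rat \<Rightarrow> rat \<Rightarrow> rat" ..
    have "rat_vector.independent {1 :: 'a}"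
      by simp
    from P.linear_independent_extend[OF this, of "\<lambda>_. 1"]
    obtain f :: "'a \<Rightarrow> rat" where f: "Vector_Spaces.linear scaleQ (*) f" "f 1 = 1" by auto
    have "f (a + a') = f a + f a'" for a a'
      using f(1) by (simp add: Vector_Spaces.linear_iff)
    from tensor_rel_eval[OF rel this] obtain m where "m > 0"
      "of_int \<lfloor>of_nat m * f 1\<rfloor> * (1 :: 'b) = 0" by auto
    then show False using f(2) by simp
  qed
qed

end

instantiation tensor ::
  ("{rat_algebra_1, involution_ring}", "{comm_ring_1, ring_char_0}") involution_ring
begin

lift_definition invol_tensor :: "('a, 'b) tensor \<Rightarrow> ('a, 'b) tensor"
  is "image_mset (map_prod invol id)"
  by (rule tensor_rel_image_mset) (simp_all add: invol_add)

lemma invol_tensor_simps: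
  fixes x y :: "('a, 'b) tensor"
  shows "invol (x + y) = invol x + invol y" "invol (tensor a b :: ('a, 'b) tensor) = tensor (invol a) b"
    "invol (0 :: ('a, 'b) tensor) = 0"
  by (transfer, simp add: tensor_rel_refl)+

instance
proof
  fix x y :: "('a, 'b) tensor"
  show "invol (x + y) = invol x + invol y" by (rule invol_tensor_simps)
  show "invol (invol x) = x"
    by (induction x rule: tensor_induct) (simp_all add: invol_tensor_simps invol_invol)
  show "invol (1 :: ('a, 'b) tensor) = 1"
    by (simp add: one_tensor_def invol_tensor_simps invol_one)
  have "invol (tensor a b * y) = invol y * tensor (invol a) b" for a b
    by (induction y rule: tensor_induct)
      (simp_all add: invol_tensor_simps tensor_mult_distrib tensor_mult_tensor invol_mult
        mult.commute)
  then show "invol (x * y) = invol y * invol x"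
    by (induction x rule: tensor_induct) (simp_all add: invol_tensor_simps tensor_mult_distrib)
qed

end

text \<open>
  Since \<open>'h\<close> and \<open>real\<close> are rational vector spaces, their tensor products over the integers and
  over the rationals agree; definite means ramified at the real place.
\<close>

definition definite :: "'h::quaternion_algebra itself \<Rightarrow> bool"
  where "definite _ \<longleftrightarrow> (\<forall>x :: ('h, real) tensor. x \<noteq> 0 \<longrightarrow> (\<exists>y. x * y = 1 \<and> y * x = 1))"

text \<open>\<open>x n\<close> is the representative in \<open>{0..n}\<close> of the component of \<open>x\<close> modulo \<open>n + 1\<close>.\<close>

typedef zhat = "{x :: nat \<Rightarrow> int. \<forall>m n. Suc n dvd Suc m \<longrightarrow> x m mod int (Suc n) = x n}"
  by (rule exI[of _ "\<lambda>_. 0"]) simp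

setup_lifting type_definition_zhat

lemma mod_int_Suc_mod_int_Suc:
  "Suc n dvd Suc m \<Longrightarrow> (x mod int (Suc m)) mod int (Suc n) = x mod int (Suc n)"
  by (rule mod_mod_cancel) (simp only: int_dvd_int_iff)

lemma zhat_compatible:
  assumes "Suc n dvd Suc m" "a mod int (Suc n) = c" "b mod int (Suc n) = d"
  shows "(a + b) mod int (Suc m) mod int (Suc n) = (c + d) mod int (Suc n)"
    and "(a - b) mod int (Suc m) mod int (Suc n) = (c - d) mod int (Suc n)"
    and "(a * b) mod int (Suc m) mod int (Suc n) = (c * d) mod int (Suc n)"
    and "(- a) mod int (Suc m) mod int (Suc n) = (- c) mod int (Suc n)"
  unfolding mod_int_Suc_mod_int_Suc[OF assms(1)] assms(2,3)[symmetric]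
  by (simp_all only: mod_add_eq mod_diff_eq mod_mult_eq mod_minus_eq)

instantiation zhat :: comm_ring_1
begin

lift_definition zero_zhat :: zhat is "\<lambda>_. 0" by simp

lift_definition one_zhat :: zhat is "\<lambda>n. 1 mod int (Suc n)"
  by (simp only: mod_int_Suc_mod_int_Suc simp_thms)

lift_definition plus_zhat :: "zhat \<Rightarrow> zhat \<Rightarrow> zhat" is "\<lambda>x y n. (x n + y n) mod int (Suc n)"
  by (intro allI impI zhat_compatible(1)) auto

lift_definition uminus_zhat :: "zhat \<Rightarrow> zhat" is "\<lambda>x n. (- x n) mod int (Suc n)"
  by (intro allI impI zhat_compatible(4)[where b = 0 and d = 0]) auto

lift_definition minus_zhat :: "zhat \<Rightarrow> zhat \<Rightarrow> zhat" is "\<lambda>x y n. (x n - y n) mod int (Suc n)"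
  by (intro allI impI zhat_compatible(2)) auto

lift_definition times_zhat :: "zhat \<Rightarrow> zhat \<Rightarrow> zhat" is "\<lambda>x y n. (x n * y n) mod int (Suc n)"
  by (intro allI impI zhat_compatible(3)) auto

instance
proof
  fix a b c :: zhat
  show "a * b * c = a * (b * c)"
    by transfer (simp only: mod_mult_left_eq mod_mult_right_eq mult.assoc)
  show "a * b = b * a" by transfer (simp only: mult.commute)
  show "1 * a = a"
    by transfer (simp only: mod_mult_left_eq mult_1_left fun_eq_iff dvd_refl simp_thms)
  show "a + b + c = a + (b + c)"
    by transfer (simp only: mod_add_left_eq mod_add_right_eq add.assoc)
  show "a + b = b + a" by transfer (simp only: add.commute)
  show "0 + a = a" by transfer (simp only: add_0 fun_eq_iff dvd_refl simp_thms)
  show "- a + a = 0" by transfer (simp only: mod_add_left_eq, simp)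
  show "a - b = a + - b"
    by transfer (simp only: mod_add_right_eq, simp)
  show "(a + b) * c = a * c + b * c"
    by transfer (simp only: mod_add_eq mod_mult_left_eq distrib_right)
  show "(0::zhat) \<noteq> 1"
    by transfer (auto simp: fun_eq_iff intro!: exI[of _ 1])
qed

end

lemma Rep_zhat_of_nat: "Rep_zhat (of_nat k) n = int k mod int (Suc n)"
proof (induction k)
  case 0
  then show ?case by (simp add: zero_zhat.rep_eq)
next
  case (Suc k)
  have "(1 mod int (Suc n) + int k mod int (Suc n)) mod int (Suc n) = (1 + int k) mod int (Suc n)"
    by (rule mod_add_eq)
  with Suc show ?case by (simp add: plus_zhat.rep_eq one_zhat.rep_eq)
qed

instance zhat :: ring_char_0
proof
  show "inj (of_nat :: nat \<Rightarrow> zhat)"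
  proof (rule injI)
    fix k l :: nat
    assume "(of_nat k :: zhat) = of_nat l"
    then have "int k mod int (Suc (k + l)) = int l mod int (Suc (k + l))"
      by (metis Rep_zhat_of_nat)
    then show "k = l" by simp
  qed
qed

definition is_order :: "'h::quaternion_algebra set \<Rightarrow> bool"
  where "is_order R \<longleftrightarrow>
    1 \<in> R \<and> (\<forall>x\<in>R. \<forall>y\<in>R. x - y \<in> R \<and> x * y \<in> R) \<and>
    (\<exists>S. finite S \<and> R = {\<Sum>x\<in>S. of_int (k x) * x | k. True}) \<and>
    rat_vector.span R = UNIV"

definition maximal_order :: "'h::quaternion_algebra set \<Rightarrow> bool"
  where "maximal_order R \<longleftrightarrow> is_order R \<and> (\<forall>R'. is_order R' \<and> R \<subseteq> R' \<longrightarrow> R' = R)"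

text \<open>
  For an order \<open>R\<close>, the rationalisation of the tensor product of \<open>R\<close> and \<open>zhat\<close> is canonically
  the tensor product of \<open>'h\<close> and \<open>zhat\<close>, as \<open>'h\<close> is the rationalisation of \<open>R\<close>.
\<close>

type_synonym 'h adeles = "('h, zhat) tensor"

text \<open>
  The image of the tensor product of \<open>R\<close> and \<open>zhat\<close> in the adeles; it is isomorphic to that tensor
  product because \<open>zhat\<close> is torsion-free, hence flat.
\<close>

definition order_hat :: "'h::quaternion_algebra set \<Rightarrow> 'h adeles set"
  where "order_hat R = {\<Sum>k<n. tensor (a k) (z k) | (n::nat) a z. \<forall>k<n. a k \<in> R}"

definition adele_vec :: "'h::quaternion_algebra ^ 'n \<Rightarrow> 'h adeles ^ 'n"
  where "adele_vec x = (\<chi> i. tensor (x $ i) 1)"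

definition dagger :: "'b::involution_ring ^ 'n ^ 'm \<Rightarrow> 'b ^ 'm ^ 'n"
  where "dagger M = (\<chi> i j. invol (M $ j $ i))"

definition fixed_ring :: "'b::involution_ring set \<Rightarrow> 'b set"
  where "fixed_ring B = {x \<in> B. invol x = x}"

definition GU :: "'b::involution_ring set \<Rightarrow> ('b ^ 'n ^ 'n) set"
  where "GU B = {M. (\<forall>i j. M $ i $ j \<in> B) \<and>
    (\<exists>l\<in>fixed_ring B. (\<exists>m\<in>fixed_ring B. l * m = 1 \<and> m * l = 1) \<and> dagger M ** M = mat l)}"

definition left_cosets :: "('b::semiring_1 ^ 'n ^ 'n) set \<Rightarrow> ('b ^ 'n ^ 'n) set \<Rightarrow> ('b ^ 'n ^ 'n) set set"
  where "left_cosets G K = (\<lambda>M. (\<lambda>U. M ** U) ` K) ` G"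

definition kappa :: "'h::quaternion_algebra set \<Rightarrow> 'h adeles ^ 'n ^ 'n \<Rightarrow> ('h ^ 'n) set"
  where "kappa R M = {x. adele_vec x \<in> (\<lambda>w. M *v w) ` {w. \<forall>i. w $ i \<in> order_hat R}}"

definition right_scale :: "'h::times ^ 'n \<Rightarrow> 'h \<Rightarrow> 'h ^ 'n"
  where "right_scale x a = (\<chi> i. x $ i * a)"

definition fg_right_submodule :: "'h::ring_1 set \<Rightarrow> ('h ^ 'n) set \<Rightarrow> bool"
  where "fg_right_submodule R L \<longleftrightarrow>
    (\<exists>S. finite S \<and> L = {\<Sum>x\<in>S. right_scale x (a x) | a. \<forall>x\<in>S. a x \<in> R})"

definition right_dual :: "'h::ring_1 set \<Rightarrow> ('h ^ 'n) set \<Rightarrow> ('h ^ 'n \<Rightarrow> 'h) set"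
  where "right_dual R L = {f. (\<forall>x\<in>L. f x \<in> R) \<and> (\<forall>x\<in>L. \<forall>y\<in>L. f (x + y) = f x + f y) \<and>
    (\<forall>x\<in>L. \<forall>a\<in>R. f (right_scale x a) = f x * a)}"

definition herm :: "rat \<Rightarrow> 'h::quaternion_algebra ^ 'n \<Rightarrow> 'h ^ 'n \<Rightarrow> 'h"
  where "herm c x y = c *\<^sub>Q (\<Sum>i\<in>UNIV. invol (x $ i) * y $ i)"

text \<open>Unimodular: the form identifies \<open>L\<close> with its dual module, the linear maps from \<open>L\<close> to \<open>R\<close>.\<close>

definition unimodular_on ::
  "'h::quaternion_algebra set \<Rightarrow> ('h ^ 'n) set \<Rightarrow> ('h ^ 'n \<Rightarrow> 'h ^ 'n \<Rightarrow> 'h) \<Rightarrow> bool"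
  where "unimodular_on R L h \<longleftrightarrow> (\<forall>f\<in>right_dual R L. \<exists>!x. x \<in> L \<and> (\<forall>y\<in>L. f y = h x y))"

definition principally_polarized :: "'h::quaternion_algebra set \<Rightarrow> ('h ^ 'n) set \<Rightarrow> bool"
  where "principally_polarized R L \<longleftrightarrow>
    fg_right_submodule R L \<and> rat_vector.span L = UNIV \<and>
    (\<exists>c. c \<noteq> 0 \<and> (\<forall>x\<in>L. \<forall>y\<in>L. herm c x y \<in> R) \<and> unimodular_on R L (herm c))"

end

theory Submission
  imports Defs
begin

text \<open>
  The crux is that every principally polarized \<open>L\<close> is of the form \<open>kappa R M\<close>: the completion of \<open>L\<close>
  must have an orthonormal basis for the form \<open>c x\<^sup>\<dagger> y\<close>.  It is obtained as a limit of systems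
  of vectors of \<open>L\<close> that are orthonormal modulo \<open>k!\<close>; by the Chinese remainder theorem these need
  only be found modulo prime powers, where they are built by Gram-Schmidt.  The local input is an
  elementary consequence of maximality: an element \<open>a\<close> with integral reduced norm and with \<open>trd (a b)\<close>
  integral for all \<open>b\<close> in \<open>R\<close> lies in \<open>R\<close>.  It yields that the radical of the trace form modulo
  \<open>p\<close> is locally principal, and that the reduced norm represents all units modulo powers of \<open>p\<close>,
  without a case distinction between split and ramified primes.

  Conversely, \<open>kappa R M\<close> is dense in the set of all \<open>M *v w\<close> with \<open>w\<close> integral, so it determines the
  coset of \<open>M\<close>, and it inherits unimodularity from the standard form after splitting the multiplier of \<open>M\<close> into a rational
  number and an integral unit.
\<close>

section \<open>Reduced trace and norm\<close>

text \<open>Completions at single primes never appear: everything local is a congruence in the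
  global \<open>R\<close> or \<open>L\<close>, written
  \<open>(1 / of_nat N) *\<^sub>Q x \<in> R\<close>. Systems that are orthonormal modulo different
  numbers need not be compatible, so a compactness argument has to precede the passage to the limit.
  Factorials serve as moduli because they form a divisibility chain that is cofinal among the
  positive integers, so a single sequence takes care of all primes at once.

  Noncommutativity is the other obstacle. No determinant turns a left inverse of an adelic matrix
  into a right inverse; rational approximation and a dimension count over the rationals replace it.
  Integrality and vanishing of adeles are read off from the traces \<open>x + invol x\<close>
  against a fixed finite dual system, which brings these questions down to \<open>zhat\<close>.

  The splitting of the multiplier reflects that every finite idele of the rationals is a rational
  number times an integral unit.\<close>

lemmas scaleQ_simps =
  rat_vector.scale_zero_left rat_vector.scale_zero_right rat_vector.scale_minus_left
  rat_vector.scale_minus_right rat_vector.scale_one rat_vector.scale_scale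

declare scaleQ_simps [simp] mult_scaleQ_left [simp] mult_scaleQ_right [simp]

lemmas scaleQ_diff_right = rat_vector.scale_right_diff_distrib
  and scaleQ_diff_left = rat_vector.scale_left_diff_distrib

lemma of_nat_scaleQ_one: "of_nat k *\<^sub>Q (1::'a::rat_algebra_1) = of_nat k"
  by (induction k) (simp_all add: scaleQ_add_left)

lemma of_int_scaleQ_one: "of_int k *\<^sub>Q (1::'a::rat_algebra_1) = of_int k"
  by (cases k) (simp_all add: of_nat_scaleQ_one scaleQ_add_left scaleQ_diff_left)

lemma of_int_mult_scaleQ: "of_int k * (x::'a::rat_algebra_1) = of_int k *\<^sub>Q x"
  by (simp flip: of_int_scaleQ_one)

lemma scaleQ_sum_right: "q *\<^sub>Q sum f A = (\<Sum>x\<in>A. q *\<^sub>Q (f x :: 'a::rat_vector))"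
  by (rule rat_vector.scale_sum_right)

lemma additive_of_nat_scaleQ:
  fixes f :: "'a::rat_vector \<Rightarrow> 'b::rat_vector"
  assumes "\<And>x y. f (x + y) = f x + f y"
  shows "f (of_nat n *\<^sub>Q x) = of_nat n *\<^sub>Q f x"
proof (induction n)
  case 0
  show ?case using assms[of 0 0] by simp
qed (simp add: scaleQ_add_left assms)

text \<open>Clear the denominator of \<open>q\<close>, then divide in the target. Compatibility of
  \<open>invol\<close> and of the hermitian forms with rational scalars thereby follows from
  additivity alone.\<close>

lemma additive_scaleQ:
  fixes f :: "'a::rat_vector \<Rightarrow> 'b::rat_vector"
  assumes add: "\<And>x y. f (x + y) = f x + f y"
  shows "f (q *\<^sub>Q x) = q *\<^sub>Q f x"
proof -
  have f0: "f 0 = 0" using add[of 0 0] by simp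
  have minus: "f (- y) = - f y" for y
    using add[of y "- y"] f0 by (simp add: eq_neg_iff_add_eq_0 add.commute)
  have int: "f (of_int k *\<^sub>Q y) = of_int k *\<^sub>Q f y" for k y
  proof (cases k rule: int_cases2)
    case (nonneg n)
    then show ?thesis using additive_of_nat_scaleQ[of f, OF add] by simp
  next
    case (nonpos n)
    then show ?thesis using additive_of_nat_scaleQ[of f, OF add] by (simp add: minus)
  qed
  obtain m n where q: "q = of_int m / of_int n" "n > 0"
    by (metis quotient_of_div quotient_of_denom_pos surj_pair)
  have "of_int n *\<^sub>Q f (q *\<^sub>Q x) = f (of_int n *\<^sub>Q q *\<^sub>Q x)" by (simp only: int)
  also have "\<dots> = of_int m *\<^sub>Q f x" using q by (simp flip: int)
  finally have "(1 / of_int n) *\<^sub>Q of_int n *\<^sub>Q f (q *\<^sub>Q x) =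
    (1 / of_int n) *\<^sub>Q of_int m *\<^sub>Q f x" by simp
  then show ?thesis using q by simp
qed

lemma invol_zero [simp]: "invol (0::'a::involution_ring) = 0"
  using invol_add[of 0 "0::'a"] by simp

lemma invol_uminus: "invol (- x::'a::involution_ring) = - invol x"
  using invol_add[of x "- x"] by (simp add: eq_neg_iff_add_eq_0 add.commute)

lemma invol_diff: "invol (x - y::'a::involution_ring) = invol x - invol y"
  using invol_add[of x "- y"] by (simp add: invol_uminus)

lemma invol_sum: "invol (sum f A) = (\<Sum>x\<in>A. invol (f x :: 'a::involution_ring))"
  by (induction A rule: infinite_finite_induct) (simp_all add: invol_add)

lemma invol_scaleQ [simp]: "invol (q *\<^sub>Q (x::'a::{rat_algebra_1, involution_ring})) =
  q *\<^sub>Q invol x"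
  by (rule additive_scaleQ) (rule invol_add)

declare invol_invol [simp] invol_one [simp]

lemma rat_common_denominator:
  assumes "finite (A :: rat set)"
  shows "\<exists>d::nat. d > 0 \<and> (\<forall>q\<in>A. of_nat d * q \<in> \<int>)"
  using assms
proof induction
  case empty
  show ?case by (intro exI[of _ 1]) simp
next
  case (insert q A)
  then obtain d where d: "d > 0" "\<forall>q\<in>A. of_nat d * q \<in> \<int>" by blast
  obtain m n where q: "q = of_int m / of_int n" "n > 0"
    by (metis quotient_of_div quotient_of_denom_pos surj_pair)
  have 1: "of_nat (d * nat n) * q = of_int (int d * m)" using q by simp
  have "of_nat (d * nat n) * r \<in> \<int>" if "r \<in> A" for r
  proof -
    have "of_nat (d * nat n) * r = of_int n * (of_nat d * r)" using q by simp
    then show ?thesis using d that by (metis Ints_mult Ints_of_int)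
  qed
  then show ?case using 1 d q by (intro exI[of _ "d * nat n"]) (auto simp del: of_nat_mult of_int_mult)
qed

lemma span_denominator:
  fixes G :: "'a::rat_vector set"
  assumes add: "\<And>x y. x \<in> G \<Longrightarrow> y \<in> G \<Longrightarrow> x +
    y \<in> G" and scale: "\<And>q x. q \<in> \<int> \<Longrightarrow> x \<in> G \<Longrightarrow>
      q *\<^sub>Q x \<in> G"
    and "0 \<in> G" "x \<in> rat_vector.span G"
  shows "\<exists>d::nat. d > 0 \<and> of_nat d *\<^sub>Q x \<in> G"
  using assms(4)
proof (induction rule: rat_vector.span_induct_alt)
  case base
  show ?case using assms(3) by (auto intro!: exI[of _ 1])
next
  case (step q x y)
  then obtain d :: nat where d: "d > 0" "of_nat d *\<^sub>Q y \<in> G" by blast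
  obtain e :: nat where e: "e > 0" "of_nat e * q \<in> \<int>" using rat_common_denominator[of "{q}"] by auto
  have "of_nat (d * e) *\<^sub>Q (q *\<^sub>Q x + y) = (of_nat d * (of_nat e * q)) *\<^sub>Q x +
    of_nat e *\<^sub>Q (of_nat d *\<^sub>Q y)"
    by (simp add: scaleQ_add_right mult_ac)
  also have "\<dots> \<in> G" using d e step(1) by (intro add scale[OF _ step(1)] scale[OF _ d(2)]) auto
  finally show ?case using d e by (intro exI[of _ "d * e"]) auto
qed

lemma common_denominator:
  fixes G :: "'a::rat_vector set"
  assumes "\<And>x. \<exists>d::nat. d > 0 \<and> of_nat d *\<^sub>Q x \<in> G"
    and scale: "\<And>x k. x \<in> G \<Longrightarrow> of_nat k *\<^sub>Q x \<in> G" and "finite A"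
  shows "\<exists>d::nat. d > 0 \<and> (\<forall>x\<in>A. of_nat d *\<^sub>Q x \<in> G)"
  using assms(3)
proof induction
  case (insert x A)
  then obtain d where d: "d > 0" "\<forall>x\<in>A. of_nat d *\<^sub>Q x \<in> G" by blast
  obtain e :: nat where e: "e > 0" "of_nat e *\<^sub>Q x \<in> G" using assms(1) by blast
  have "of_nat (d * e) *\<^sub>Q y \<in> G" if "y \<in> insert x A" for y
  proof -
    have "of_nat (d * e) *\<^sub>Q y = of_nat e *\<^sub>Q of_nat d *\<^sub>Q y"
      "of_nat (d * e) *\<^sub>Q y = of_nat d *\<^sub>Q of_nat e *\<^sub>Q y"
      by (simp_all add: mult_ac)
    then show ?thesis using d e that by (metis scale insertE)
  qed
  then show ?case using d e by (intro exI[of _ "d * e"]) auto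
qed (auto intro!: exI[of _ 1])

text \<open>Stands in for an argument by integral closure: the denominator of \<open>q ^ k\<close>
  is \<open>n ^ k\<close>, and it can divide the fixed \<open>d\<close> for all \<open>k\<close>
  only if \<open>n = 1\<close>, as \<open>2 ^ d > d\<close>.\<close>

lemma Ints_if_powers_bounded:
  fixes q :: rat
  assumes "d > 0" "\<And>k. of_nat d * q ^ k \<in> \<int>"
  shows "q \<in> \<int>"
proof -
  obtain m n where q: "q = of_int m / of_int n" "n > 0" "coprime m n"
    by (metis quotient_of_div quotient_of_denom_pos quotient_of_coprime surj_pair)
  have "n ^ k dvd int d" for k
  proof -
    obtain l where "of_nat d * q ^ k = of_int l" using assms(2)[of k] by (elim Ints_cases)
    then have "(of_int (int d * m ^ k) :: rat) = of_int (l * n ^ k)" using q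
      by (simp add: field_simps power_divide)
    then have "int d * m ^ k = l * n ^ k" by (simp only: of_int_eq_iff)
    then have "n ^ k dvd int d * m ^ k" by simp
    moreover have "coprime (n ^ k) (m ^ k)" using q(3) by (simp add: coprime_commute)
    ultimately show ?thesis by (simp add: coprime_dvd_mult_left_iff)
  qed
  then have "n ^ d \<le> int d" using assms(1) by (intro zdvd_imp_le) auto
  moreover have "int d < 2 ^ d" using of_nat_less_two_power[where 'a = int] by simp
  ultimately have "\<not> n \<ge> 2" using power_mono[of 2 n d] by linarith
  then have "n = 1" using q(2) by simp
  then show ?thesis using q by simp
qed

lemma zero_if_powers_divide:
  fixes q :: rat
  assumes "N \<ge> 2" "\<And>k. q / of_nat N ^ k \<in> \<int>"
  shows "q = 0"
proof (rule ccontr)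
  assume "q \<noteq> 0"
  obtain m where m: "q = of_int m" using assms(2)[of 0] by (auto elim: Ints_cases)
  \<comment> \<open>With this exponent \<open>N ^ k \<ge> 2 ^ k > \<bar>m\<bar>\<close>, so
    \<open>N ^ k\<close> cannot divide the nonzero \<open>m\<close>.\<close>
  define k where "k = nat \<bar>m\<bar>"
  obtain l where "q / of_nat N ^ k = of_int l" using assms(2) by (auto elim: Ints_cases)
  then have "(of_int m :: rat) = of_int (l * int N ^ k)" using assms(1) m by (simp add: field_simps)
  then have "m = l * int N ^ k" by (simp only: of_int_eq_iff)
  then have "int N ^ k dvd m" by simp
  then have "int N ^ k \<le> \<bar>m\<bar>" using \<open>q \<noteq> 0\<close> m by (intro zdvd_imp_le) auto
  moreover have "int k < 2 ^ k" using of_nat_less_two_power[where 'a = int] by simp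
  moreover have "2 ^ k \<le> int N ^ k" using assms(1) by (intro power_mono) auto
  ultimately show False by (simp add: k_def)
qed

definition trd :: "'h::quaternion_algebra \<Rightarrow> rat"
  where "trd x = (SOME t. x + invol x = t *\<^sub>Q 1)"

definition nrd :: "'h::quaternion_algebra \<Rightarrow> rat"
  where "nrd x = (SOME n. x * invol x = n *\<^sub>Q 1)"

lemma add_invol: "x + invol x = trd x *\<^sub>Q 1"
  unfolding trd_def by (rule someI_ex) (rule trace_rational)

lemma mult_invol: "x * invol x = nrd x *\<^sub>Q 1"
  unfolding nrd_def by (rule someI_ex) (rule norm_rational)

lemma scaleQ_one_eq_iff [simp]: "p *\<^sub>Q (1::'a::rat_algebra_1) =
  q *\<^sub>Q 1 \<longleftrightarrow> p = q"
  by simp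

lemma trd_eqI: "x + invol x = t *\<^sub>Q 1 \<Longrightarrow> trd x = t"
  by (simp add: add_invol)

lemma nrd_eqI: "x * invol x = n *\<^sub>Q 1 \<Longrightarrow> nrd x = n"
  by (simp add: mult_invol)

lemma invol_eq: "invol x = trd x *\<^sub>Q 1 - x"
  by (simp flip: add_invol)

lemma invol_mult_self: "invol x * x = nrd x *\<^sub>Q 1"
proof -
  have "invol x * x = x * invol x" by (simp add: invol_eq algebra_simps)
  then show ?thesis by (simp add: mult_invol)
qed

lemma trd_add: "trd (x + y) = trd x + trd y"
  by (rule trd_eqI) (simp add: scaleQ_add_left invol_add flip: add_invol)

lemma trd_scaleQ: "trd (q *\<^sub>Q x) = q * trd x"
  by (rule trd_eqI) (simp add: scaleQ_add_right flip: scaleQ_add_right add_invol scaleQ_scaleQ)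

lemma trd_zero [simp]: "trd 0 = 0"
  using trd_add[of 0 0] by simp

lemma trd_uminus: "trd (- x) = - trd x"
  using trd_scaleQ[of "-1" x] by simp

lemma trd_diff: "trd (x - y) = trd x - trd y"
  using trd_add[of x "- y"] by (simp add: trd_uminus)

lemma trd_invol [simp]: "trd (invol x) = trd x"
  by (rule trd_eqI) (simp add: add.commute flip: add_invol)

lemma trd_one [simp]: "trd 1 = 2"
  by (rule trd_eqI) (simp add: scaleQ_add_left[of 1 1 "1::'a", simplified])

lemma nrd_mult: "nrd (x * y) = nrd x * nrd y"
proof (rule nrd_eqI)
  have "x * y * invol (x * y) = x * (y * invol y) * invol x" by (simp add: invol_mult mult.assoc)
  also have "\<dots> = (nrd x * nrd y) *\<^sub>Q 1" by (simp add: mult_invol mult.commute)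
  finally show "x * y * invol (x * y) = (nrd x * nrd y) *\<^sub>Q 1" .
qed

lemma nrd_one [simp]: "nrd 1 = 1"
  by (rule nrd_eqI) simp

lemma nrd_scaleQ: "nrd (q *\<^sub>Q x) = q\<^sup>2 * nrd x"
  by (rule nrd_eqI) (simp add: mult_invol power2_eq_square mult.assoc)

lemma nrd_zero [simp]: "nrd 0 = 0"
  using nrd_scaleQ[of 0 "0::'a"] by simp

lemma nrd_uminus [simp]: "nrd (- x) = nrd x"
  using nrd_scaleQ[of "-1" x] by simp

lemma nrd_invol [simp]: "nrd (invol x) = nrd x"
  by (rule nrd_eqI) (simp add: invol_mult_self)

lemma nrd_add: "nrd (x + y) = nrd x + nrd y + trd (x * invol y)"
  by (rule nrd_eqI)
    (simp add: invol_add algebra_simps scaleQ_add_left invol_mult flip: mult_invol add_invol)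

lemma nrd_diff: "nrd (x - y) = nrd x + nrd y - trd (x * invol y)"
  using nrd_add[of x "- y"] by (simp add: invol_uminus trd_uminus)

text \<open>Both sides are polarisations of \<open>nrd\<close>, at \<open>x\<close>,
  \<open>invol y\<close> and at \<open>invol x\<close>, \<open>y\<close>; these agree because
  \<open>nrd\<close> is invariant under \<open>invol\<close>.\<close>

lemma trd_mult_commute: "trd (x * y) = trd (y * x)"
proof -
  have "trd (x * y) = nrd (x + invol y) - nrd x - nrd y" by (simp add: nrd_add)
  also have "nrd (x + invol y) = nrd (invol x + y)" by (metis nrd_invol invol_add invol_invol)
  also have "\<dots> - nrd x - nrd y = trd (invol x * invol y)" by (simp add: nrd_add)
  also have "\<dots> = trd (y * x)" by (simp flip: invol_mult)
  finally show ?thesis .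
qed

lemma sandwich: "a * c * a = trd (c * a) *\<^sub>Q a - nrd a *\<^sub>Q invol c"
proof -
  have "a * c * a = a * (trd (c * a) *\<^sub>Q 1 - invol (c * a))" by (simp add: mult.assoc flip: add_invol)
  also have "\<dots> = trd (c * a) *\<^sub>Q a - a * invol a * invol c"
    by (simp add: algebra_simps invol_mult)
  finally show ?thesis by (simp add: mult_invol)
qed

lemma square_eq: "a * a = trd a *\<^sub>Q a - nrd a *\<^sub>Q 1"
  using sandwich[of a 1] by simp

text \<open>Lets a bound on the denominators of traces bound those of norms, before either is known
  to be integral.\<close>

lemma nrd_eq_trd: "2 * nrd a = trd a ^ 2 - trd (a * a)"
  by (simp add: square_eq trd_diff trd_scaleQ power2_eq_square)

text \<open>The reduced trace form has an orthogonal basis of non-isotropic vectors, namely 1, i, j, ij.\<close>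

lemma trace_dual_basis:
  "\<exists>(e :: nat \<Rightarrow> 'h::quaternion_algebra) c. \<forall>x. x =
    (\<Sum>m<4. (c m * trd (x * e m)) *\<^sub>Q e m)"
  and quaternion_noncommutative: "\<exists>x y :: 'h. x * y \<noteq> y * x"
proof -
  obtain i j :: 'h and a b
    where ij: "a \<noteq> 0" "b \<noteq> 0" "i * i = a *\<^sub>Q 1" "j * j = b *\<^sub>Q 1"
      "j * i = - (i * j)"
    and span: "\<And>x. \<exists>t u v w. x = t *\<^sub>Q 1 + u *\<^sub>Q i + v *\<^sub>Q j +
      w *\<^sub>Q (i * j)"
    and indep: "\<And>t u v w. t *\<^sub>Q 1 + u *\<^sub>Q i + v *\<^sub>Q j + w *\<^sub>Q (i * j) = 0
          \<Longrightarrow> t = 0 \<and> u = 0 \<and> v = 0 \<and> w = 0"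
    using quaternion_basis[where 'a = 'h] by metis
  \<comment> \<open>If \<open>x * x\<close> is a scalar, the quadratic equation
    \<open>square_eq\<close> makes \<open>trd x *\<^sub>Q x\<close> a scalar too; as
    \<open>x\<close> is independent of 1, its trace vanishes.\<close>
  have traceless: "trd x = 0"
    if "x * x = d *\<^sub>Q 1" "\<And>p q. p *\<^sub>Q 1 + q *\<^sub>Q x = 0 \<Longrightarrow> q = 0"
      for x :: 'h and d
  proof -
    have "(- nrd x - d) *\<^sub>Q 1 + trd x *\<^sub>Q x = 0" using that(1) square_eq[of x]
      by (simp add: scaleQ_diff_left algebra_simps)
    then show ?thesis by (rule that(2))
  qed
  have ji: "j * (i * x) = - (i * (j * x))" for x using ij(5) by (metis minus_mult_left mult.assoc)
  have ii: "i * (i * x) = a *\<^sub>Q x" for x using ij(3) by (metis mult.assoc mult_1_left mult_scaleQ_left)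
  have jj: "j * (j * x) = b *\<^sub>Q x" for x using ij(4) by (metis mult.assoc mult_1_left mult_scaleQ_left)
  have sq: "(i * j) * (i * j) = (- (a * b)) *\<^sub>Q 1"
    by (simp add: mult.assoc ji ii ij)
  have ti: "trd i = 0" using traceless[OF ij(3)] indep[of _ _ 0 0] by simp
  have tj: "trd j = 0" using traceless[OF ij(4)] indep[of _ 0 _ 0] by simp
  have tij: "trd (i * j) = 0" using traceless[OF sq] indep[of _ 0 0 _] by simp
  have eval: "trd x = 2 * t" "trd (x * i) = 2 * a * u" "trd (x * j) = 2 * b * v"
    "trd (x * (i * j)) = - 2 * a * b * w"
    if "x = t *\<^sub>Q 1 + u *\<^sub>Q i + v *\<^sub>Q j + w *\<^sub>Q (i * j)" for x :: 'h and t u v w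
    unfolding that
    by (simp_all add: distrib_right trd_add trd_scaleQ trd_uminus trd_diff ti tj tij mult.assoc ij ji ii jj)
  define e where "e m = (if m = 0 then 1 else if m = 1 then i else if m = 2 then j else i * j)" for m :: nat
  \<comment> \<open>The weights are the inverses of \<open>trd (e m * e m)\<close>, that is of 2,
    \<open>2 * a\<close>, \<open>2 * b\<close> and \<open>- (2 * a * b)\<close>.\<close>
  define c where "c m = (if m = 0 then 1/2 else if m = 1 then 1/(2*a) else if m = 2 then 1/(2*b) else -
    (1/(2*a*b)))" for m :: nat
  have "x = (\<Sum>m<4. (c m * trd (x * e m)) *\<^sub>Q e m)" for x
  proof -
    obtain t u v w where x: "x = t *\<^sub>Q 1 + u *\<^sub>Q i + v *\<^sub>Q j + w *\<^sub>Q (i * j)"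
      using span by blast
    show ?thesis using eval[OF x] ij(1,2)
      by (subst x) (simp add: eval_nat_numeral e_def c_def)
  qed
  then show "\<exists>(e :: nat \<Rightarrow> 'h) c. \<forall>x. x =
    (\<Sum>m<4. (c m * trd (x * e m)) *\<^sub>Q e m)" by blast
  have "i * j \<noteq> j * i"
  proof
    assume "i * j = j * i"
    then have "i * j + i * j = 0" using ij(5) by (metis add.right_inverse)
    then have "2 *\<^sub>Q (i * j) = 0" using scaleQ_add_left[of 1 1 "i * j"] by simp
    then show False using indep[of 0 0 0 2] by simp
  qed
  then show "\<exists>x y :: 'h. x * y \<noteq> y * x" by blast
qed

lemma trd_nondegenerate: "(\<And>z. trd (x * z) = 0) \<Longrightarrow> x = 0"
  using trace_dual_basis(1)
    by (metis (no_types, lifting) sum.neutral mult_zero_right rat_vector.scale_zero_left)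

section \<open>Orders\<close>

interpretation int_mod: module "\<lambda>(k::int) (x::'a::ring_1). of_int k * x"
  by unfold_locales (simp_all add: algebra_simps)

lemma int_span_mult_closed:
  assumes "\<And>x y. x \<in> S \<Longrightarrow> y \<in> S \<Longrightarrow> x * y \<in> int_mod.span S"
    and "x \<in> int_mod.span S" "y \<in> int_mod.span S"
  shows "x * y \<in> int_mod.span S"
proof -
  have *: "x * y \<in> int_mod.span S" if "x \<in> S" for x
    using assms(3)
  proof (induction rule: int_mod.span_induct)
    case base
    show ?case
      by (auto simp: int_mod.subspace_def distrib_left intro: int_mod.span_add int_mod.span_zero)
        (metis Ints_of_int int_mod.span_scale mult.assoc mult_of_int_commute)
  qed (use assms(1) that in auto)
  show ?thesis
    using assms(2)
  proof (induction rule: int_mod.span_induct)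
    case base
    show ?case
      by (auto simp: int_mod.subspace_def distrib_right mult.assoc
          intro: int_mod.span_add int_mod.span_zero int_mod.span_scale)
  qed (use * in auto)
qed

text \<open>The bridge between divisibility of integers and the form
  \<open>q / of_nat N \<in> \<int>\<close> in which congruences between rational traces and norms
  are stated.\<close>

lemma of_int_div_Ints_iff:
  assumes "N > 0"
  shows "(of_int k / of_nat N :: rat) \<in> \<int> \<longleftrightarrow> int N dvd k"
proof
  assume "(of_int k / of_nat N :: rat) \<in> \<int>"
  then obtain l where "(of_int k / of_nat N :: rat) = of_int l" by (elim Ints_cases)
  then have "(of_int k :: rat) = of_int (l * int N)" using assms by (simp add: field_simps)
  then show "int N dvd k" by (simp only: of_int_eq_iff) simp
next
  assume "int N dvd k"
  then show "(of_int k / of_nat N :: rat) \<in> \<int>" using assms by (auto elim!: dvdE)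
qed

lemma prime_Ints_mult:
  fixes a b :: rat
  assumes "prime (p::nat)" "a \<in> \<int>" "b \<in> \<int>" "a * b / of_nat p \<in> \<int>"
  shows "a / of_nat p \<in> \<int> \<or> b / of_nat p \<in> \<int>"
proof -
  obtain k l where kl: "a = of_int k" "b = of_int l" using assms(2,3) by (elim Ints_cases)
  have p: "p > 0" using assms(1) prime_gt_0_nat by auto
  have "int p dvd k * l" using assms(4) of_int_div_Ints_iff[OF p, of "k * l"] kl by simp
  then have "int p dvd k \<or> int p dvd l" using assms(1) by (simp add: prime_dvd_mult_iff)
  then show ?thesis using kl of_int_div_Ints_iff[OF p] by auto
qed

locale quaternion_order =
  fixes R :: "'h::quaternion_algebra set"
  assumes is_order: "is_order R"
begin

lemma R_one [simp]: "1 \<in> R" and R_mult: "x \<in> R \<Longrightarrow> y \<in> R \<Longrightarrow>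
  x * y \<in> R"
  and R_diff: "x \<in> R \<Longrightarrow> y \<in> R \<Longrightarrow> x - y \<in> R"
  using is_order by (auto simp: is_order_def)

lemma R_zero [simp]: "0 \<in> R" using R_diff[of 1 1] by simp

lemma R_uminus: "x \<in> R \<Longrightarrow> - x \<in> R" using R_diff[of 0 x] by simp

lemma R_add: "x \<in> R \<Longrightarrow> y \<in> R \<Longrightarrow> x + y \<in> R"
  using R_diff[of x "- y"] R_uminus by simp

lemma R_sum: "(\<And>i. i \<in> A \<Longrightarrow> f i \<in> R) \<Longrightarrow> sum f A \<in> R"
  by (induction A rule: infinite_finite_induct) (auto intro: R_add)

lemma R_power: "x \<in> R \<Longrightarrow> x ^ k \<in> R"
  by (induction k) (auto intro: R_mult)

lemma R_generators: obtains S where "finite S" "S \<subseteq> R" "R = int_mod.span S"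
proof -
  obtain S where S: "finite S" "R = {\<Sum>x\<in>S. of_int (k x) * x | k. True}" using is_order
    by (auto simp: is_order_def)
  then have "R = int_mod.span S" by (auto simp: int_mod.span_finite)
  then show ?thesis using that[of S] S int_mod.span_superset[of S] by auto
qed

lemma R_of_int [simp]: "of_int k \<in> R"
proof -
  obtain S where "R = int_mod.span S" using R_generators .
  then show ?thesis using int_mod.span_scale[of 1 S k] by auto (metis R_one)
qed

lemma R_scale_Ints: "q \<in> \<int> \<Longrightarrow> x \<in> R \<Longrightarrow> q *\<^sub>Q x \<in> R"
  by (metis Ints_cases R_mult R_of_int of_int_mult_scaleQ)

lemma R_denominator: "\<exists>d::nat. d > 0 \<and> of_nat d *\<^sub>Q x \<in> R"
  using is_order by (intro span_denominator R_add R_scale_Ints) (auto simp: is_order_def)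

lemma R_common_denominator: "finite A \<Longrightarrow> \<exists>d::nat. d > 0 \<and>
  (\<forall>x\<in>A. of_nat d *\<^sub>Q x \<in> R)"
  by (rule common_denominator[OF R_denominator R_scale_Ints[OF Ints_of_nat]])

lemma trd_bounded: "\<exists>d::nat. d > 0 \<and> (\<forall>x\<in>R. of_nat d * trd x \<in> \<int>)"
proof -
  obtain S where S: "finite S" "R = int_mod.span S" using R_generators by blast
  obtain d :: nat where d: "d > 0" "\<forall>q\<in>trd ` S. of_nat d * q \<in> \<int>"
    using rat_common_denominator[of "trd ` S"] S by auto
  have "of_nat d * trd x \<in> \<int>" if "x \<in> int_mod.span S" for x
    using that
  proof (induction rule: int_mod.span_induct)
    case base
    have "of_nat d * trd (of_int c * x) = of_int c * (of_nat d * trd x)" for c x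
      by (simp add: of_int_mult_scaleQ trd_scaleQ)
    then have "of_nat d * trd x \<in> \<int> \<Longrightarrow>
      of_nat d * trd (of_int c * x) \<in> \<int>" for c x
      by (metis Ints_mult Ints_of_int)
    then show ?case by (auto intro!: int_mod.subspaceI simp: trd_add distrib_left)
  qed (use d in auto)
  then show ?thesis using d S by auto
qed

text \<open>The powers of \<open>x\<close> stay in \<open>R\<close>, where traces have a common
  denominator \<open>d\<close>; by \<open>nrd_eq_trd\<close> all powers of \<open>nrd x\<close> then
  have denominators dividing \<open>2 * d ^ 2\<close>.\<close>

lemma nrd_Ints: "x \<in> R \<Longrightarrow> nrd x \<in> \<int>"
proof -
  assume x: "x \<in> R"
  obtain d :: nat where d: "d > 0" "\<And>x. x \<in> R \<Longrightarrow> of_nat d * trd x \<in> \<int>"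
    using trd_bounded by blast
  show "nrd x \<in> \<int>"
  proof (rule Ints_if_powers_bounded)
    show "2 * d ^ 2 > 0" using d by simp
    fix k
    have "nrd x ^ k = nrd (x ^ k)" by (induction k) (simp_all add: nrd_mult)
    then have "of_nat (2 * d ^ 2) * nrd x ^ k = of_nat d ^ 2 * (2 * nrd (x ^ k))" by simp
    also have "\<dots> = (of_nat d * trd (x ^ k)) ^ 2 - of_nat d * (of_nat d * trd (x ^ k * x ^ k))"
      by (simp only: nrd_eq_trd) (simp add: algebra_simps power2_eq_square)
    also have "\<dots> \<in> \<int>" using x
      by (intro Ints_diff Ints_mult Ints_power d(2) R_mult R_power) auto
    finally show "of_nat (2 * d ^ 2) * nrd x ^ k \<in> \<int>" .
  qed
qed

lemma trd_Ints: "x \<in> R \<Longrightarrow> trd x \<in> \<int>"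
proof -
  assume x: "x \<in> R"
  have "trd x = nrd (x + 1) - nrd x - 1" by (simp add: nrd_add)
  also have "\<dots> \<in> \<int>" using x by (intro Ints_diff nrd_Ints R_add) auto
  finally show ?thesis .
qed

lemma R_invol: "x \<in> R \<Longrightarrow> invol x \<in> R"
  unfolding invol_eq by (intro R_diff R_scale_Ints trd_Ints) auto

lemma R_scaleQ_one_iff: "q *\<^sub>Q 1 \<in> R \<longleftrightarrow> q \<in> \<int>"
proof
  assume "q *\<^sub>Q 1 \<in> R"
  then have q: "q *\<^sub>Q 1 \<in> R" .
  have "q ^ k *\<^sub>Q (1::'h) = (q *\<^sub>Q 1) ^ k" for k
    by (induction k) (simp_all flip: scaleQ_scaleQ)
  then have "2 * q ^ k \<in> \<int>" for k using trd_Ints[OF R_power[OF q, of k]]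
    by (metis mult.commute trd_one trd_scaleQ)
  then show "q \<in> \<int>" using Ints_if_powers_bounded[of 2 q] by simp
qed (auto intro: R_scale_Ints)

lemma R_fixed: "x \<in> R \<Longrightarrow> invol x = x \<Longrightarrow> \<exists>k. x = of_int k"
proof -
  assume x: "x \<in> R" "invol x = x"
  have "x = (1/2) *\<^sub>Q (x + x)" by (simp flip: rat_vector.scale_left_distrib add: scaleQ_add_right)
  also have "\<dots> = (trd x / 2) *\<^sub>Q 1" using x(2) add_invol[of x] by simp
  finally have *: "x = (trd x / 2) *\<^sub>Q 1" .
  then have "trd x / 2 \<in> \<int>" using x R_scaleQ_one_iff by metis
  then obtain k where "trd x / 2 = of_int k" by (elim Ints_cases)
  then show ?thesis using * by (metis of_int_scaleQ_one)
qed

text \<open>Integral version of \<open>trace_dual_basis\<close>: up to the fixed factor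
  \<open>D\<close>, an element is an integral combination of vectors of \<open>R\<close>, weighted
  by its traces. Divisibility of all these traces thus passes to the element.\<close>

lemma R_trace_dual:
  "\<exists>(e :: nat \<Rightarrow> 'h) k (D::nat). D > 0 \<and> (\<forall>m<4. e m \<in> R) \<and>
     (\<forall>x. of_nat D *\<^sub>Q x = (\<Sum>m<4. (of_int (k m) * trd (x * e m)) *\<^sub>Q e m))"
proof -
  obtain e :: "nat \<Rightarrow> 'h" and c
    where ec: "\<And>x. x = (\<Sum>m<4. (c m * trd (x * e m)) *\<^sub>Q e m)"
    using trace_dual_basis(1) by blast
  obtain d :: nat where d: "d > 0" "\<forall>x\<in>e ` {..<4}. of_nat d *\<^sub>Q x \<in> R"
    using R_common_denominator[of "e ` {..<4}"] by auto
  \<comment> \<open>The vector \<open>e m\<close> occurs twice in each term, so replacing it by its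
    multiple by \<open>d\<close> costs a factor \<open>d ^ 2\<close>.\<close>
  obtain D :: nat where D: "D > 0"
    "\<forall>q\<in>(\<lambda>m. c m / of_nat d ^ 2) ` {..<4}. of_nat D * q \<in> \<int>"
    using rat_common_denominator[of "(\<lambda>m. c m / of_nat d ^ 2) ` {..<4}"] by auto
  define k where "k m = \<lfloor>of_nat D * (c m / of_nat d ^ 2)\<rfloor>" for m
  have k: "of_int (k m) = of_nat D * (c m / of_nat d ^ 2)" if "m < 4" for m
    unfolding k_def using D that by (auto elim!: Ints_cases)
  have "of_nat D *\<^sub>Q x = (\<Sum>m<4. (of_int (k m) * trd (x * of_nat d *\<^sub>Q e m)) *\<^sub>Q
    of_nat d *\<^sub>Q e m)" for x
    by (subst ec[of x]) (use d(1) in \<open>simp add: scaleQ_sum_right k trd_scaleQ power2_eq_square mult_ac cong: sum.cong_simp\<close>)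
  then show ?thesis using d D
    by (intro exI[of _ "\<lambda>m. of_nat d *\<^sub>Q e m"] exI[of _ k] exI[of _ D]) auto
qed

lemma zero_if_powers_divide_R:
  assumes "N \<ge> 2" "\<And>k. (1 / of_nat N ^ k) *\<^sub>Q x \<in> R"
  shows "x = 0"
proof (rule trd_nondegenerate)
  fix z
  obtain d :: nat where d: "d > 0" "of_nat d *\<^sub>Q z \<in> R" using R_denominator by blast
  have "trd (x * of_nat d *\<^sub>Q z) / of_nat N ^ k \<in> \<int>" for k
    using trd_Ints[OF R_mult[OF assms(2)[of k] d(2)]] by (simp add: trd_scaleQ)
  then have "trd (x * of_nat d *\<^sub>Q z) = 0" using zero_if_powers_divide[OF assms(1)] by blast
  then show "trd (x * z) = 0" using d by (simp add: trd_scaleQ)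
qed

text \<open>If 1 and \<open>v\<close> generated \<open>R\<close> modulo \<open>N\<close>, every
  commutator would be \<open>N\<close> times a combination of commutators in \<open>R\<close>, hence
  by iteration divisible by all powers of \<open>N\<close>, hence zero. The degenerate cases for
  trace and norm below are refuted by reduction to this.\<close>

lemma not_generated_by_two_mod:
  assumes "N \<ge> 2" "v \<in> R"
  shows "\<exists>x\<in>R. \<forall>k l. (1 / of_nat N) *\<^sub>Q (x - of_int k *\<^sub>Q 1 -
    of_int l *\<^sub>Q v) \<notin> R"
proof (rule ccontr)
  assume "\<not> ?thesis"
  then have gen: "\<exists>k l. (1 / of_nat N) *\<^sub>Q (x - of_int k *\<^sub>Q 1 -
    of_int l *\<^sub>Q v) \<in> R" if "x \<in> R" for x
    using that by blast
  have decomp: "\<exists>k l. \<exists>x'\<in>R. x = of_int k *\<^sub>Q 1 + of_int l *\<^sub>Q v +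
    of_nat N *\<^sub>Q x'" if "x \<in> R" for x
  proof -
    obtain k l where kl: "(1 / of_nat N) *\<^sub>Q (x - of_int k *\<^sub>Q 1 -
      of_int l *\<^sub>Q v) \<in> R" (is "?x' \<in> R") using gen[OF \<open>x \<in> R\<close>] by blast
    have "x = of_int k *\<^sub>Q 1 + of_int l *\<^sub>Q v + of_nat N *\<^sub>Q ?x'" using assms(1) by simp
    then show ?thesis using kl by blast
  qed
  have comm: "\<forall>x\<in>R. \<forall>y\<in>R. (1 / of_nat N ^ m) *\<^sub>Q (x * y - y * x) \<in> R" for m
  proof (induction m)
    case 0
    show ?case by (auto intro: R_diff R_mult)
  next
    case (Suc m)
    show ?case
    proof (intro ballI)
      fix x y assume "x \<in> R" "y \<in> R"
      obtain k l x' where x: "x' \<in> R"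
        "x = of_int k *\<^sub>Q 1 + of_int l *\<^sub>Q v + of_nat N *\<^sub>Q x'"
          using decomp \<open>x \<in> R\<close> by blast
      obtain k' l' y' where y: "y' \<in> R"
        "y = of_int k' *\<^sub>Q 1 + of_int l' *\<^sub>Q v + of_nat N *\<^sub>Q y'"
          using decomp \<open>y \<in> R\<close> by blast
      define q where "q = 1 / (of_nat N ^ m :: rat)"
      have N: "of_nat N * (1 / of_nat N ^ Suc m) = q" using assms(1) by (simp add: q_def)
      have "x * y - y * x = of_nat N *\<^sub>Q (of_int l *\<^sub>Q (v * y' - y' * v) +
        of_int l' *\<^sub>Q (x' * v - v * x')
          + of_nat N *\<^sub>Q (x' * y' - y' * x'))"
        unfolding x(2) y(2) by (simp add: distrib_left distrib_right scaleQ_add_right scaleQ_diff_right mult_ac)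
      then have "(1 / of_nat N ^ Suc m) *\<^sub>Q (x * y - y * x) =
        q *\<^sub>Q (of_int l *\<^sub>Q (v * y' - y' * v) + of_int l' *\<^sub>Q (x' * v - v * x')
          + of_nat N *\<^sub>Q (x' * y' - y' * x'))"
        using N by (simp only: scaleQ_scaleQ mult.commute)
      also have "\<dots> = of_int l *\<^sub>Q (q *\<^sub>Q (v * y' - y' * v)) +
        of_int l' *\<^sub>Q (q *\<^sub>Q (x' * v - v * x'))
          + of_nat N *\<^sub>Q (q *\<^sub>Q (x' * y' - y' * x'))"
        by (simp add: scaleQ_add_right mult.commute)
      also have "\<dots> \<in> R" using Suc x(1) y(1) assms(2) unfolding q_def
        by (metis R_add R_scale_Ints Ints_of_nat Ints_of_int)
      finally show "(1 / of_nat N ^ Suc m) *\<^sub>Q (x * y - y * x) \<in> R" .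
    qed
  qed
  have zero: "x * y = y * x" if "x \<in> R" "y \<in> R" for x y
    using zero_if_powers_divide_R[OF assms(1), of "x * y - y * x"] comm that by simp
  obtain x y :: 'h where xy: "x * y \<noteq> y * x" using quaternion_noncommutative by blast
  obtain d :: nat where d: "d > 0" "of_nat d *\<^sub>Q x \<in> R" "of_nat d *\<^sub>Q y \<in> R"
    using R_common_denominator[of "{x, y}"] by auto
  have "of_nat d *\<^sub>Q of_nat d *\<^sub>Q (x * y) = of_nat d *\<^sub>Q of_nat d *\<^sub>Q (y * x)"
    using zero[OF d(2,3)] by simp
  then show False using xy d(1) by simp
qed

end

section \<open>Maximal orders\<close>

text \<open>Pigeonhole: on \<open>{0..h}\<close> both the squares and the values
  \<open>r - n * y\<^sup>2\<close> are distinct modulo \<open>p\<close>, and two sets of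
  \<open>h + 1\<close> residues cannot be disjoint because \<open>2 * (h + 1) > p\<close>.\<close>

lemma binary_form_represents:
  fixes n r :: int
  assumes p: "prime (p::nat)" "odd p" and n: "\<not> int p dvd n"
  shows "\<exists>x y. int p dvd x\<^sup>2 + n * y\<^sup>2 - r"
proof -
  define h where "h = (int p - 1) div 2"
  have ph: "int p = 2 * h + 1" using p(2) by (auto simp: h_def elim!: oddE)
  have pp: "prime (int p)" using p by simp
  have h0: "h \<ge> 0" "int p > 0" using p by (auto simp: h_def dest: prime_gt_0_nat)
  define f where "f x = x\<^sup>2 mod int p" for x
  define g where "g y = (r - n * y\<^sup>2) mod int p" for y
  have sq: "x = y" if "x \<in> {0..h}" "y \<in> {0..h}" "int p dvd x\<^sup>2 - y\<^sup>2" for x y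
  proof -
    have "int p dvd (x - y) * (x + y)" using that(3) by (simp add: power2_eq_square algebra_simps)
    then consider "int p dvd x - y" | "int p dvd x + y" using pp by (auto simp: prime_dvd_mult_iff)
    then show ?thesis
    proof cases
      case 1
      then have "int p \<le> \<bar>x - y\<bar>" if "x \<noteq> y"
        using dvd_imp_le_int[of "x - y" "int p"] that by simp
      then show ?thesis using that(1,2) ph by fastforce
    next
      case 2
      then have "x + y = 0" using that(1,2) ph zdvd_imp_le[of "int p" "x + y"] by force
      then show ?thesis using that(1,2) by simp
    qed
  qed
  have "inj_on f {0..h}" by (auto intro!: inj_onI sq simp: f_def mod_eq_dvd_iff)
  moreover have "inj_on g {0..h}"
  proof (rule inj_onI)
    fix x y assume xy: "x \<in> {0..h}" "y \<in> {0..h}" "g x = g y"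
    then have "int p dvd n * (y\<^sup>2 - x\<^sup>2)" by (simp add: g_def mod_eq_dvd_iff algebra_simps)
    then have "int p dvd y\<^sup>2 - x\<^sup>2" using n pp by (simp add: prime_dvd_mult_iff)
    then show "x = y" using sq[of y x] xy by simp
  qed
  ultimately have card: "card (f ` {0..h}) = nat (h + 1)" "card (g ` {0..h}) = nat (h + 1)"
    by (simp_all add: card_image)
  have "f ` {0..h} \<inter> g ` {0..h} \<noteq> {}"
  proof
    assume "f ` {0..h} \<inter> g ` {0..h} = {}"
    then have "card (f ` {0..h} \<union> g ` {0..h}) = 2 * nat (h + 1)" using card
      by (subst card_Un_disjoint) auto
    moreover have "f ` {0..h} \<union> g ` {0..h} \<subseteq> {0..<int p}" using h0
      by (auto simp: f_def g_def)
    then have "card (f ` {0..h} \<union> g ` {0..h}) \<le> card {0..<int p}" by (intro card_mono) auto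
    ultimately show False using ph h0 by auto
  qed
  then obtain x y where "f x = g y" by auto
  then have "int p dvd x\<^sup>2 - (r - n * y\<^sup>2)" by (simp add: f_def g_def mod_eq_dvd_iff)
  then show ?thesis by (intro exI[of _ x] exI[of _ y]) (simp add: algebra_simps)
qed

locale maximal_quaternion_order = quaternion_order R for R :: "'h::quaternion_algebra set" +
  assumes maximal_order: "maximal_order R"
begin

text \<open>
  Under these hypotheses \<open>R + R a R\<close> is a ring, because \<open>a * c * a = trd (c * a) a - nrd a (invol c)\<close>.
\<close>

lemma maximal_orderD:
  assumes tr: "\<And>b. b \<in> R \<Longrightarrow> trd (a * b) \<in> \<int>" and nr: "nrd a \<in> \<int>"
  shows "a \<in> R"
proof -
  obtain S where S: "finite S" "S \<subseteq> R" "R = int_mod.span S" using R_generators by blast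
  \<comment> \<open>Products over a finite generating set, so that \<open>R'\<close>, which is
    \<open>R + R a R\<close>, is visibly finitely generated.\<close>
  define T where "T = (\<lambda>(s, t). s * a * t) ` (S \<times> S)"
  define R' where "R' = int_mod.span (S \<union> T)"
  have sub: "R \<subseteq> R'" unfolding S(3) R'_def by (rule int_mod.span_mono) auto
  have R'_add: "x + y \<in> R'" and R'_diff: "x - y \<in> R'" if "x \<in> R'" "y \<in> R'" for x y
    using that by (auto simp: R'_def intro: int_mod.span_add int_mod.span_diff)
  have R'_scale: "q *\<^sub>Q x \<in> R'" if "q \<in> \<int>" "x \<in> R'" for q x
    using that int_mod.span_scale[of x "S \<union> T"]
      by (auto simp: R'_def of_int_mult_scaleQ elim!: Ints_cases)
  have 1: "s * a * c \<in> R'" if "s \<in> S" "c \<in> int_mod.span S" for s c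
    using that(2)
  proof (induction rule: int_mod.span_induct_alt)
    case (step k x y)
    have "s * a * (of_int k * x + y) = of_int k *\<^sub>Q (s * a * x) + s * a * y"
      by (simp add: distrib_left of_int_mult_scaleQ)
    moreover have "s * a * x \<in> R'" using step that(1)
      by (auto simp: R'_def T_def intro!: int_mod.span_base)
    ultimately show ?case using step by (metis R'_add R'_scale Ints_of_int)
  qed (simp add: R'_def int_mod.span_zero)
  have 2: "b * a * c \<in> R'" if "b \<in> R" "c \<in> R" for b c
    using that(1) unfolding S(3)
  proof (induction rule: int_mod.span_induct_alt)
    case (step k x y)
    have "(of_int k * x + y) * a * c = of_int k *\<^sub>Q (x * a * c) + y * a * c"
      by (simp add: distrib_right of_int_mult_scaleQ)
    moreover have "x * a * c \<in> R'" using 1 step that(2) S(3) by auto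
    ultimately show ?case using step by (metis R'_add R'_scale Ints_of_int)
  qed (simp add: R'_def int_mod.span_zero)
  have 3: "(b * a * c) * (b' * a * c') \<in> R'" if "b \<in> R" "c \<in> R" "b' \<in> R" "c' \<in> R"
    for b c b' c'
  proof -
    have "(b * a * c) * (b' * a * c') = b * (a * (c * b') * a) * c'" by (simp add: mult.assoc)
    also have "\<dots> = trd (c * b' * a) *\<^sub>Q (b * a * c') - nrd a *\<^sub>Q (b * invol (c * b') * c')"
      by (simp add: sandwich algebra_simps)
    also have "\<dots> \<in> R'"
    proof (intro R'_diff R'_scale 2)
      show "trd (c * b' * a) \<in> \<int>" using tr[of "c * b'"] that
        by (simp add: trd_mult_commute[of "c * b'" a] R_mult)
      show "b * invol (c * b') * c' \<in> R'" 
        by (rule subsetD[OF sub R_mult[OF R_mult[OF that(1) R_invol[OF R_mult[OF that(2,3)]]] that(4)]])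
    qed (use that nr in auto)
    finally show ?thesis .
  qed
  have mult: "x * y \<in> R'" if "x \<in> R'" "y \<in> R'" for x y
    unfolding R'_def
  proof (rule int_span_mult_closed)
    fix x y assume xy: "x \<in> S \<union> T" "y \<in> S \<union> T"
    show "x * y \<in> int_mod.span (S \<union> T)"
      unfolding R'_def[symmetric]
    proof (cases "x \<in> S")
      case x: True
      show "x * y \<in> R'"
      proof (cases "y \<in> S")
        case True
        then show ?thesis using x S(2) sub by (auto intro: R_mult)
      next
        case False
        then obtain s t where "s \<in> S" "t \<in> S" "y = s * a * t" using xy by (auto simp: T_def)
        then show ?thesis using 2[of "x * s" t] x S(2) by (auto intro: R_mult simp: mult.assoc)
      qed
    next
      case False
      then obtain s t where x: "s \<in> S" "t \<in> S" "x = s * a * t" using xy by (auto simp: T_def)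
      show "x * y \<in> R'"
      proof (cases "y \<in> S")
        case True
        then show ?thesis using 2[of s "t * y"] x S(2) by (auto intro: R_mult simp: mult.assoc)
      next
        case False
        then obtain s' t' where "s' \<in> S" "t' \<in> S" "y = s' * a * t'" using xy by (auto simp: T_def)
        then show ?thesis using 3[of s t s' t'] x S(2) by auto
      qed
    qed
  qed (use that in \<open>auto simp: R'_def\<close>)
  have "is_order R'"
    unfolding is_order_def
  proof (intro conjI ballI)
    show "1 \<in> R'" using sub by auto
    show "\<exists>S. finite S \<and> R' = {\<Sum>x\<in>S. of_int (k x) * x |k. True}"
      using S(1) by (intro exI[of _ "S \<union> T"]) (auto simp: R'_def T_def int_mod.span_finite)
    show "rat_vector.span R' = UNIV"
      using is_order rat_vector.span_mono[OF sub] by (auto simp: is_order_def)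
  qed (auto intro: R'_diff mult)
  then have "R' = R" using maximal_order sub by (auto simp: maximal_order_def)
  then show ?thesis using 2[of 1 1] by simp
qed

text \<open>Since 1 has trace 2, only \<open>p = 2\<close> could fail. Then maximality puts every
  element of norm divisible by 4 into \<open>2 R\<close>. Two elements of norm 2 modulo 4 therefore
  differ by an element of \<open>2 R\<close>, so 1 and one such element \<open>v\<close> generate
  \<open>R\<close> modulo 2, which is impossible.\<close>

lemma trd_not_divisible:
  assumes p: "prime (p::nat)"
  shows "\<exists>b\<in>R. trd b / of_nat p \<notin> \<int>"
proof (rule ccontr)
  assume "\<not> ?thesis"
  then have tr: "trd b / of_nat p \<in> \<int>" if "b \<in> R" for b using that by blast
  have p0: "p > 0" using p prime_gt_0_nat by auto
  have "int p dvd 2" using tr[of 1] of_int_div_Ints_iff[OF p0, of 2] by simp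
  then have "int p \<le> 2" by (intro zdvd_imp_le) auto
  then have p2: "p = 2" using prime_ge_2_nat[OF p] by linarith
  \<comment> \<open>As all traces are even, the trace condition of \<open>maximal_orderD\<close> is
    automatic for half of \<open>a\<close>, and only the norm has to be checked.\<close>
  have half: "(1/2) *\<^sub>Q a \<in> R" if "a \<in> R" "nrd a / 4 \<in> \<int>" for a
  proof (rule maximal_orderD)
    fix b assume "b \<in> R"
    then show "trd ((1/2) *\<^sub>Q a * b) \<in> \<int>" using tr[of "a * b"] that(1) p2
      by (auto intro: R_mult simp: trd_scaleQ)
  next
    show "nrd ((1/2) *\<^sub>Q a) \<in> \<int>" using that(2) by (simp add: nrd_scaleQ power2_eq_square)
  qed
  have tr4: "trd (a * invol b) / 4 \<in> \<int>"
    if "a \<in> R" "b \<in> R" "nrd a / 2 \<in> \<int>" "nrd b / 2 \<in> \<int>" for a b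
  proof -
    have "nrd (a * invol b) / 4 = (nrd a / 2) * (nrd b / 2)" by (simp add: nrd_mult)
    then have "(1/2) *\<^sub>Q (a * invol b) \<in> R" using that
      by (intro half R_mult R_invol) (auto simp del: times_divide_eq_left times_divide_eq_right)
    from tr[OF this] show ?thesis using p2 by (simp add: trd_scaleQ)
  qed
  have halves: "k / 2 \<in> \<int> \<or> (k + 1) / 2 \<in> \<int>" if k: "k \<in> \<int>" for k :: rat
  proof -
    obtain m where "k = of_int m" using k by (elim Ints_cases)
    moreover have "even m \<or> even (m + 1)" by auto
    ultimately show ?thesis using of_int_div_Ints_iff[of 2 m] of_int_div_Ints_iff[of 2 "m + 1"] by auto
  qed
  \<comment> \<open>An element of norm 2 modulo 4 if there is one, and 0 otherwise.\<close>
  obtain v where v: "v \<in> R" "nrd v / 2 \<in> \<int>"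
    and v4: "\<And>y. y \<in> R \<Longrightarrow> nrd y / 2 \<in> \<int> \<Longrightarrow>
      nrd y / 4 \<notin> \<int> \<Longrightarrow> nrd v / 4 \<notin> \<int>"
  proof (cases "\<exists>v\<in>R. nrd v / 2 \<in> \<int> \<and> nrd v / 4 \<notin> \<int>")
    case False
    then show ?thesis using that[of 0] by auto
  qed (use that in blast)
  have gen_even: "\<exists>l. (1/2) *\<^sub>Q (y - of_int l *\<^sub>Q v) \<in> R"
    if y: "y \<in> R" "nrd y / 2 \<in> \<int>" for y
  proof (cases "nrd y / 4 \<in> \<int>")
    case True
    then show ?thesis using half[of y] y by (intro exI[of _ 0]) auto
  next
    case False
    \<comment> \<open>The norms of \<open>y\<close> and \<open>v\<close> are both 2 modulo 4 and the
      mixed trace is divisible by 4, so the norm of \<open>y - v\<close> is divisible by 4.\<close>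
    have "(nrd y / 2 + 1) / 2 \<in> \<int>" using halves[OF y(2)] False by auto
    moreover have "(nrd v / 2 + 1) / 2 \<in> \<int>" using halves[OF v(2)] v4[OF y False] by auto
    moreover have "nrd (y - v) / 4 = (nrd y / 2 + 1) / 2 + (nrd v / 2 + 1) / 2 - 1 - trd (y * invol v) / 4"
      by (simp add: nrd_diff field_simps)
    ultimately have "nrd (y - v) / 4 \<in> \<int>" using tr4[OF y(1) v(1) y(2) v(2)]
      by (metis Ints_1 Ints_add Ints_diff)
    then show ?thesis using half[of "y - v"] y v by (intro exI[of _ 1]) (auto intro: R_diff)
  qed
  have "\<exists>k l. (1/2) *\<^sub>Q (x - of_int k *\<^sub>Q 1 - of_int l *\<^sub>Q v) \<in> R"
    if x: "x \<in> R" for x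
  proof -
    \<comment> \<open>As traces are even, subtracting 1 changes the parity of the norm, so
      \<open>k\<close> is 0 or 1.\<close>
    have "\<exists>k. nrd (x - of_int k *\<^sub>Q 1) / 2 \<in> \<int>"
    proof (cases "nrd x / 2 \<in> \<int>")
      case True
      then show ?thesis by (intro exI[of _ 0]) simp
    next
      case False
      then have "(nrd x + 1) / 2 \<in> \<int>" using halves[OF nrd_Ints[OF x]] by auto
      moreover have "nrd (x - 1) / 2 = (nrd x + 1) / 2 - trd x / 2" by (simp add: nrd_diff field_simps)
      ultimately have "nrd (x - 1) / 2 \<in> \<int>" using tr[OF x] p2 by (metis Ints_diff of_nat_numeral)
      then show ?thesis by (intro exI[of _ 1]) simp
    qed
    then obtain k where "nrd (x - of_int k *\<^sub>Q 1) / 2 \<in> \<int>" by blast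
    then show ?thesis
      using gen_even[OF R_diff[OF x R_scale_Ints[OF Ints_of_int R_one]]] by blast
  qed
  then show False using not_generated_by_two_mod[of 2 v] v by auto
qed

text \<open>The hypothesis says that \<open>a\<close> is in the radical of the trace form modulo
  \<open>p\<close>. Testing it against \<open>invol a * b\<close> gives
  \<open>nrd a * trd b\<close>; if \<open>p\<close> did not divide \<open>nrd a\<close>, it would
  divide every trace.\<close>

lemma nrd_divisible:
  assumes p: "prime (p::nat)" and a: "a \<in> R"
    "\<And>b. b \<in> R \<Longrightarrow> trd (a * b) / of_nat p \<in> \<int>"
  shows "nrd a / of_nat p \<in> \<int>"
proof (rule ccontr)
  assume np: "nrd a / of_nat p \<notin> \<int>"
  have "trd b / of_nat p \<in> \<int>" if "b \<in> R" for b
  proof -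
    have "a * (invol a * b) = nrd a *\<^sub>Q b" by (simp add: mult_invol flip: mult.assoc)
    then have "nrd a * trd b / of_nat p \<in> \<int>" using a(2)[of "invol a * b"] a(1) that
      by (auto simp: trd_scaleQ intro: R_mult R_invol)
    then show ?thesis using prime_Ints_mult[OF p nrd_Ints[OF a(1)] trd_Ints[OF that]] np by blast
  qed
  then show False using trd_not_divisible[OF p] by blast
qed

text \<open>The square of the radical lies in \<open>p R\<close>: each factor contributes one
  \<open>p\<close> to the norm, which is what \<open>maximal_orderD\<close> asks of the product
  divided by \<open>p\<close>.\<close>

lemma mult_divisible:
  assumes p: "prime (p::nat)" and a: "a \<in> R"
    "\<And>c. c \<in> R \<Longrightarrow> trd (a * c) / of_nat p \<in> \<int>"
    and b: "b \<in> R" "\<And>c. c \<in> R \<Longrightarrow> trd (b * c) / of_nat p \<in> \<int>"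
  shows "(1 / of_nat p) *\<^sub>Q (a * b) \<in> R"
proof (rule maximal_orderD)
  fix c assume "c \<in> R"
  then show "trd ((1 / of_nat p) *\<^sub>Q (a * b) * c) \<in> \<int>" using a(2)[of "b * c"] b(1)
    by (simp add: trd_scaleQ mult.assoc R_mult)
next
  have "(nrd a / of_nat p) * (nrd b / of_nat p) \<in> \<int>" by (intro Ints_mult nrd_divisible[OF p] a b)
  then show "nrd ((1 / of_nat p) *\<^sub>Q (a * b)) \<in> \<int>"
    by (simp add: nrd_scaleQ nrd_mult power2_eq_square)
qed

text \<open>Otherwise polarisation, with 2 invertible modulo \<open>p\<close>, puts all traceless
  elements into the radical of the trace form. By \<open>mult_divisible\<close> they are then
  multiples of a single \<open>a\<close> modulo \<open>p\<close>, and since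
  \<open>2 *\<^sub>Q x\<close> is a scalar plus a traceless element, 1 and \<open>a\<close> generate
  \<open>R\<close> modulo \<open>p\<close>.\<close>

lemma traceless_unit_norm:
  assumes p: "prime (p::nat)" "odd p"
  shows "\<exists>b\<in>R. trd b = 0 \<and> nrd b / of_nat p \<notin> \<int>"
proof (rule ccontr)
  assume "\<not> ?thesis"
  then have nr: "nrd b / of_nat p \<in> \<int>" if "b \<in> R" "trd b = 0" for b using that by blast
  have p0: "p > 0" "p \<ge> 2" using p prime_gt_0_nat prime_ge_2_nat by auto
  have two: "k / of_nat p \<in> \<int>" if "2 * k / of_nat p \<in> \<int>" "k \<in> \<int>" for k :: rat
  proof -
    have "(2::rat) / of_nat p \<notin> \<int>"
    proof
      assume "(2::rat) / of_nat p \<in> \<int>"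
      then have "int p dvd 2" using of_int_div_Ints_iff[OF p0(1), of 2] by simp
      then have "int p \<le> 2" by (intro zdvd_imp_le) auto
      then show False using p p0(2) by auto
    qed
    then show ?thesis using prime_Ints_mult[OF p(1) _ that(2,1)] by auto
  qed
  \<comment> \<open>Twice the traceless part; the factor 2 avoids a denominator.\<close>
  define z where "z c = 2 *\<^sub>Q c - trd c *\<^sub>Q 1" for c :: 'h
  have z: "z c \<in> R" "trd (z c) = 0" if "c \<in> R" for c
    using that by (auto simp: z_def trd_diff trd_scaleQ trd_Ints intro!: R_diff R_scale_Ints)
  have tr: "trd (b * c) / of_nat p \<in> \<int>" if b: "b \<in> R" "trd b = 0" and c: "c \<in> R" for b c
  proof (rule two)
    have "trd (b * z c) = 2 * trd (b * c)" using b by (simp add: z_def algebra_simps trd_diff trd_scaleQ)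
    moreover have "invol (z c) = - z c" using z(2)[OF c] by (simp add: invol_eq)
    then have "trd (b * z c) = - (nrd (b + z c) - nrd b - nrd (z c))" by (simp add: nrd_add trd_uminus)
    ultimately have "2 * trd (b * c) / of_nat p = - (nrd (b + z c) - nrd b - nrd (z c)) / of_nat p" by simp
    also have "\<dots> = - (nrd (b + z c) / of_nat p - nrd b / of_nat p - nrd (z c) / of_nat p)"
      by (simp add: diff_divide_distrib)
    also have "\<dots> \<in> \<int>" using b z[OF c]
      by (intro Ints_minus Ints_diff nr) (auto intro: R_add simp: trd_add)
    finally show "2 * trd (b * c) / of_nat p \<in> \<int>" .
    show "trd (b * c) \<in> \<int>" using b c by (intro trd_Ints R_mult)
  qed
  have "\<exists>a\<in>R. \<forall>b\<in>R. trd b = 0 \<longrightarrow>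
    (\<exists>l m. \<not> int p dvd m \<and> (1 / of_nat p) *\<^sub>Q (of_int m *\<^sub>Q b -
      of_int l *\<^sub>Q a) \<in> R)"
  proof (cases "\<exists>a\<in>R. trd a = 0 \<and> (1 / of_nat p) *\<^sub>Q a \<notin> R")
    case True
    then obtain a where a: "a \<in> R" "trd a = 0" "(1 / of_nat p) *\<^sub>Q a \<notin> R" by blast
    have "nrd ((1 / of_nat p) *\<^sub>Q a) \<notin> \<int>"
    proof
      assume "nrd ((1 / of_nat p) *\<^sub>Q a) \<in> \<int>"
      moreover have "trd ((1 / of_nat p) *\<^sub>Q a * b) \<in> \<int>" if "b \<in> R" for b
        using tr[OF a(1,2) that] by (simp add: trd_scaleQ)
      ultimately show False using maximal_orderD a(3) by blast
    qed
    then have na: "nrd a / of_nat p / of_nat p \<notin> \<int>" by (simp add: nrd_scaleQ power2_eq_square)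
    obtain n where n: "nrd a / of_nat p = of_int n" using nr[OF a(1,2)] by (elim Ints_cases)
    have pn: "\<not> int p dvd 2 * n"
    proof
      assume "int p dvd 2 * n"
      then have "2 * (of_int n :: rat) / of_nat p \<in> \<int>"
        using of_int_div_Ints_iff[OF p0(1), of "2 * n"] by simp
      then show False using two[of "of_int n"] na n by simp
    qed
    have "\<exists>l. (1 / of_nat p) *\<^sub>Q (of_int (2 * n) *\<^sub>Q b -
      of_int l *\<^sub>Q a) \<in> R" if b: "b \<in> R" "trd b = 0" for b
    proof -
      \<comment> \<open>Since \<open>a * a\<close> is the scalar \<open>- nrd a\<close>, multiplying
        \<open>c\<close> by \<open>a\<close> gives \<open>- n\<close> times \<open>b\<close>.
        Doubling and splitting off the trace \<open>t\<close> of \<open>c\<close> leaves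
        \<open>a * z c\<close>, which lies in \<open>p R\<close> because both factors are traceless;
        hence \<open>2 * n\<close> times \<open>b\<close> is congruent to \<open>- t\<close> times
        \<open>a\<close>.\<close>
      define c where "c = (1 / of_nat p) *\<^sub>Q (a * b)"
      have c: "c \<in> R" unfolding c_def
        by (rule mult_divisible[OF p(1) a(1) tr[OF a(1,2)] b(1) tr[OF b(1,2)]])
      have az: "(1 / of_nat p) *\<^sub>Q (a * z c) \<in> R"
        by (rule mult_divisible[OF p(1) a(1) tr[OF a(1,2)] z(1)[OF c] tr[OF z[OF c]]])
      have aa: "a * a = - nrd a *\<^sub>Q 1" using a(2) by (simp add: square_eq)
      have "nrd a / of_nat p = of_int n" by (rule n)
      then have nb: "of_int n *\<^sub>Q b = - (a * c)"
        using aa by (simp add: c_def flip: mult.assoc)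
      obtain t where t: "trd c = of_int t" using trd_Ints[OF c] by (elim Ints_cases)
      have "of_int (2 * n) *\<^sub>Q b = - (2 *\<^sub>Q (a * c))" using nb
        by (metis mult.commute of_int_mult of_int_numeral rat_vector.scale_minus_right scaleQ_scaleQ)
      also have "\<dots> = - (a * z c) - of_int t *\<^sub>Q a" by (simp add: z_def algebra_simps t)
      finally have "of_int (2 * n) *\<^sub>Q b - of_int (- t) *\<^sub>Q a = - (a * z c)"
        by (simp add: algebra_simps)
      then show ?thesis using R_uminus[OF az] by (metis rat_vector.scale_minus_right)
    qed
    then show ?thesis using pn a(1) by blast
  next
    case False
    \<comment> \<open>If every traceless element lies in \<open>p R\<close>, the generator 0
      serves.\<close>
    have "\<exists>l m. \<not> int p dvd m \<and> (1 / of_nat p) *\<^sub>Q (of_int m *\<^sub>Q b -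
      of_int l *\<^sub>Q 0) \<in> R" if "b \<in> R" "trd b = 0" for b
      using False that p0 by (intro exI[of _ 1]) auto
    then show ?thesis by (intro bexI[of _ 0]) auto
  qed
  then obtain a where a: "a \<in> R" and gen: "\<And>b. b \<in> R \<Longrightarrow> trd b =
    0 \<Longrightarrow>
      \<exists>l m. \<not> int p dvd m \<and> (1 / of_nat p) *\<^sub>Q (of_int m *\<^sub>Q b -
        of_int l *\<^sub>Q a) \<in> R" by blast
  have "\<exists>k l. (1 / of_nat p) *\<^sub>Q (x - of_int k *\<^sub>Q 1 -
    of_int l *\<^sub>Q a) \<in> R" if x: "x \<in> R" for x
  proof -
    obtain l m where lm: "\<not> int p dvd m"
      "(1 / of_nat p) *\<^sub>Q (of_int m *\<^sub>Q z x - of_int l *\<^sub>Q a) \<in> R"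
        using gen[OF z[OF x]] by blast
    obtain t where t: "trd x = of_int t" using trd_Ints[OF x] by (elim Ints_cases)
    have "coprime (int p) (2 * m)"
    proof (rule prime_imp_coprime)
      show "prime (int p)" using p by simp
      show "\<not> int p dvd 2 * m"
        using lm(1) two[of "of_int m"] of_int_div_Ints_iff[OF p0(1), of "2 * m"] of_int_div_Ints_iff[OF p0(1), of m] by auto
    qed
    \<comment> \<open>Modulo \<open>p\<close> this rewrites \<open>x\<close> as \<open>v * m\<close>
      times \<open>2 *\<^sub>Q x\<close>, that is \<open>v * m\<close> times \<open>z x\<close> plus
      the scalar \<open>v * m * t\<close>, and \<open>m\<close> times \<open>z x\<close> is
      \<open>l\<close> times \<open>a\<close>.\<close>
    then obtain u v where "u * int p + v * (2 * m) = 1" by (metis bezout_int coprime_iff_gcd_eq_1)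
    then have uv: "u * int p + v * (m * 2) = 1" by (simp only: mult.commute[of m])
    have "x = (of_int (u * int p + v * (m * 2)) :: rat) *\<^sub>Q x" by (simp only: uv of_int_1 scaleQ_one)
    also have "\<dots> = of_int u *\<^sub>Q of_nat p *\<^sub>Q x +
      of_int v *\<^sub>Q of_int m *\<^sub>Q 2 *\<^sub>Q x" by (simp add: scaleQ_add_left)
    also have "2 *\<^sub>Q x = z x + of_int t *\<^sub>Q 1" by (simp add: z_def t)
    finally have "x - of_int (v * m * t) *\<^sub>Q 1 - of_int (v * l) *\<^sub>Q a =
        of_int u *\<^sub>Q of_nat p *\<^sub>Q x + of_int v *\<^sub>Q of_int m *\<^sub>Q (z x +
          of_int t *\<^sub>Q 1)
          - of_int (v * m * t) *\<^sub>Q 1 - of_int (v * l) *\<^sub>Q a"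
      by (rule arg_cong)
    also have "\<dots> = of_int u *\<^sub>Q of_nat p *\<^sub>Q x +
      of_int v *\<^sub>Q (of_int m *\<^sub>Q z x - of_int l *\<^sub>Q a)"
      by (simp only: scaleQ_add_right scaleQ_diff_right scaleQ_scaleQ of_int_mult mult.assoc) simp
    finally have eq: "x - of_int (v * m * t) *\<^sub>Q 1 - of_int (v * l) *\<^sub>Q a = \<dots>" .
    have "(1 / of_nat p) *\<^sub>Q (x - of_int (v * m * t) *\<^sub>Q 1 - of_int (v * l) *\<^sub>Q a) =
        of_int u *\<^sub>Q x + of_int v *\<^sub>Q ((1 / of_nat p) *\<^sub>Q (of_int m *\<^sub>Q z x -
          of_int l *\<^sub>Q a))"
      unfolding eq using p0 by (simp add: scaleQ_add_right)
    also have "\<dots> \<in> R"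
      by (rule R_add[OF R_scale_Ints[OF Ints_of_int x] R_scale_Ints[OF Ints_of_int lm(2)]])
    finally show ?thesis by blast
  qed
  then show False using not_generated_by_two_mod[OF p0(2) a] by blast
qed

text \<open>For odd \<open>p\<close>, on the span of 1 and a traceless \<open>b\<close> the norm is
  the form \<open>x\<^sup>2 + n * y\<^sup>2\<close> with \<open>n = nrd b\<close> prime to
  \<open>p\<close>. For \<open>p = 2\<close> the only unit class is that of 1.\<close>

lemma nrd_represents_prime:
  assumes p: "prime (p::nat)" and r: "\<not> int p dvd r"
  shows "\<exists>a\<in>R. (nrd a - of_int r) / of_nat p \<in> \<int>"
proof (cases "odd p")
  case True
  have p0: "p > 0" using p prime_gt_0_nat by auto
  obtain b where b: "b \<in> R" "trd b = 0" "nrd b / of_nat p \<notin> \<int>"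
    using traceless_unit_norm[OF p True] by blast
  obtain n where n: "nrd b = of_int n" using nrd_Ints[OF b(1)] by (elim Ints_cases)
  then have "\<not> int p dvd n" using b(3) of_int_div_Ints_iff[OF p0] by simp
  then obtain x y where xy: "int p dvd x\<^sup>2 + n * y\<^sup>2 - r"
    using binary_form_represents[OF p True] by blast
  have "nrd (of_int x *\<^sub>Q 1 + of_int y *\<^sub>Q b) = of_int (x\<^sup>2 + n * y\<^sup>2)"
    using b(2) n by (simp add: nrd_add nrd_scaleQ trd_scaleQ mult.commute)
  then have "(nrd (of_int x *\<^sub>Q 1 + of_int y *\<^sub>Q b) - of_int r) / of_nat p \<in> \<int>"
    using xy of_int_div_Ints_iff[OF p0, of "x\<^sup>2 + n * y\<^sup>2 - r"] by simp
  then show ?thesis using b(1)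
    by (intro bexI[of _ "of_int x *\<^sub>Q 1 + of_int y *\<^sub>Q b"]) (auto intro!: R_add R_scale_Ints)
next
  case False
  then have "p = 2" using primes_dvd_imp_eq[of 2 p] p two_is_prime_nat by auto
  then show ?thesis using of_int_div_Ints_iff[of 2 "1 - r"] r by (intro bexI[of _ 1]) auto
qed

text \<open>Hensel lifting. The derivative of \<open>nrd\<close> at \<open>a\<close> in direction
  \<open>invol b\<close> is \<open>trd (a * b)\<close>, and as \<open>nrd a\<close> is prime to
  \<open>p\<close>, \<open>nrd_divisible\<close> provides a \<open>b\<close> for which this is a
  unit.\<close>

lemma nrd_represents_prime_power:
  assumes p: "prime (p::nat)" and r: "\<not> int p dvd r"
  shows "\<exists>a\<in>R. (nrd a - of_int r) / of_nat p ^ Suc k \<in> \<int>"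
proof (induction k)
  case 0
  show ?case using nrd_represents_prime[OF p r] by simp
next
  case (Suc k)
  have p0: "p > 0" using p prime_gt_0_nat by auto
  from Suc obtain a s where a: "a \<in> R" and s: "(nrd a - of_int r) / of_nat p ^ Suc k = of_int s"
    by (auto elim!: Ints_cases)
  then have na: "nrd a = of_int r + of_int s * of_nat p ^ Suc k" using p0 by (simp add: field_simps)
  have "nrd a / of_nat p \<notin> \<int>"
  proof
    assume "nrd a / of_nat p \<in> \<int>"
    then have "int p dvd r + s * int p ^ Suc k"
      using of_int_div_Ints_iff[OF p0, of "r + s * int p ^ Suc k"] na by simp
    then show False using r by (simp add: dvd_add_left_iff)
  qed
  then obtain b where b: "b \<in> R" "trd (a * b) / of_nat p \<notin> \<int>"
    using nrd_divisible[OF p a] by blast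
  obtain t where t: "trd (a * b) = of_int t" using trd_Ints[OF R_mult[OF a b(1)]] by (elim Ints_cases)
  have "\<not> int p dvd t" using b(2) t of_int_div_Ints_iff[OF p0] by simp
  then have "coprime (int p) t" using p by (intro prime_imp_coprime) auto
  then obtain u v where uv: "u * int p + v * t = 1" by (metis bezout_int coprime_iff_gcd_eq_1)
  \<comment> \<open>As \<open>v\<close> inverts \<open>t = trd (a * b)\<close> modulo
    \<open>p\<close>, the linear term of the correction cancels the error \<open>s\<close>; the
    quadratic term carries a further factor \<open>p\<close>.\<close>
  define q :: rat where "q = of_nat p ^ Suc k * of_int (- s * v)"
  define a' where "a' = a + q *\<^sub>Q invol b"
  have a': "a' \<in> R" unfolding a'_def q_def by (intro R_add a R_scale_Ints R_invol b) auto
  obtain m where m: "nrd b = of_int m" using nrd_Ints[OF b(1)] by (elim Ints_cases)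
  have "nrd a' - of_int r = of_nat p ^ Suc k * of_int (s + (- s * v) * t +
    int p * (int p ^ k * (s * v)\<^sup>2 * m))"
  proof -
    have "nrd a' = nrd a + q\<^sup>2 * of_int m + q * of_int t"
      by (simp add: a'_def nrd_add nrd_scaleQ trd_scaleQ t m)
    moreover have "r' + s' * (p' * X) + ((p' * X) * (- s' * v'))\<^sup>2 * m' +
      ((p' * X) * (- s' * v')) * t' - r'
        = (p' * X) * (s' + (- s' * v') * t' +
          p' * (X * (s' * v')\<^sup>2 * m'))" for r' s' p' X v' m' t' :: rat
      by algebra
    ultimately show ?thesis unfolding na q_def
      by (simp only: of_int_add of_int_mult of_int_power of_int_minus of_int_of_nat_eq power_Suc)
  qed
  also have "s + (- s * v) * t = s * u * int p" 
  proof -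
    have "s + (- s * v) * t = s * (1 - v * t)" by (simp add: algebra_simps)
    also have "1 - v * t = u * int p" using uv by simp
    finally show ?thesis by (simp add: mult.assoc)
  qed
  also have "of_nat p ^ Suc k * (of_int (s * u * int p + int p * (int p ^ k * (s * v)\<^sup>2 * m)) :: rat) =
      of_nat p ^ Suc (Suc k) * of_int (s * u + int p ^ k * (s * v)\<^sup>2 * m)"
  proof -
    have "p' * X * (s' * u' * p' + p' * (X * (s' * v')\<^sup>2 * m')) = p' * (p' * X) * (s' * u' +
      X * (s' * v')\<^sup>2 * m')"
      for p' X s' u' v' m' :: rat by algebra
    then show ?thesis by (simp only: of_int_add of_int_mult of_int_power of_int_of_nat_eq power_Suc)
  qed
  finally have "(nrd a' - of_int r) / of_nat p ^ Suc (Suc k) = of_int (s * u +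
    int p ^ k * (s * v)\<^sup>2 * m)" using p0 by simp
  then show ?case using a' by (metis Ints_of_int)
qed

end

section \<open>Unimodular hermitian lattices\<close>

lemma scaleQ_vec_nth [simp]: "(q *\<^sub>Q x) $ i = q *\<^sub>Q (x $ i :: 'a::rat_vector)"
  by (simp add: scaleQ_vec_def)

lemma right_scale_nth [simp]: "right_scale x a $ i = x $ i * a"
  by (simp add: right_scale_def)

text \<open>A dimension count over the rationals, replacing linear algebra over the noncommutative
  \<open>'h\<close>. It yields vectors orthogonal to a given system and inverts rational
  matrices.\<close>

lemma rat_vec_additive_inj_imp_surj:
  fixes f :: "'h::quaternion_algebra ^ 'n \<Rightarrow> 'h ^ 'n"
  assumes add: "\<And>x y. f (x + y) = f x + f y" and "inj f"
  shows "surj f"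
proof -
  obtain e :: "nat \<Rightarrow> 'h" and c
    where ec: "\<And>x. x = (\<Sum>m<4. (c m * trd (x * e m)) *\<^sub>Q e m)"
    using trace_dual_basis(1) by blast
  define S :: "('h ^ 'n) set" where "S = (\<lambda>(i, m). axis i (e m)) ` (UNIV \<times> {..<4})"
  have "x \<in> rat_vector.span S" for x :: "'h ^ 'n"
  proof -
    have "x = (\<Sum>i\<in>UNIV. \<Sum>m<4. (c m * trd (x $ i * e m)) *\<^sub>Q axis i (e m))"
    proof (rule vec_eq_iff[THEN iffD2, rule_format])
      fix j
      have "(\<Sum>i\<in>UNIV. \<Sum>m<4. (c m * trd (x $ i * e m)) *\<^sub>Q axis i (e m)) $ j =
          (\<Sum>i\<in>UNIV. if i = j then (\<Sum>m<4. (c m * trd (x $ i * e m)) *\<^sub>Q e m) else 0)"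
        unfolding sum_component scaleQ_vec_nth by (rule sum.cong) (auto simp: axis_def)
      also have "\<dots> = x $ j" using ec[of "x $ j"] by simp
      finally show "x $ j = (\<Sum>i\<in>UNIV. \<Sum>m<4. (c m * trd (x $ i * e m)) *\<^sub>Q
        axis i (e m)) $ j" by simp
    qed
    also have "\<dots> \<in> rat_vector.span S"
      by (intro rat_vector.span_sum rat_vector.span_scale rat_vector.span_base) (auto simp: S_def)
    finally show ?thesis .
  qed
  then have span: "rat_vector.span S = UNIV" by blast
  obtain B where B: "B \<subseteq> S" "rat_vector.independent B" "S \<subseteq> rat_vector.span B"
    using rat_vector.maximal_independent_subset[of S] by blast
  have "finite S" by (simp add: S_def)
  then have "finite B" using B(1) finite_subset by blast
  moreover have "rat_vector.span B = UNIV"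
    using span rat_vector.span_minimal[OF B(3) rat_vector.subspace_span] by auto
  ultimately interpret fd: finite_dimensional_vector_space "scaleQ :: rat \<Rightarrow> 'h ^ 'n \<Rightarrow> 'h ^ 'n" B
    using B(2) by unfold_locales auto
  have "Vector_Spaces.linear scaleQ scaleQ f"
    by unfold_locales (simp_all add: add additive_scaleQ[of f, OF add])
  then show ?thesis using fd.linear_inj_imp_surj \<open>inj f\<close> by blast
qed

lemma herm_add_right: "herm c x (y + z) = herm c x y + herm c x z"
  by (simp add: herm_def distrib_left sum.distrib scaleQ_add_right)

lemma herm_add_left: "herm c (x + z) y = herm c x y + herm c z y"
  by (simp add: herm_def distrib_right invol_add sum.distrib scaleQ_add_right)

lemma herm_scaleQ_right: "herm c x (q *\<^sub>Q y) = q *\<^sub>Q herm c x y"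
  by (rule additive_scaleQ) (rule herm_add_right)

lemma herm_scaleQ_left: "herm c (q *\<^sub>Q x) y = q *\<^sub>Q herm c x y"
  by (rule additive_scaleQ[of "\<lambda>x. herm c x y"]) (rule herm_add_left)

lemma herm_zero_right [simp]: "herm c x 0 = 0" and herm_zero_left [simp]: "herm c 0 y = 0"
  by (simp_all add: herm_def)

lemma herm_diff_right: "herm c x (y - z) = herm c x y - herm c x z"
  using herm_add_right[of c x "y - z" z] by simp

lemma herm_diff_left: "herm c (x - z) y = herm c x y - herm c z y"
  using herm_add_left[of c "x - z" z y] by simp

lemma herm_sum_right: "herm c x (sum f A) = (\<Sum>i\<in>A. herm c x (f i))"
  by (induction A rule: infinite_finite_induct) (simp_all add: herm_add_right)

lemma herm_right_scale: "herm c x (right_scale y a) = herm c x y * a"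
  by (simp add: herm_def sum_distrib_right mult.assoc)

lemma herm_right_scale_left: "herm c (right_scale x a) y = invol a * herm c x y"
  by (simp add: herm_def sum_distrib_left mult.assoc invol_mult)

lemma invol_herm: "invol (herm c x y) = herm c y x"
  by (simp add: herm_def invol_sum invol_mult)

lemma herm_axis: "herm c x (axis i 1) = c *\<^sub>Q invol (x $ i)"
proof -
  have "(\<Sum>j\<in>UNIV. invol (x $ j) * axis i 1 $ j) = (\<Sum>j\<in>UNIV. if j =
    i then invol (x $ i) else 0)"
    by (rule sum.cong) (auto simp: axis_def)
  then show ?thesis by (simp add: herm_def)
qed

lemma herm_nondegenerate:
  assumes "c \<noteq> 0" "\<And>y. herm c x y = 0"
  shows "x = 0"
proof -
  have "invol (x $ i) = 0" for i using assms(2)[of "axis i 1"] assms(1) by (simp add: herm_axis)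
  then have "x $ i = 0" for i by (metis invol_invol invol_zero)
  then show ?thesis by (simp add: vec_eq_iff)
qed

definition herm_norm :: "rat \<Rightarrow> 'h::quaternion_algebra ^ 'n \<Rightarrow> rat"
  where "herm_norm c x = c * (\<Sum>i\<in>UNIV. nrd (x $ i))"

lemma herm_self: "herm c x x = herm_norm c x *\<^sub>Q 1"
  by (simp add: herm_def herm_norm_def invol_mult_self rat_vector.scale_sum_left flip: scaleQ_scaleQ)

lemma herm_norm_add: "herm_norm c (x + y) = herm_norm c x + herm_norm c y + trd (herm c x y)"
proof -
  have "herm_norm c (x + y) *\<^sub>Q (1::'a) = herm c x x + herm c y y + (herm c x y + invol (herm c x y))"
    by (simp add: invol_herm herm_add_left herm_add_right flip: herm_self)
  also have "\<dots> = (herm_norm c x + herm_norm c y + trd (herm c x y)) *\<^sub>Q 1"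
    by (simp add: add_invol herm_self scaleQ_add_left)
  finally show ?thesis by simp
qed

text \<open>Bezout: \<open>1 / (m * n)\<close> is an integral combination of \<open>1 / m\<close>
  and \<open>1 / n\<close>.\<close>

lemma coprime_divide_closed:
  fixes x :: "'a::rat_vector"
  assumes "\<And>x y. x \<in> G \<Longrightarrow> y \<in> G \<Longrightarrow> x + y \<in> G"
    "\<And>x k. x \<in> G \<Longrightarrow> of_int k *\<^sub>Q x \<in> G"
    and "coprime m n" "m > 0" "n > 0" "(1 / of_nat m) *\<^sub>Q x \<in> G"
      "(1 / of_nat n) *\<^sub>Q x \<in> G"
  shows "(1 / of_nat (m * n)) *\<^sub>Q x \<in> G"
proof -
  obtain u v where uv: "u * int m + v * int n = 1"
    using assms(3) by (metis bezout_int coprime_iff_gcd_eq_1 coprime_int_iff)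
  have "1 / of_nat (m * n) = (of_int (u * int m + v * int n) :: rat) / of_nat (m * n)"
    by (simp only: uv of_int_1)
  also have "\<dots> = of_int u * (1 / of_nat n) + of_int v * (1 / of_nat m)" using assms(4,5)
    by (simp add: field_simps)
  finally have "(1 / of_nat (m * n)) *\<^sub>Q x = of_int u *\<^sub>Q ((1 / of_nat n) *\<^sub>Q x) +
    of_int v *\<^sub>Q ((1 / of_nat m) *\<^sub>Q x)"
    by (simp only: scaleQ_add_left scaleQ_scaleQ)
  then show ?thesis using assms(1,2,6,7) by presburger
qed

lemma nat_coprime_induct [consumes 1, case_names one prime_power coprime]:
  fixes P :: "nat \<Rightarrow> bool"
  assumes "N > 0" "P 1" "\<And>p k. prime p \<Longrightarrow> P (p ^ Suc k)"
    and coprime: "\<And>m n. coprime m n \<Longrightarrow> m > 0 \<Longrightarrow>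
      n > 0 \<Longrightarrow> P m \<Longrightarrow> P n \<Longrightarrow> P (m * n)"
  shows "P N"
  using assms(1)
proof (induction N rule: less_induct)
  case (less N)
  show ?case
  proof (cases "N = 1")
    case False
    then obtain p where p: "prime p" "p dvd N" using prime_factor_nat by blast
    have N0: "N \<noteq> 0" "\<not> is_unit p" using less p not_prime_1 by auto
    obtain m where m: "N = p ^ multiplicity p N * m" "\<not> p dvd m"
      using multiplicity_decompose'[OF N0] by metis
    have "multiplicity p N > 0" using p less by (simp add: prime_multiplicity_gt_zero_iff)
    then obtain k where k: "multiplicity p N = Suc k" using gr0_implies_Suc by blast
    define q where "q = p ^ Suc k"
    have N: "N = q * m" using m k by (simp add: q_def)
    have "q > 1" using p unfolding q_def by (metis one_less_power prime_gt_1_nat zero_less_Suc)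
    then have "q > 0" "m > 0" "m < N" using N less by auto
    moreover have "coprime q m" using p m(2) by (simp add: q_def prime_imp_coprime)
    ultimately show ?thesis
      unfolding N using less(1)[of m] assms(3)[OF p(1), of k] N by (intro coprime) (auto simp: q_def)
  qed (use assms(2) in simp)
qed

section \<open>Finitely generated right modules and their residue classes\<close>

definition right_span :: "'h::ring_1 set \<Rightarrow> ('h ^ 'n) set \<Rightarrow> ('h ^ 'n) set"
  where "right_span R S = {\<Sum>x\<in>S. right_scale x (a x) | a. \<forall>x\<in>S. a x \<in> R}"

lemma fg_right_submodule_iff: "fg_right_submodule R L \<longleftrightarrow> (\<exists>S. finite S \<and>
  L = right_span R S)"
  by (simp add: fg_right_submodule_def right_span_def)

context quaternion_order
begin

lemma right_span_add:
  assumes "x \<in> right_span R S" "y \<in> right_span R S"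
  shows "x + y \<in> right_span R S"
proof -
  obtain a b where ab: "\<forall>x\<in>S. a x \<in> R" "\<forall>x\<in>S. b x \<in> R"
    "x = (\<Sum>x\<in>S. right_scale x (a x))" "y = (\<Sum>x\<in>S. right_scale x (b x))"
    using assms unfolding right_span_def by blast
  have "x + y = (\<Sum>x\<in>S. right_scale x (a x + b x))"
    by (simp add: ab(3,4) vec_eq_iff distrib_left sum.distrib)
  then show ?thesis
    unfolding right_span_def using ab by (auto intro!: exI[of _ "\<lambda>x. a x + b x"] R_add)
qed

lemma right_span_right_scale:
  assumes "x \<in> right_span R S" "b \<in> R"
  shows "right_scale x b \<in> right_span R S"
proof -
  obtain a where a: "\<forall>x\<in>S. a x \<in> R" "x = (\<Sum>x\<in>S. right_scale x (a x))"
    using assms unfolding right_span_def by blast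
  have "right_scale x b = (\<Sum>x\<in>S. right_scale x (a x * b))"
    by (simp add: a(2) vec_eq_iff sum_distrib_right mult.assoc)
  then show ?thesis
    unfolding right_span_def using a assms(2) by (auto intro!: exI[of _ "\<lambda>x. a x * b"] R_mult)
qed

lemma right_span_zero: "0 \<in> right_span R S"
proof -
  have "0 = (\<Sum>x\<in>S. right_scale x 0)" by (simp add: vec_eq_iff)
  then show ?thesis
    unfolding right_span_def by (auto intro!: exI[of _ "\<lambda>_. 0"])
qed

lemma right_span_sum: "(\<And>i. i \<in> A \<Longrightarrow> f i \<in> right_span R S) \<Longrightarrow>
  sum f A \<in> right_span R S"
  by (induction A rule: infinite_finite_induct) (auto intro: right_span_add right_span_zero)

lemma right_span_base:
  fixes S :: "('h ^ 'n) set"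
  assumes "finite S" "s \<in> S"
  shows "s \<in> right_span R S"
proof -
  have "s = (\<Sum>x\<in>S. right_scale x (if x = s then 1 else 0))"
  proof -
    have "right_scale x 1 = x" "right_scale x 0 = 0" for x :: "'h ^ 'n" by (simp_all add: vec_eq_iff)
    then have "right_scale x (if x = s then 1 else 0) = (if x = s then s else 0)" for x by auto
    then show ?thesis using assms by simp
  qed
  then show ?thesis
    unfolding right_span_def by (auto intro!: exI[of _ "\<lambda>x. if x = s then 1 else 0"])
qed

text \<open>Finiteness of \<open>R\<close> modulo \<open>N\<close> without a quotient:
  \<open>cl x\<close> records chosen coordinates modulo \<open>N\<close>. Equal classes force
  congruence, although congruent elements may receive different classes.\<close>

lemma R_mod_classes:
  assumes "N > 0"
  shows "\<exists>cl :: 'h \<Rightarrow> 'h \<Rightarrow> int. finite (cl ` R) \<and>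
    (\<forall>x\<in>R. \<forall>y\<in>R. cl x = cl y \<longrightarrow> (1 / of_nat N) *\<^sub>Q (x -
      y) \<in> R)"
proof -
  obtain S where S: "finite S" "S \<subseteq> R" "R = int_mod.span S" using R_generators by blast
  have "\<exists>k. x = (\<Sum>s\<in>S. of_int (k s) * s)" if "x \<in> R" for x
    using that S by (auto simp: int_mod.span_finite)
  then obtain k where k: "\<And>x. x \<in> R \<Longrightarrow> x = (\<Sum>s\<in>S. of_int (k x s) * s)"
    by metis
  define cl where "cl x = (\<lambda>s\<in>S. k x s mod int N)" for x
  have "cl ` R \<subseteq> PiE S (\<lambda>_. {0..<int N})" using assms by (auto simp: cl_def)
  then have "finite (cl ` R)" using S(1) by (meson finite_PiE finite_atLeastLessThan_int finite_subset)
  moreover have "(1 / of_nat N) *\<^sub>Q (x - y) \<in> R" if xy: "x \<in> R" "y \<in> R" "cl x = cl y"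
    for x y
  proof -
    have dvd: "int N dvd k x s - k y s" if "s \<in> S" for s
      using fun_cong[OF xy(3), of s] that by (simp add: cl_def mod_eq_dvd_iff)
    have "x - y = (\<Sum>s\<in>S. of_int (k x s - k y s) *\<^sub>Q s)"
      by (subst k[OF xy(1)], subst k[OF xy(2)])
        (simp add: of_int_mult_scaleQ scaleQ_diff_left sum_subtractf)
    then have "(1 / of_nat N) *\<^sub>Q (x - y) = (\<Sum>s\<in>S. (of_int (k x s -
      k y s) / of_nat N) *\<^sub>Q s)"
      by (simp add: scaleQ_sum_right)
    also have "\<dots> \<in> R"
      using dvd S(2) by (intro R_sum R_scale_Ints) (auto simp:
        of_int_div_Ints_iff[OF assms] simp del: of_int_diff)
    finally show ?thesis .
  qed
  ultimately show ?thesis by blast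
qed

lemma vec_mod_classes:
  fixes K :: "('h ^ 'n) set"
  assumes "N > 0" "d > 0" and K: "\<And>x i. x \<in> K \<Longrightarrow> of_nat d *\<^sub>Q (x $ i) \<in> R"
  shows "\<exists>cl :: 'h ^ 'n \<Rightarrow> 'n \<Rightarrow> 'h \<Rightarrow> int. finite (cl ` K) \<and>
    (\<forall>x\<in>K. \<forall>y\<in>K. cl x = cl y \<longrightarrow>
      (\<forall>i. ((1 / of_nat N) *\<^sub>Q (x - y)) $ i \<in> R))"
proof -
  \<comment> \<open>The coordinates enter \<open>R\<close> only after scaling by \<open>d\<close>,
    so they are compared modulo \<open>d * N\<close>.\<close>
  have "d * N > 0" using assms by simp
  from R_mod_classes[OF this] obtain cl :: "'h \<Rightarrow> 'h \<Rightarrow> int" where cl: "finite (cl ` R)"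
    "\<And>x y. x \<in> R \<Longrightarrow> y \<in> R \<Longrightarrow> cl x = cl y \<Longrightarrow>
      (1 / of_nat (d * N)) *\<^sub>Q (x - y) \<in> R" by blast
  define cl' where "cl' x = (\<lambda>i. cl (of_nat d *\<^sub>Q (x $ i)))" for x :: "'h ^ 'n"
  have "cl' ` K \<subseteq> PiE UNIV (\<lambda>_. cl ` R)" using K by (auto simp: cl'_def)
  then have "finite (cl' ` K)" using cl(1) by (meson finite_PiE finite finite_subset)
  moreover have "((1 / of_nat N) *\<^sub>Q (x - y)) $ i \<in> R"
    if xy: "x \<in> K" "y \<in> K" "cl' x = cl' y" for x y i
  proof -
    have "(1 / of_nat (d * N)) *\<^sub>Q (of_nat d *\<^sub>Q (x $ i) - of_nat d *\<^sub>Q (y $ i)) \<in> R"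
      using fun_cong[OF xy(3), of i] K xy(1,2) by (intro cl(2)) (auto simp: cl'_def)
    then show ?thesis using assms(1,2) by (simp flip: scaleQ_diff_right)
  qed
  ultimately show ?thesis by blast
qed

end

section \<open>Self-dual lattices and orthonormal systems modulo \<open>N\<close>\<close>

locale unimodular_lattice = maximal_quaternion_order R for R :: "'h::quaternion_algebra set" +
  fixes L :: "('h ^ 'n) set" and c :: rat
  assumes fg: "fg_right_submodule R L" and span_L: "rat_vector.span L = UNIV" and c: "c \<noteq> 0"
    and integral: "x \<in> L \<Longrightarrow> y \<in> L \<Longrightarrow> herm c x y \<in> R"
    and unimodular: "unimodular_on R L (herm c)"
begin

lemma L_generators: obtains S where "finite S" "L = right_span R S"
  using fg by (auto simp: fg_right_submodule_iff)

lemma L_add: "x \<in> L \<Longrightarrow> y \<in> L \<Longrightarrow> x + y \<in> L"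
  and L_right_scale: "x \<in> L \<Longrightarrow> b \<in> R \<Longrightarrow> right_scale x b \<in> L"
  and L_zero [simp]: "0 \<in> L"
  using L_generators by (metis right_span_add, metis right_span_right_scale, metis right_span_zero)

lemma L_scale_Ints: "q \<in> \<int> \<Longrightarrow> x \<in> L \<Longrightarrow> q *\<^sub>Q x \<in> L"
proof -
  assume "q \<in> \<int>" "x \<in> L"
  moreover have "q *\<^sub>Q x = right_scale x (q *\<^sub>Q 1)" by (simp add: vec_eq_iff)
  ultimately show ?thesis using L_right_scale[of x "q *\<^sub>Q 1"] R_scale_Ints[of q 1] by simp
qed

lemma L_diff: "x \<in> L \<Longrightarrow> y \<in> L \<Longrightarrow> x - y \<in> L"
  using L_add[of x "(-1) *\<^sub>Q y"] L_scale_Ints[of "-1" y] by simp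

lemma L_sum: "(\<And>i. i \<in> A \<Longrightarrow> f i \<in> L) \<Longrightarrow> sum f A \<in> L"
  by (induction A rule: infinite_finite_induct) (auto intro: L_add)

lemma L_denominator: "\<exists>d::nat. d > 0 \<and> of_nat d *\<^sub>Q x \<in> L"
  by (intro span_denominator L_add L_scale_Ints) (auto simp: span_L)

lemma L_bounded: "\<exists>d::nat. d > 0 \<and>
  (\<forall>x\<in>L. \<forall>i. of_nat d *\<^sub>Q (x $ i) \<in> R)"
proof -
  obtain S where S: "finite S" "L = right_span R S" using L_generators .
  obtain d :: nat where d: "d > 0"
    "\<forall>y\<in>(\<lambda>(x, i). x $ i) ` (S \<times> UNIV). of_nat d *\<^sub>Q y \<in> R"
    using R_common_denominator[of "(\<lambda>(x, i). x $ i) ` (S \<times> UNIV)"] S(1) by auto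
  have "of_nat d *\<^sub>Q (x $ i) \<in> R" if x: "x \<in> L" for x i
  proof -
    obtain a where a: "\<forall>x\<in>S. a x \<in> R" "x = (\<Sum>x\<in>S. right_scale x (a x))"
      using x S(2) unfolding right_span_def by blast
    have "of_nat d *\<^sub>Q (x $ i) = (\<Sum>x\<in>S. of_nat d *\<^sub>Q (x $ i) * a x)"
      by (simp add: a(2) scaleQ_sum_right)
    also have "\<dots> \<in> R" using d a by (intro R_sum R_mult) auto
    finally show ?thesis .
  qed
  then show ?thesis using d by blast
qed

lemma L_contains: "\<exists>d::nat. d > 0 \<and>
  (\<forall>x. (\<forall>i. x $ i \<in> R) \<longrightarrow> of_nat d *\<^sub>Q x \<in> L)"
proof -
  have "\<exists>d::nat. d > 0 \<and>
    (\<forall>x\<in>range (\<lambda>i. axis i 1). of_nat d *\<^sub>Q x \<in> L)"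
    by (rule common_denominator[OF L_denominator L_scale_Ints[OF Ints_of_nat]]) auto
  then obtain d :: nat where d: "d > 0" "\<forall>i. of_nat d *\<^sub>Q axis i 1 \<in> L" by auto
  have "of_nat d *\<^sub>Q x \<in> L" if "\<forall>i. x $ i \<in> R" for x
  proof -
    have "of_nat d *\<^sub>Q x = (\<Sum>i\<in>UNIV. right_scale (of_nat d *\<^sub>Q axis i 1) (x $ i))"
      by (simp add: vec_eq_iff axis_def if_distrib[of "\<lambda>y. y * _"] if_distrib[of "\<lambda>y.
        _ *\<^sub>Q y"] cong: if_cong)
    also have "\<dots> \<in> L" using d that by (intro L_sum L_right_scale) auto
    finally show ?thesis .
  qed
  then show ?thesis using d by blast
qed

text \<open>The form in which unimodularity is applied: the functional of \<open>w\<close> is also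
  that of some \<open>x \<in> L\<close>, and the two vectors coincide because \<open>L\<close> spans
  the space and the form is nondegenerate.\<close>

lemma L_dual: assumes "\<And>y. y \<in> L \<Longrightarrow> herm c w y \<in> R" shows "w \<in> L"
proof -
  have "herm c w \<in> right_dual R L"
    using assms by (auto simp: right_dual_def herm_add_right herm_right_scale)
  then obtain x where x: "x \<in> L" "\<And>y. y \<in> L \<Longrightarrow> herm c w y = herm c x y"
    using unimodular unfolding unimodular_on_def by blast
  have "herm c (w - x) y = 0" for y
  proof -
    obtain d :: nat where d: "d > 0" "of_nat d *\<^sub>Q y \<in> L" using L_denominator by blast
    have "of_nat d *\<^sub>Q herm c (w - x) y = 0" using x(2)[OF d(2)]
      by (auto simp: herm_diff_left herm_scaleQ_right)
    then show ?thesis using d by simp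
  qed
  then have "w - x = 0" by (rule herm_nondegenerate[OF c])
  then show ?thesis using x(1) by simp
qed

lemma herm_norm_Ints: "x \<in> L \<Longrightarrow> herm_norm c x \<in> \<int>"
  using integral[of x x] by (simp add: herm_self R_scaleQ_one_iff)

lemma L_zero_if_powers_divide:
  assumes "N \<ge> 2" "\<And>k. (1 / of_nat N ^ k) *\<^sub>Q x \<in> L"
  shows "x = 0"
proof -
  obtain d :: nat where d: "d > 0"
    "\<And>x i. x \<in> L \<Longrightarrow> of_nat d *\<^sub>Q (x $ i) \<in> R" using L_bounded by blast
  have "of_nat d *\<^sub>Q x $ i = 0" for i
    by (rule zero_if_powers_divide_R[OF assms(1)]) (use d(2)[OF assms(2)] in \<open>simp add: mult.commute\<close>)
  then show ?thesis using d(1) by (simp add: vec_eq_iff)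
qed

text \<open>A kernel vector exists since the map into the coordinates in \<open>I\<close> misses a
  coordinate. It can be divided by \<open>N\<close> only finitely often inside
  \<open>L\<close>.\<close>

lemma exists_orthogonal_primitive:
  assumes "(I :: 'n set) \<noteq> UNIV" "N \<ge> 2"
  shows "\<exists>z\<in>L. (1 / of_nat N) *\<^sub>Q z \<notin> L \<and>
    (\<forall>i\<in>I. herm c (e i) z = 0)"
proof -
  \<comment> \<open>Padding with zeros outside \<open>I\<close> gives an endomorphism, for which
    failure of surjectivity forces failure of injectivity.\<close>
  define f where "f z = (\<chi> i. if i \<in> I then herm c (e i) z else 0)" for z
  obtain i0 where i0: "i0 \<notin> I" using assms(1) by blast
  have "\<not> surj f"
  proof
    assume "surj f"
    then obtain z where "f z = axis i0 1" by (metis surjD)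
    then have "f z $ i0 = 1" by simp
    then show False using i0 by (simp add: f_def)
  qed
  moreover have add: "f (x + y) = f x + f y" for x y by (simp add: f_def vec_eq_iff herm_add_right)
  ultimately have "\<not> inj f" using rat_vec_additive_inj_imp_surj by blast
  then obtain x y where xy: "x \<noteq> y" "f x = f y" by (auto simp: inj_def)
  define z where "z = x - y"
  have "f z = 0" using add[of z y] xy by (simp add: z_def)
  moreover have "herm c (e i) z = f z $ i" if "i \<in> I" for i using that by (simp add: f_def)
  ultimately have z: "z \<noteq> 0" "\<And>i. i \<in> I \<Longrightarrow> herm c (e i) z = 0" using xy
    by (auto simp: z_def)
  obtain d :: nat where d: "d > 0" "of_nat d *\<^sub>Q z \<in> L" using L_denominator by blast
  have "\<exists>k. (1 / of_nat N ^ k) *\<^sub>Q of_nat d *\<^sub>Q z \<in> L \<and>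
    (1 / of_nat N ^ Suc k) *\<^sub>Q of_nat d *\<^sub>Q z \<notin> L"
  proof (rule ccontr)
    assume *: "\<not> ?thesis"
    have "(1 / of_nat N ^ k) *\<^sub>Q of_nat d *\<^sub>Q z \<in> L" for k
    proof (induction k)
      case 0
      show ?case using d(2) by simp
    qed (use * in blast)
    then have "of_nat d *\<^sub>Q z = 0" using L_zero_if_powers_divide[OF assms(2)] by blast
    then show False using z d by simp
  qed
  then obtain k where k: "(1 / of_nat N ^ k) *\<^sub>Q of_nat d *\<^sub>Q z \<in> L"
    "(1 / of_nat N ^ Suc k) *\<^sub>Q of_nat d *\<^sub>Q z \<notin> L" by blast
  have "(1 / of_nat N) *\<^sub>Q ((1 / of_nat N ^ k) *\<^sub>Q of_nat d *\<^sub>Q z) =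
    (1 / of_nat N ^ Suc k) *\<^sub>Q of_nat d *\<^sub>Q z" by simp
  then show ?thesis using k z(2) by (intro bexI[OF _ k(1)]) (auto simp: herm_scaleQ_right)
qed

text \<open>Orthonormality modulo \<open>N\<close>, relative to an index set so that Gram-Schmidt
  can add one vector at a time.\<close>

definition gram :: "nat \<Rightarrow> 'n set \<Rightarrow> ('n \<Rightarrow> 'h ^ 'n) \<Rightarrow> bool"
  where "gram N I e \<longleftrightarrow> (\<forall>i\<in>I. e i \<in> L) \<and>
    (\<forall>i\<in>I. \<forall>j\<in>I. (1 / of_nat N) *\<^sub>Q (herm c (e i) (e j) - (if i =
      j then 1 else 0)) \<in> R)"

text \<open>
  Assume that all norms were divisible by \<open>p\<close> on the approximate complement of the \<open>e i\<close>.  A vector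
  \<open>z\<close> orthogonal to all \<open>e i\<close> would then pair with \<open>L\<close> into the radical \<open>J\<close> of the trace form modulo
  \<open>p\<close>.  As \<open>J\<close> is locally generated by an element whose norm is exactly divisible by \<open>p\<close> (or by \<open>p\<close>
  itself), unimodularity makes \<open>z\<close> divisible by \<open>p\<close>.
\<close>

lemma exists_unit_norm_in_complement:
  assumes p: "prime (p::nat)" and e: "gram (p ^ Suc k) I e" and I: "I \<noteq> UNIV"
  shows "\<exists>x\<in>L. (\<forall>i\<in>I. (1 / of_nat (p ^ Suc k)) *\<^sub>Q herm c (e i) x \<in>
    R) \<and> herm_norm c x / of_nat p \<notin> \<int>"
proof (rule ccontr)
  assume neg: "\<not> ?thesis"
  define N where "N = p ^ Suc k"
  have p2: "p \<ge> 2" "p > 0" using p prime_ge_2_nat prime_gt_0_nat by auto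
  have eL: "e i \<in> L" if "i \<in> I" for i using e that by (auto simp: gram_def)
  have eG: "(1 / of_nat N) *\<^sub>Q (herm c (e i) (e j) - (if i = j then 1 else 0)) \<in> R"
    if "i \<in> I" "j \<in> I" for i j
    using e that unfolding gram_def N_def by blast
  have div: "herm_norm c x / of_nat p \<in> \<int>"
    if "x \<in> L" "\<And>i. i \<in> I \<Longrightarrow>
      (1 / of_nat N) *\<^sub>Q herm c (e i) x \<in> R" for x
    using neg that unfolding N_def by blast
  \<comment> \<open>The trace of the pairing is a polarisation of \<open>herm_norm\<close>, whose
    values on the approximate complement are all divisible by \<open>p\<close> by
    assumption.\<close>
  have radical: "trd (herm c x y * b) / of_nat p \<in> \<int>"
    if x: "x \<in> L" "\<And>i. i \<in> I \<Longrightarrow> herm c (e i) x =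
      0" and y: "y \<in> L" and b: "b \<in> R" for x y b
  proof -
    define y1 where "y1 = right_scale y b"
    have y1: "y1 \<in> L" using y b by (simp add: y1_def L_right_scale)
    \<comment> \<open>Projection to the approximate complement. It leaves the pairing with
      \<open>x\<close> unchanged, as \<open>x\<close> is exactly orthogonal to the
      \<open>e i\<close>.\<close>
    define y' where "y' = y1 - (\<Sum>i\<in>I. right_scale (e i) (herm c (e i) y1))"
    have y': "y' \<in> L" unfolding y'_def by (intro L_diff y1 L_sum L_right_scale eL integral)
    have orth: "(1 / of_nat N) *\<^sub>Q herm c (e j) y' \<in> R" if j: "j \<in> I" for j
    proof -
      have "herm c (e j) y1 = (\<Sum>i\<in>I. (if j = i then 1 else 0) * herm c (e i) y1)"
        using j by (simp add: if_distrib[of "\<lambda>x. x * _"] cong: if_cong)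
      then have "herm c (e j) y' = - (\<Sum>i\<in>I. (herm c (e j) (e i) - (if j =
        i then 1 else 0)) * herm c (e i) y1)"
        by (simp add: y'_def herm_diff_right herm_sum_right herm_right_scale left_diff_distrib sum_subtractf del: sum.delta sum.delta')
      then have "(1 / of_nat N) *\<^sub>Q herm c (e j) y' =
          - (\<Sum>i\<in>I. ((1 / of_nat N) *\<^sub>Q (herm c (e j) (e i) - (if j =
            i then 1 else 0))) * herm c (e i) y1)"
        by (simp only: rat_vector.scale_minus_right scaleQ_sum_right mult_scaleQ_left)
      also have "\<dots> \<in> R" by (intro R_uminus R_sum R_mult eG integral eL y1 j)
      finally show ?thesis .
    qed
    have "herm c x (e i) = 0" if "i \<in> I" for i using x(2)[OF that] invol_herm[of c "e i" x] by simp
    then have "herm c x y' = herm c x y * b"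
      by (simp add: y'_def herm_diff_right herm_sum_right herm_right_scale y1_def)
    then have "trd (herm c x y * b) / of_nat p = herm_norm c (x + y') / of_nat p -
      herm_norm c x / of_nat p - herm_norm c y' / of_nat p"
      by (simp add: herm_norm_add flip: diff_divide_distrib)
    also have "\<dots> \<in> \<int>"
      by (intro Ints_diff div L_add x(1) y') (use x(2) orth in \<open>auto simp: herm_add_right\<close>)
    finally show ?thesis .
  qed
  \<comment> \<open>All pairings of \<open>x\<close> with \<open>L\<close> lie in the radical, so
    after multiplication by another radical element they lie in \<open>p R\<close>; self-duality
    then divides the vector itself by \<open>p\<close>.\<close>
  have shift: "(1 / of_nat p) *\<^sub>Q right_scale x (invol \<pi>) \<in> L"
    if x: "x \<in> L" "\<And>i. i \<in> I \<Longrightarrow> herm c (e i) x =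
      0" and \<pi>: "\<pi> \<in> R" "\<And>b. b \<in> R \<Longrightarrow>
        trd (\<pi> * b) / of_nat p \<in> \<int>" for x \<pi>
  proof (rule L_dual)
    fix y assume y: "y \<in> L"
    have "(1 / of_nat p) *\<^sub>Q (\<pi> * herm c x y) \<in> R"
      by (rule mult_divisible[OF p \<pi> integral[OF x(1) y] radical[OF x y]])
    then show "herm c ((1 / of_nat p) *\<^sub>Q right_scale x (invol \<pi>)) y \<in> R"
      by (simp add: herm_scaleQ_left herm_right_scale_left)
  qed
  obtain z where z: "z \<in> L" "(1 / of_nat p) *\<^sub>Q z \<notin> L"
    "\<And>i. i \<in> I \<Longrightarrow> herm c (e i) z = 0"
    using exists_orthogonal_primitive[OF I p2(1), of e] by blast
  show False
  proof (cases "\<exists>\<pi>\<in>R. (\<forall>b\<in>R. trd (\<pi> * b) / of_nat p \<in> \<int>) \<and>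
    (1 / of_nat p) *\<^sub>Q \<pi> \<notin> R")
    case False
    have "(1 / of_nat p) *\<^sub>Q z \<in> L"
    proof (rule L_dual)
      fix y assume "y \<in> L"
      then have "(1 / of_nat p) *\<^sub>Q herm c z y \<in> R"
        using False integral[OF z(1)] radical[OF z(1,3)] by blast
      then show "herm c ((1 / of_nat p) *\<^sub>Q z) y \<in> R" by (simp add: herm_scaleQ_left)
    qed
    then show False using z(2) by blast
  next
    case True
    then obtain \<pi> where \<pi>: "\<pi> \<in> R"
      "\<And>b. b \<in> R \<Longrightarrow> trd (\<pi> * b) / of_nat p \<in> \<int>"
        "(1 / of_nat p) *\<^sub>Q \<pi> \<notin> R" by blast
    have \<pi>': "trd (invol \<pi> * b) / of_nat p \<in> \<int>" if "b \<in> R" for b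
    proof -
      have "trd (invol \<pi> * b) = trd (\<pi> * invol b)"
        by (metis invol_invol invol_mult trd_invol trd_mult_commute)
      then show ?thesis using \<pi>(2)[OF R_invol[OF that]] by simp
    qed
    obtain u where u: "nrd \<pi> / of_nat p = of_int u" using nrd_divisible[OF p \<pi>(1,2)]
      by (auto elim: Ints_cases)
    \<comment> \<open>Otherwise maximality would put \<open>\<pi>\<close> into \<open>p R\<close>.
      Hence \<open>p\<close> divides \<open>nrd \<pi>\<close> exactly once and \<open>u\<close> is
      prime to \<open>p\<close>.\<close>
    have "nrd ((1 / of_nat p) *\<^sub>Q \<pi>) \<notin> \<int>"
    proof
      assume "nrd ((1 / of_nat p) *\<^sub>Q \<pi>) \<in> \<int>"
      moreover have "trd ((1 / of_nat p) *\<^sub>Q \<pi> * b) \<in> \<int>" if "b \<in> R" for b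
        using \<pi>(2)[OF that] by (simp add: trd_scaleQ)
      ultimately show False using maximal_orderD \<pi>(3) by blast
    qed
    moreover have "nrd ((1 / of_nat p) *\<^sub>Q \<pi>) = of_int u / of_nat p" using u[symmetric]
      by (simp add: nrd_scaleQ power2_eq_square)
    ultimately have "\<not> int p dvd u" using of_int_div_Ints_iff[OF p2(2), of u] by simp
    then have "coprime (int p) u" using p by (intro prime_imp_coprime) auto
    then obtain s t where st: "s * int p + t * u = 1" by (metis bezout_int coprime_iff_gcd_eq_1)
    define z1 where "z1 = (1 / of_nat p) *\<^sub>Q right_scale z (invol \<pi>)"
    have z1: "z1 \<in> L" "\<And>i. i \<in> I \<Longrightarrow> herm c (e i) z1 = 0"
      using shift[OF z(1,3) \<pi>(1,2)] z(3) by (auto simp: z1_def herm_scaleQ_right herm_right_scale)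
    \<comment> \<open>Shifting by \<open>\<pi>\<close> and then by its conjugate multiplies
      \<open>z\<close> by \<open>nrd \<pi> / p\<^sup>2 = u / p\<close>; Bezout turns this into
      divisibility of \<open>z\<close> by \<open>p\<close>.\<close>
    have "(1 / of_nat p) *\<^sub>Q right_scale z1 (invol (invol \<pi>)) \<in> L"
      by (rule shift[OF z1 R_invol[OF \<pi>(1)] \<pi>'])
    moreover have "(1 / of_nat p) *\<^sub>Q right_scale z1 (invol (invol \<pi>)) =
      (of_int u / of_nat p) *\<^sub>Q z"
      by (simp add: vec_eq_iff z1_def mult.assoc invol_mult_self flip: u)
    ultimately have "of_int t *\<^sub>Q (of_int u / of_nat p) *\<^sub>Q z + of_int s *\<^sub>Q z \<in> L"
      using z(1) by (metis L_add L_scale_Ints Ints_of_int)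
    moreover have "of_int t *\<^sub>Q (of_int u / of_nat p) *\<^sub>Q z + of_int s *\<^sub>Q z =
      (1 / of_nat p) *\<^sub>Q z"
    proof -
      have "of_int t * (of_int u / of_nat p) + of_int s = (of_int (s * int p + t * u) :: rat) / of_nat p"
        using p2 by (simp add: field_simps)
      then show ?thesis by (simp add: st flip: scaleQ_add_left)
    qed
    ultimately show False using z(2) by simp
  qed
qed

text \<open>Scaling the new vector on the right by an element of \<open>R\<close> preserves its
  orthogonality to the earlier ones, so only its norm remains to be corrected.\<close>

lemma gram_prime_power:
  assumes p: "prime (p::nat)"
  shows "\<exists>e. gram (p ^ Suc k) I e"
  using finite[of I]
proof (induction I)
  case empty
  show ?case by (simp add: gram_def)
next
  case (insert i0 I)
  define N where "N = p ^ Suc k"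
  have p2: "p \<ge> 2" "p > 0" using p prime_ge_2_nat prime_gt_0_nat by auto
  have N0: "N > 0" using p2 by (simp add: N_def)
  from insert obtain e where e: "gram N I e" unfolding N_def by blast
  have "I \<noteq> UNIV" using insert(2) by auto
  then obtain x where x: "x \<in> L"
    "\<And>i. i \<in> I \<Longrightarrow> (1 / of_nat N) *\<^sub>Q herm c (e i) x \<in> R"
      "herm_norm c x / of_nat p \<notin> \<int>"
    using exists_unit_norm_in_complement[OF p e[unfolded N_def]] unfolding N_def by blast
  obtain r where r: "herm_norm c x = of_int r" using herm_norm_Ints[OF x(1)] by (elim Ints_cases)
  have "\<not> int p dvd r" using x(3) r of_int_div_Ints_iff[OF p2(2), of r] by simp
  then have "coprime (int p) r" using p by (intro prime_imp_coprime) auto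
  then have "coprime (int N) r" by (simp add: N_def)
  \<comment> \<open>Here \<open>t\<close> inverts the norm \<open>r\<close> of \<open>x\<close>
    modulo \<open>N\<close>. Scaling by \<open>a\<close> multiplies the norm by
    \<open>nrd a\<close>, which will be chosen congruent to \<open>t\<close>.\<close>
  then obtain s t where st: "s * int N + t * r = 1" by (metis bezout_int coprime_iff_gcd_eq_1)
  have "\<not> int p dvd t"
  proof
    assume "int p dvd t"
    moreover have "int p dvd int N" by (simp add: N_def)
    ultimately have "int p dvd s * int N + t * r" by (intro dvd_add dvd_mult dvd_mult2)
    then show False using st p2 by simp
  qed
  then obtain a where a: "a \<in> R" "(nrd a - of_int t) / of_nat N \<in> \<int>"
    using nrd_represents_prime_power[OF p, of t k] by (auto simp: N_def)
  define e' where "e' = e(i0 := right_scale x a)"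
  have e'_I: "e' i = e i" if "i \<in> I" for i using that insert(2) by (auto simp: e'_def)
  have off: "(1 / of_nat N) *\<^sub>Q herm c (e' i) (e' i0) \<in> R" if "i \<in> I" for i
    using R_mult[OF x(2)[OF that] a(1)] that insert(2) by (auto simp: e'_def herm_right_scale)
  have off': "(1 / of_nat N) *\<^sub>Q herm c (e' i0) (e' i) \<in> R" if "i \<in> I" for i
    using R_invol[OF off[OF that]] by (simp add: invol_herm)
  have "herm c (e' i0) (e' i0) = invol a * (herm c x x * a)"
    by (simp add: e'_def herm_right_scale herm_right_scale_left mult.assoc)
  also have "\<dots> = (of_int r * nrd a) *\<^sub>Q 1"
    unfolding herm_self r by (simp add: invol_mult_self)
  finally have "(1 / of_nat N) *\<^sub>Q (herm c (e' i0) (e' i0) - 1) = ((of_int r * nrd a -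
    1) / of_nat N) *\<^sub>Q 1"
    by (simp add: scaleQ_diff_right scaleQ_diff_left diff_divide_distrib)
  moreover have "(of_int r * nrd a - 1) / of_nat N = of_int r * ((nrd a - of_int t) / of_nat N) - of_int s"
  proof -
    have "(1::rat) = of_int (s * int N + t * r)" by (simp only: st of_int_1)
    then show ?thesis using N0 by (simp add: field_simps)
  qed
  ultimately have "(1 / of_nat N) *\<^sub>Q (herm c (e' i0) (e' i0) - 1) \<in> R"
    using a(2) by (simp only: R_scaleQ_one_iff) (intro Ints_diff Ints_mult Ints_of_int)
  then have "gram N (insert i0 I) e'"
    using e off off' x(1) a(1) insert(2) unfolding gram_def
    by (auto simp: e'_I) (auto simp: e'_def intro: L_right_scale)
  then show ?case unfolding N_def by blast
qed

text \<open>One half of the Chinese remainder step: modulo \<open>P\<close> the coefficient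
  \<open>s\<close> is 1 and the other is 0, so the combined system is congruent to
  \<open>e\<close>.\<close>

lemma gram_combine:
  assumes e: "gram P I e" and e': "\<And>i. i \<in> I \<Longrightarrow> e' i \<in> L" and st: "s +
    t * int P = 1" and P: "P > 0"
    and ij: "i \<in> I" "j \<in> I"
  shows "(1 / of_nat P) *\<^sub>Q (herm c (of_int s *\<^sub>Q e i +
    of_int (t * int P) *\<^sub>Q e' i) (of_int s *\<^sub>Q e j + of_int (t * int P) *\<^sub>Q e' j)
    - (if i = j then 1 else 0)) \<in> R"
proof -
  define \<delta> :: 'h where "\<delta> = (if i = j then 1 else 0)"
  have \<delta>: "\<delta> \<in> R" by (simp add: \<delta>_def)
  have eL: "e i \<in> L" "e j \<in> L" using e ij by (auto simp: gram_def)
  have G: "(1 / of_nat P) *\<^sub>Q (herm c (e i) (e j) - \<delta>) \<in> R" using e ij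
    unfolding gram_def \<delta>_def by blast
  have s: "s = 1 - t * int P" using st by simp
  have "(1 / of_nat P) *\<^sub>Q (herm c (of_int s *\<^sub>Q e i +
    of_int (t * int P) *\<^sub>Q e' i) (of_int s *\<^sub>Q e j + of_int (t * int P) *\<^sub>Q e' j) -
      \<delta>)
    = of_int (s * s) *\<^sub>Q ((1 / of_nat P) *\<^sub>Q (herm c (e i) (e j) - \<delta>)) +
      of_int (t * (t * int P - 2)) *\<^sub>Q \<delta>
      + of_int (s * t) *\<^sub>Q (herm c (e i) (e' j) + herm c (e' i) (e j)) +
        of_int (t * t * int P) *\<^sub>Q herm c (e' i) (e' j)"
  proof -
    \<comment> \<open>This is \<open>(s * s - 1) / P\<close>, as
      \<open>s = 1 - t * P\<close>.\<close>
    define X where "X = t * (t * int P - 2)"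
    have "s * s = X * int P + 1" unfolding s X_def by algebra
    then have "(of_int (s * s) :: rat) / of_nat P - 1 / of_nat P = of_int X"
      using P by (simp add: add_divide_distrib del: of_int_mult) simp
    then have X: "of_int (s * s) * (1 / of_nat P) - 1 / of_nat P = (of_int X :: rat)" by simp
    have T: "(of_int (t * int P) :: rat) * (1 / of_nat P) = of_int t" using P by simp
    have lin: "q *\<^sub>Q ((S * S) *\<^sub>Q a + (S * T) *\<^sub>Q b + ((T * S) *\<^sub>Q a' +
      (T * T) *\<^sub>Q b') - \<delta>) =
        (S * S) *\<^sub>Q (q *\<^sub>Q (a - \<delta>)) + (S * S * q - q) *\<^sub>Q \<delta> +
          (S * (T * q)) *\<^sub>Q (b + a') + (T * (T * q)) *\<^sub>Q b'"
      for q S T and a b a' b' :: 'h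
      by (simp add: scaleQ_add_right scaleQ_diff_right scaleQ_diff_left mult_ac)
    have "herm c (of_int s *\<^sub>Q e i + of_int (t * int P) *\<^sub>Q e' i) (of_int s *\<^sub>Q e j +
      of_int (t * int P) *\<^sub>Q e' j) =
      (of_int s * of_int s) *\<^sub>Q herm c (e i) (e j) +
        (of_int s * of_int (t * int P)) *\<^sub>Q herm c (e i) (e' j) +
      ((of_int (t * int P) * of_int s) *\<^sub>Q herm c (e' i) (e j) +
        (of_int (t * int P) * of_int (t * int P)) *\<^sub>Q herm c (e' i) (e' j))"
      by (simp only: herm_add_left herm_add_right herm_scaleQ_left herm_scaleQ_right scaleQ_add_right scaleQ_scaleQ)
        (simp only: mult.commute add_ac)
    note expand = this
    have c1: "(of_int s * of_int s :: rat) = of_int (s * s)" by (rule of_int_mult[symmetric])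
    have c2: "of_int s * (of_int (t * int P) * (1 / of_nat P)) = (of_int (s * t) :: rat)"
      unfolding T by (rule of_int_mult[symmetric])
    have c3: "of_int (t * int P) * (of_int (t * int P) * (1 / of_nat P)) = (of_int (t * t * int P) :: rat)"
      unfolding T of_int_mult[symmetric]
        by (rule arg_cong[of _ _ of_int]) (rule mult.commute[THEN trans], rule mult.assoc[symmetric])
    show ?thesis unfolding expand lin unfolding c1 c2 c3 X unfolding X_def by (rule refl)
  qed
  also have "\<dots> \<in> R"
    by (intro R_add R_scale_Ints[OF Ints_of_int G] R_scale_Ints[OF Ints_of_int \<delta>] R_scale_Ints[OF Ints_of_int R_add]
        R_scale_Ints[OF Ints_of_int integral] integral eL e' ij)
  finally show ?thesis by (simp only: \<delta>_def)
qed

lemma gram_exists: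
  assumes "N > 0"
  shows "\<exists>e. gram N UNIV e"
  using assms
proof (induction N rule: nat_coprime_induct)
  case one
  \<comment> \<open>Modulo 1 there is no condition beyond membership in \<open>L\<close>.\<close>
  show ?case by (intro exI[of _ "\<lambda>_. 0"]) (auto simp: gram_def intro!: R_uminus)
next
  case (prime_power p k)
  then show ?case by (rule gram_prime_power)
next
  case (coprime P m)
  note cop = coprime(1) and Pm = coprime(2,3)
  obtain e1 where e1: "gram P UNIV e1" using coprime(4) by blast
  obtain e2 where e2: "gram m UNIV e2" using coprime(5) by blast
  obtain u v where uv: "u * int P + v * int m = 1" using cop
    by (metis bezout_int coprime_iff_gcd_eq_1 coprime_int_iff)
  \<comment> \<open>Congruent to \<open>e1\<close> modulo \<open>P\<close> and to \<open>e2\<close>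
    modulo \<open>m\<close>.\<close>
  define e where "e i = of_int (v * int m) *\<^sub>Q e1 i + of_int (u * int P) *\<^sub>Q e2 i" for i
  have eL: "e1 i \<in> L" "e2 i \<in> L" for i using e1 e2 by (auto simp: gram_def)
  have "e i \<in> L" for i unfolding e_def by (intro L_add L_scale_Ints eL) auto
  moreover have "(1 / of_nat (P * m)) *\<^sub>Q (herm c (e i) (e j) - (if i = j then 1 else 0)) \<in> R"
    for i j
  proof (rule coprime_divide_closed[OF _ _ cop Pm(1,2)])
    show "(1 / of_nat P) *\<^sub>Q (herm c (e i) (e j) - (if i = j then 1 else 0)) \<in> R"
      unfolding e_def using uv by (intro gram_combine[OF e1]) (auto simp: eL Pm)
    show "(1 / of_nat m) *\<^sub>Q (herm c (e i) (e j) - (if i = j then 1 else 0)) \<in> R"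
      unfolding e_def add.commute[of "of_int (v * int m) *\<^sub>Q _"] using uv
        by (intro gram_combine[OF e2]) (auto simp: eL Pm)
  qed (auto intro: R_add R_scale_Ints)
  ultimately show ?case unfolding gram_def by blast
qed

lemma L_mod_classes:
  assumes "N > 0"
  shows "\<exists>cl :: 'h ^ 'n \<Rightarrow> 'n \<Rightarrow> 'h \<Rightarrow> int.
    finite (cl ` L) \<and> (\<forall>x\<in>L. \<forall>y\<in>L. cl x = cl y \<longrightarrow>
      (1 / of_nat N) *\<^sub>Q (x - y) \<in> L)"
proof -
  obtain d :: nat where d: "d > 0"
    "\<And>x i. x \<in> L \<Longrightarrow> of_nat d *\<^sub>Q (x $ i) \<in> R" using L_bounded by blast
  obtain d' :: nat where d': "d' > 0"
    "\<And>x. (\<forall>i. x $ i \<in> R) \<Longrightarrow> of_nat d' *\<^sub>Q x \<in> L"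
      using L_contains by blast
  have "N * d' > 0" using assms d' by simp
  then have "\<exists>cl :: 'h ^ 'n \<Rightarrow> 'n \<Rightarrow> 'h \<Rightarrow> int.
    finite (cl ` L) \<and>
    (\<forall>x\<in>L. \<forall>y\<in>L. cl x = cl y \<longrightarrow>
      (\<forall>i. ((1 / of_nat (N * d')) *\<^sub>Q (x - y)) $ i \<in> R))"
    by (rule vec_mod_classes[OF _ d(1)]) (rule d(2))
  then obtain cl :: "'h ^ 'n \<Rightarrow> 'n \<Rightarrow> 'h \<Rightarrow> int" where cl: "finite (cl ` L)"
    "\<forall>x\<in>L. \<forall>y\<in>L. cl x = cl y \<longrightarrow>
      (\<forall>i. ((1 / of_nat (N * d')) *\<^sub>Q (x - y)) $ i \<in> R)" by blast
  have "(1 / of_nat N) *\<^sub>Q (x - y) \<in> L" if "x \<in> L" "y \<in> L" "cl x = cl y" for x y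
  proof -
    have "\<forall>i. ((1 / of_nat (N * d')) *\<^sub>Q (x - y)) $ i \<in> R" using cl(2) that by blast
    from d'(2)[OF this] show ?thesis using d'(1) by simp
  qed
  then show ?thesis using cl(1) by blast
qed

lemma gram_cong:
  assumes "gram N I e'" "\<And>i. i \<in> I \<Longrightarrow> e i \<in> L"
    "\<And>i. i \<in> I \<Longrightarrow> (1 / of_nat N) *\<^sub>Q (e' i - e i) \<in> L"
  shows "gram N I e"
  unfolding gram_def
proof (intro conjI ballI)
  fix i j assume ij: "i \<in> I" "j \<in> I"
  have e': "e' j \<in> L" using assms(1) ij by (auto simp: gram_def)
  have G: "(1 / of_nat N) *\<^sub>Q (herm c (e' i) (e' j) - (if i = j then 1 else 0)) \<in> R"
    using assms(1) ij unfolding gram_def by blast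
  have "(1 / of_nat N) *\<^sub>Q (herm c (e i) (e j) - (if i = j then 1 else 0)) =
      (1 / of_nat N) *\<^sub>Q (herm c (e' i) (e' j) - (if i = j then 1 else 0))
      - herm c ((1 / of_nat N) *\<^sub>Q (e' i - e i)) (e' j) -
        herm c (e i) ((1 / of_nat N) *\<^sub>Q (e' j - e j))"
    by (simp only: herm_scaleQ_left herm_scaleQ_right herm_diff_left herm_diff_right scaleQ_diff_right)
      (simp add: algebra_simps)
  also have "\<dots> \<in> R" using G assms(2,3) ij e' by (intro R_diff integral) auto
  finally show "(1 / of_nat N) *\<^sub>Q (herm c (e i) (e j) - (if i = j then 1 else 0)) \<in> R" .
qed (use assms(2) in auto)

lemma gram_mono:
  assumes "gram (m * N) I e" "m > 0"
  shows "gram N I e"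
  unfolding gram_def
proof (intro conjI ballI)
  fix i j assume "i \<in> I" "j \<in> I"
  then have "(1 / of_nat (m * N)) *\<^sub>Q (herm c (e i) (e j) - (if i = j then 1 else 0)) \<in> R"
    using assms(1) unfolding gram_def by blast
  from R_scale_Ints[OF Ints_of_nat[of m] this] show "(1 / of_nat N) *\<^sub>Q (herm c (e i) (e j) -
    (if i = j then 1 else 0)) \<in> R"
    using assms(2) by simp
qed (use assms(1) in \<open>auto simp: gram_def\<close>)

text \<open>Compactness in the style of Koenig's lemma: a system is kept only if it extends to
  orthonormal systems at all higher levels, and finiteness of \<open>L\<close> modulo each factorial
  ensures that such a system can be refined.\<close>

lemma gram_sequence:
  "\<exists>E :: nat \<Rightarrow> 'n \<Rightarrow> 'h ^ 'n. \<forall>k. gram (fact k) UNIV (E k) \<and>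
    (\<forall>i. (1 / of_nat (fact k)) *\<^sub>Q (E (Suc k) i - E k i) \<in> L)"
proof -
  define good where "good k e \<longleftrightarrow> (\<forall>i. e i \<in> L) \<and>
    (\<forall>m\<ge>k. \<exists>e'. gram (fact m) UNIV e' \<and>
      (\<forall>i. (1 / of_nat (fact k)) *\<^sub>Q (e' i -
        e i) \<in> L))" for k and e :: "'n \<Rightarrow> 'h ^ 'n"
  have gramL: "e i \<in> L" if "gram N UNIV e" for N e i using that by (auto simp: gram_def)
  have gram_fact_mono: "gram (fact k) UNIV e" if "gram (fact m) UNIV e" "k \<le> m" for k m e
  proof -
    have "(fact k :: nat) dvd fact m" using that(2) by (rule fact_dvd)
    then obtain q where q: "(fact m :: nat) = q * fact k" by (metis dvd_def mult.commute)
    then have "q > 0" by (metis fact_nonzero gr0I mult_zero_left)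
    then show ?thesis using gram_mono[of q "fact k"] that(1) q by simp
  qed
  have good_gram: "gram (fact k) UNIV e" if g: "good k e" for k e
  proof -
    obtain e' where "gram (fact k) UNIV e'" "\<And>i. (1 / of_nat (fact k)) *\<^sub>Q (e' i - e i) \<in> L"
      using g unfolding good_def by blast
    then show ?thesis using g by (auto simp: good_def intro: gram_cong[of "fact k" UNIV e'])
  qed
  \<comment> \<open>The modulus is \<open>fact 0 = 1\<close>, so any system in \<open>L\<close> is a
    valid start.\<close>
  have 0: "good 0 (\<lambda>_. 0)"
    unfolding good_def
  proof (intro conjI allI impI)
    fix m :: nat
    obtain e' where "gram (fact m) UNIV e'" using gram_exists[of "fact m"] by auto
    then show "\<exists>e'. gram (fact m) UNIV e' \<and>
      (\<forall>i. (1 / of_nat (fact 0)) *\<^sub>Q (e' i - 0) \<in> L)" using gramL by auto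
  qed simp
  have step: "\<exists>e'. good (Suc k) e' \<and> (\<forall>i. (1 / of_nat (fact k)) *\<^sub>Q (e' i -
    e i) \<in> L)" if g: "good k e" for k e
  proof -
    define F where "F = (fact (Suc k) :: nat)"
    obtain cl :: "'h ^ 'n \<Rightarrow> 'n \<Rightarrow> 'h \<Rightarrow> int" where cl: "finite (cl ` L)"
      "\<And>x y. x \<in> L \<Longrightarrow> y \<in> L \<Longrightarrow> cl x = cl y \<Longrightarrow>
        (1 / of_nat F) *\<^sub>Q (x - y) \<in> L"
      using L_mod_classes[of F] unfolding F_def by (metis fact_gt_zero)
    have "\<forall>m. \<exists>e'. gram (fact (Suc k + m)) UNIV e' \<and>
      (\<forall>i. (1 / of_nat (fact k)) *\<^sub>Q (e' i - e i) \<in> L)"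
      using g unfolding good_def by (metis le_add1 add_leD1 Suc_leD)
    then obtain E where E: "\<And>m. gram (fact (Suc k + m)) UNIV (E m)"
      "\<And>m i. (1 / of_nat (fact k)) *\<^sub>Q (E m i - e i) \<in> L"
      by metis
    define C where "C m = (\<lambda>i. cl (E m i))" for m
    have "range C \<subseteq> PiE UNIV (\<lambda>_. cl ` L)" using gramL[OF E(1)] by (auto simp: C_def)
    then have "finite (range C)" using cl(1) by (meson finite_PiE finite finite_subset)
    \<comment> \<open>Infinitely many levels share one class modulo \<open>fact (Suc k)\<close>, so
      the system \<open>E m0\<close> extends to arbitrarily high, hence by
      \<open>gram_fact_mono\<close> to all levels.\<close>
    then obtain m0 where m0: "infinite {m. C m = C m0}" using pigeonhole_infinite[of UNIV C] by auto
    have "good (Suc k) (E m0)"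
      unfolding good_def
    proof (intro conjI allI impI)
      show "E m0 i \<in> L" for i using gramL[OF E(1)] .
      fix m assume "Suc k \<le> m"
      obtain m1 where m1: "m1 \<ge> m" "C m1 = C m0" using m0 unfolding infinite_nat_iff_unbounded_le by blast
      have "(1 / of_nat (fact (Suc k))) *\<^sub>Q (E m1 i - E m0 i) \<in> L" for i
        using cl(2)[OF gramL[OF E(1)[of m1]] gramL[OF E(1)[of m0]]] fun_cong[OF m1(2), of i]
          unfolding F_def C_def by blast
      moreover have "gram (fact m) UNIV (E m1)" using gram_fact_mono[OF E(1)[of m1]] m1 by simp
      ultimately show "\<exists>e'. gram (fact m) UNIV e' \<and>
        (\<forall>i. (1 / of_nat (fact (Suc k))) *\<^sub>Q (e' i - E m0 i) \<in> L)" by blast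
    qed
    then show ?thesis using E(2) by blast
  qed
  obtain E where "\<And>k. good k (E k)"
    "\<And>k. \<forall>i. (1 / of_nat (fact k)) *\<^sub>Q (E (Suc k) i - E k i) \<in> L"
    using dependent_nat_choice[of good "\<lambda>k e e'. \<forall>i. (1 / of_nat (fact k)) *\<^sub>Q
      (e' i - e i) \<in> L"] 0 step by metis
  then show ?thesis using good_gram by blast
qed

end

section \<open>The finite adeles\<close>

lemma Rep_zhat_mod: "Suc n dvd Suc m \<Longrightarrow> Rep_zhat x m mod int (Suc n) = Rep_zhat x n"
  using Rep_zhat[of x] by blast

lemma Rep_zhat_of_int: "Rep_zhat (of_int k) n = k mod int (Suc n)"
proof (cases k rule: int_cases2)
  case (nonneg m)
  then show ?thesis by (simp add: Rep_zhat_of_nat)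
next
  case (nonpos m)
  then have "Rep_zhat (of_int k) n = (- (int m mod int (Suc n))) mod int (Suc n)"
    by (simp only: of_int_minus of_int_of_nat_eq uminus_zhat.rep_eq Rep_zhat_of_nat)
  then show ?thesis using nonpos by (simp only: mod_minus_eq)
qed

lemma zhat_eqI: "(\<And>n. Rep_zhat x n = Rep_zhat y n) \<Longrightarrow> x = y"
  by (metis Rep_zhat_inject ext)

lemma Rep_zhat_of_nat_mult: "Rep_zhat (of_nat N * x) n = (int N * Rep_zhat x n) mod int (Suc n)"
  by (simp only: times_zhat.rep_eq Rep_zhat_of_nat mod_mult_left_eq)

lemma Rep_zhat_mod_pos:
  assumes "M dvd K" "K > 0"
  shows "Rep_zhat x (K - 1) mod int M = Rep_zhat x (M - 1)"
proof -
  have "M > 0" using assms by (metis dvd_0_left_iff gr0I)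
  then show ?thesis using Rep_zhat_mod[of "M - 1" "K - 1" x] assms by simp
qed

lemma zhat_divide:
  assumes N: "N > 0" and x: "Rep_zhat x (N - 1) = 0"
  shows "\<exists>y. x = of_nat N * y"
proof -
  \<comment> \<open>The component of \<open>x\<close> modulo \<open>N * (n + 1)\<close>, the index
    being one less than the modulus. Divided by \<open>N\<close> it gives the component of the
    quotient modulo \<open>n + 1\<close>.\<close>
  define b where "b n = Rep_zhat x (N * Suc n - 1)" for n
  have pos: "N * Suc n > 0" for n using N by simp
  have b_mod: "b m mod int (N * Suc n) = b n" if "Suc n dvd Suc m" for m n
    unfolding b_def by (rule Rep_zhat_mod_pos[OF mult_dvd_mono[OF dvd_refl that] pos])
  have b_N: "int N dvd b n" for n
    using Rep_zhat_mod_pos[OF dvd_triv_left pos, of x n] x unfolding b_def by (simp only: mod_0_imp_dvd)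
  have b_div: "b n = int N * (b n div int N)" for n using b_N by simp
  have b_x: "b n mod int (Suc n) = Rep_zhat x n" for n
    using Rep_zhat_mod_pos[OF dvd_triv_right pos, of x n] unfolding b_def by (simp only: diff_Suc_1)
  have "(b m div int N) mod int (Suc n) = b n div int N" if "Suc n dvd Suc m" for m n
  proof -
    have "int N * ((b m div int N) mod int (Suc n)) = b m mod int (N * Suc n)"
      using b_div[of m] by (metis mult_mod_right of_nat_mult)
    then have "int N * ((b m div int N) mod int (Suc n)) = int N * (b n div int N)"
      using b_mod[OF that] b_div[of n] by simp
    then show ?thesis using N by simp
  qed
  then have "Rep_zhat (Abs_zhat (\<lambda>n. b n div int N)) = (\<lambda>n. b n div int N)"
    by (intro Abs_zhat_inverse) auto
  then have "x = of_nat N * Abs_zhat (\<lambda>n. b n div int N)"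
    by (intro zhat_eqI) (simp only: Rep_zhat_of_nat_mult b_div[symmetric] b_x)
  then show ?thesis by blast
qed

lemma zhat_torsion_free:
  assumes N: "N > 0" and x: "of_nat N * x = (0::zhat)"
  shows "x = 0"
proof (rule zhat_eqI)
  fix n
  define r where "r = Rep_zhat x (N * Suc n - 1)"
  have pos: "N * Suc n > 0" using N by simp
  have "(int N * r) mod int (N * Suc n) = 0"
    using arg_cong[OF x, of "\<lambda>x. Rep_zhat x (N * Suc n - 1)"]
    unfolding Rep_zhat_of_nat_mult Suc_diff_1[OF pos] zero_zhat.rep_eq r_def[symmetric] .
  then have "int N * int (Suc n) dvd int N * r" unfolding of_nat_mult by (rule mod_0_imp_dvd)
  then have "int (Suc n) dvd r" using N by (simp only: dvd_mult_cancel_left) simp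
  moreover have "r mod int (Suc n) = Rep_zhat x n"
    using Rep_zhat_mod_pos[OF dvd_triv_right pos, of x] unfolding r_def by (simp only: diff_Suc_1)
  ultimately show "Rep_zhat x n = Rep_zhat 0 n" by (simp add: zero_zhat.rep_eq)
qed

lemma zhat_approx:
  assumes "N > 0"
  shows "\<exists>k y. x = of_int k + of_nat N * (y::zhat)"
proof -
  define k where "k = Rep_zhat x (N - 1)"
  have "Rep_zhat (x - of_int k) (N - 1) = 0"
    using Rep_zhat_mod[of "N - 1" "N - 1" x] by (simp add: minus_zhat.rep_eq Rep_zhat_of_int k_def)
  then obtain y where "x - of_int k = of_nat N * y" using zhat_divide[OF assms] by blast
  then show ?thesis by (metis add.commute diff_add_cancel)
qed

lemma zhat_divisible_imp_zero:
  assumes "\<And>N. N > 0 \<Longrightarrow> \<exists>y. x = of_nat N * (y::zhat)"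
  shows "x = 0"
proof (rule zhat_eqI)
  fix n
  obtain y where "x = of_nat (Suc n) * y" using assms[of "Suc n"] by blast
  then show "Rep_zhat x n = Rep_zhat 0 n" by (simp only: Rep_zhat_of_nat_mult zero_zhat.rep_eq) simp
qed

lemma of_int_zhat_divisible:
  assumes "N > 0" "of_int k = of_nat N * (y::zhat)"
  shows "int N dvd k"
  using arg_cong[OF assms(2), of "\<lambda>x. Rep_zhat x (N - 1)"] assms(1)
  by (simp add: Rep_zhat_of_int Rep_zhat_of_nat_mult mod_0_imp_dvd)

text \<open>A factorial series converges in \<open>zhat\<close>: modulo \<open>n + 1\<close> all
  terms from index \<open>n + 1\<close> on vanish.\<close>

lemma zhat_series:
  fixes a :: "nat \<Rightarrow> int"
  shows "\<exists>x. \<forall>m. \<exists>y. x = of_int (\<Sum>k<m. fact k * a k) +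
    of_nat (fact m) * (y::zhat)"
proof -
  define s where "s m = (\<Sum>k<m. fact k * a k)" for m
  have tail: "d dvd s n - s m" if "m \<le> n" "\<And>k. k \<ge> m \<Longrightarrow> d dvd fact k" for m n d
  proof -
    have "s n - s m = (\<Sum>k\<in>{m..<n}. fact k * a k)"
      using that(1) by (simp add: s_def sum_diff_nat_ivl[of 0 m n, symmetric] atLeast0LessThan)
    then show ?thesis using that(2) by (auto intro!: dvd_sum dvd_mult2)
  qed
  have cong: "s m mod int (Suc n) = s (Suc n) mod int (Suc n)" if "Suc n \<le> m" for m n
  proof -
    have "int (Suc n) dvd fact k" if "k \<ge> Suc n" for k
      using dvd_fact[of "Suc n" k] that
        by (metis One_nat_def Suc_leI of_nat_dvd_iff of_nat_fact zero_less_Suc)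
    then show ?thesis unfolding mod_eq_dvd_iff using tail[OF that] by blast
  qed
  define x where "x = Abs_zhat (\<lambda>n. s (Suc n) mod int (Suc n))"
  have x: "Rep_zhat x n = s (Suc n) mod int (Suc n)" for n
  proof -
    have "s (Suc m) mod int (Suc m) mod int (Suc n) = s (Suc n) mod int (Suc n)" if "Suc n dvd Suc m" for m n
      using mod_int_Suc_mod_int_Suc[OF that] cong[of n "Suc m"] dvd_imp_le[OF that] by simp
    then have "Rep_zhat x = (\<lambda>n. s (Suc n) mod int (Suc n))"
      unfolding x_def by (intro Abs_zhat_inverse) blast
    then show ?thesis by simp
  qed
  have "\<exists>y. x = of_int (s m) + of_nat (fact m) * y" for m
  proof -
    \<comment> \<open>The component modulo \<open>F\<close> is the partial sum up to
      \<open>F\<close>. It may be compared with the one up to \<open>m\<close> because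
      \<open>m \<le> F\<close> and the terms in between are divisible by
      \<open>fact m\<close>.\<close>
    define F where "F = (fact m :: nat)"
    have F: "F > 0" "m \<le> F" using fact_ge_self[of m] by (auto simp: F_def)
    have "int F dvd s F - s m"
    proof (rule tail[OF F(2)])
      show "int F dvd fact k" if "m \<le> k" for k
        using fact_dvd[OF that, where 'a = nat] unfolding F_def by (metis of_nat_dvd_iff of_nat_fact)
    qed
    then have "s F mod int F = s m mod int F" by (simp add: mod_eq_dvd_iff)
    then have "Rep_zhat (x - of_int (s m)) (F - 1) = 0"
      using F x[of "F - 1"] by (simp add: minus_zhat.rep_eq Rep_zhat_of_int)
    then obtain y where "x - of_int (s m) = of_nat F * y" using zhat_divide[OF F(1)] by blast
    then show ?thesis unfolding F_def by (metis add.commute diff_add_cancel)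
  qed
  then show ?thesis unfolding s_def by blast
qed

section \<open>Rational scalars on tensor products\<close>

instantiation tensor :: (rat_vector, ab_group_add) rat_vector
begin

lift_definition scaleQ_tensor :: "rat \<Rightarrow> ('a, 'b) tensor \<Rightarrow> ('a, 'b) tensor"
  is "\<lambda>q. image_mset (map_prod (scaleQ q) id)"
  by (rule tensor_rel_image_mset) (simp_all add: scaleQ_add_right)

lemma scaleQ_tensor_simps:
  fixes x y :: "('a, 'b) tensor"
  shows "q *\<^sub>Q (x + y) = q *\<^sub>Q x + q *\<^sub>Q y"
    "q *\<^sub>Q (tensor a b :: ('a, 'b) tensor) = tensor (q *\<^sub>Q a) b"
    "q *\<^sub>Q (0 :: ('a, 'b) tensor) = 0"
  by (transfer, simp add: tensor_rel_refl)+

instance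
proof
  fix x y :: "('a, 'b) tensor" and p q :: rat
  show "p *\<^sub>Q (x + y) = p *\<^sub>Q x + p *\<^sub>Q y" by (rule scaleQ_tensor_simps)
  show "(p + q) *\<^sub>Q x = p *\<^sub>Q x + q *\<^sub>Q x"
    by (induction x rule: tensor_induct) (simp_all add: scaleQ_tensor_simps scaleQ_add_left tensor_add_left)
  show "p *\<^sub>Q q *\<^sub>Q x = (p * q) *\<^sub>Q x"
    by (induction x rule: tensor_induct) (simp_all add: scaleQ_tensor_simps)
  show "1 *\<^sub>Q x = x"
    by (induction x rule: tensor_induct) (simp_all add: scaleQ_tensor_simps)
qed

end

instance tensor :: (rat_algebra_1, ring_char_0) rat_algebra_1
proof
  fix x y :: "('a, 'b) tensor" and q :: rat
  have 1: "q *\<^sub>Q tensor a b * y = q *\<^sub>Q (tensor a b * y)" for a b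
    by (induction y rule: tensor_induct) (simp_all add: scaleQ_tensor_simps tensor_mult_distrib tensor_mult_tensor)
  show "q *\<^sub>Q x * y = q *\<^sub>Q (x * y)"
    by (induction x rule: tensor_induct) (simp_all add: 1 scaleQ_tensor_simps tensor_mult_distrib del: scaleQ_tensor_simps(2))
  have 2: "tensor a b * q *\<^sub>Q y = q *\<^sub>Q (tensor a b * y)" for a b
    by (induction y rule: tensor_induct) (simp_all add: scaleQ_tensor_simps tensor_mult_distrib tensor_mult_tensor)
  show "x * q *\<^sub>Q y = q *\<^sub>Q (x * y)"
    by (induction x rule: tensor_induct) (simp_all add: 2 scaleQ_tensor_simps tensor_mult_distrib)
qed

lemma tensor_zero_left [simp]: "tensor 0 b = 0" and tensor_zero_right [simp]: "tensor a 0 = 0"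
  using tensor_add_left[of 0 0 b] tensor_add_right[of a 0 0] by simp_all

lemma tensor_uminus_left: "tensor (- a) b = - tensor a b"
  using tensor_add_left[of a "- a" b] by (simp add: eq_neg_iff_add_eq_0 add.commute)

lemma tensor_uminus_right: "tensor a (- b) = - tensor a b"
  using tensor_add_right[of a b "- b"] by (simp add: eq_neg_iff_add_eq_0 add.commute)

lemma tensor_diff_left: "tensor (a - a') b = tensor a b - tensor a' b"
  using tensor_add_left[of a "- a'" b] by (simp add: tensor_uminus_left)

lemma tensor_diff_right: "tensor a (b - b') = tensor a b - tensor a b'"
  using tensor_add_right[of a b "- b'"] by (simp add: tensor_uminus_right)

lemma tensor_sum_left: "tensor (sum f A) b = (\<Sum>i\<in>A. tensor (f i) b)"
  by (induction A rule: infinite_finite_induct) (simp_all add: tensor_add_left)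

lemma tensor_of_nat_right: "tensor a (of_nat n * b) =
  of_nat n *\<^sub>Q tensor (a::'a::rat_vector) (b::'b::ring_1)"
  by (induction n) (simp_all add: distrib_right tensor_add_right scaleQ_add_left)

lemma tensor_of_int_right: "tensor a (of_int k * b) =
  of_int k *\<^sub>Q tensor (a::'a::rat_vector) (b::'b::ring_1)"
  using tensor_of_nat_right[of a "nat k" b] tensor_of_nat_right[of a "nat (- k)" b]
  by (cases "k \<ge> 0") (simp_all add: tensor_uminus_right)

definition emb :: "'h::quaternion_algebra \<Rightarrow> 'h adeles"
  where "emb a = tensor a 1"

lemma emb_simps:
  "emb (a + b) = emb a + emb b" "emb (a - b) = emb a - emb b" "emb (a * b) = emb a * emb b" "emb 0 = 0"
    "emb 1 = 1"
  "emb (q *\<^sub>Q a) = q *\<^sub>Q emb a" "emb (invol a) = invol (emb a)"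
    "emb (sum f A) = (\<Sum>i\<in>A. emb (f i))" "emb (- a) = - emb a"
  "emb (of_int k) = of_int k"
  unfolding of_int_scaleQ_one[symmetric]
  by (simp_all add: emb_def tensor_add_left tensor_diff_left tensor_mult_tensor one_tensor_def scaleQ_tensor_simps
      invol_tensor_simps tensor_sum_left tensor_uminus_left)

text \<open>The trace on the first factor detects \<open>z\<close>. \<open>tensor_rel_eval\<close>
  realises it only up to a positive factor \<open>m\<close>, so the conclusion is
  \<open>2 * m * z = 0\<close>, and \<open>zhat\<close> is torsion-free.\<close>

lemma tensor_one_eq_zero:
  assumes "tensor (1::'h::quaternion_algebra) (z::zhat) = 0"
  shows "z = 0"
proof -
  have "tensor_rel {#(1::'h, z)#} {#}" using assms by transfer
  from tensor_rel_eval[OF this trd_add] obtain m :: nat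
    where "m > 0" "of_int \<lfloor>of_nat m * trd (1::'h)\<rfloor> * z = 0" by auto
  moreover have "\<lfloor>of_nat m * trd (1::'h)\<rfloor> = int (2 * m)"
    by (simp add: mult.commute[of _ 2]) (metis floor_of_nat of_nat_mult of_nat_numeral)
  ultimately have "of_nat (2 * m) * z = 0" by (simp only: of_int_of_nat_eq)
  then show ?thesis using zhat_torsion_free \<open>m > 0\<close> by (metis mult_pos_pos pos2)
qed

lemma tensor_one_inj: "tensor (1::'h::quaternion_algebra) (y::zhat) = tensor 1 z \<Longrightarrow> y = z"
  using tensor_one_eq_zero[of "y - z"] by (simp add: tensor_diff_right)

text \<open>Inside the adeles, the rationals meet \<open>zhat\<close> in the integers.\<close>

lemma emb_scaleQ_one_eq_tensor:
  assumes "q *\<^sub>Q (1 :: 'h::quaternion_algebra adeles) = tensor 1 z"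
  shows "q \<in> \<int>"
proof -
  obtain m n where q: "q = of_int m / of_int n" "n > 0"
    by (metis quotient_of_div quotient_of_denom_pos surj_pair)
  define N where "N = nat n"
  have N: "N > 0" "q = of_int m / of_nat N" using q by (auto simp: N_def)
  have "tensor (1::'h) (of_int m :: zhat) = of_int m *\<^sub>Q 1"
    using tensor_of_int_right[of "1::'h" m "1::zhat"] by (simp add: one_tensor_def)
  also have "\<dots> = of_nat N *\<^sub>Q (q *\<^sub>Q 1)" using N by simp
  also have "\<dots> = tensor 1 (of_nat N * z)" by (simp only: assms tensor_of_nat_right)
  finally have "int N dvd m" using of_int_zhat_divisible[OF N(1)] tensor_one_inj by blast
  then show ?thesis using N of_int_div_Ints_iff by blast
qed

section \<open>Integral adeles: density, separatedness, completeness\<close>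

context quaternion_order
begin

abbreviation "OH \<equiv> order_hat R"

lemma OH_zero [simp]: "0 \<in> OH"
proof -
  show ?thesis unfolding order_hat_def mem_Collect_eq by (intro exI[of _ "0::nat"]) simp
qed

lemma OH_add_tensor: "x \<in> OH \<Longrightarrow> b \<in> R \<Longrightarrow> x + tensor b z \<in> OH"
proof -
  assume x: "x \<in> OH" and b: "b \<in> R"
  then obtain n :: nat and a y
    where a: "\<forall>k<n. a k \<in> R" "x = (\<Sum>k<n. tensor (a k) (y k))" unfolding order_hat_def
      by blast
  have "x + tensor b z = (\<Sum>k<Suc n. tensor ((a(n := b)) k) ((y(n := z)) k))" by (simp add: a(2))
  moreover have "\<forall>k<Suc n. (a(n := b)) k \<in> R" using a b by (auto simp: less_Suc_eq)
  ultimately show ?thesis unfolding order_hat_def mem_Collect_eq by (intro exI conjI)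
qed

lemma OH_induct [consumes 1, case_names zero add]:
  assumes "x \<in> OH" "P 0"
    "\<And>a z x. a \<in> R \<Longrightarrow> x \<in> OH \<Longrightarrow> P x \<Longrightarrow> P (x +
      tensor a z)"
  shows "P x"
proof -
  obtain n :: nat and a y where a: "\<forall>k<n. a k \<in> R" "x = (\<Sum>k<n. tensor (a k) (y k))"
    using assms(1) unfolding order_hat_def by blast
  have "m \<le> n \<Longrightarrow> (\<Sum>k<m. tensor (a k) (y k)) \<in> OH \<and>
    P (\<Sum>k<m. tensor (a k) (y k))" for m
    by (induction m) (use assms(2,3) a(1) OH_add_tensor in \<open>auto simp: Suc_le_eq\<close>)
  then show ?thesis using a(2) by blast
qed

lemma OH_add: assumes "x \<in> OH" "y \<in> OH" shows "x + y \<in> OH"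
  using assms(2,1) by (induction y rule: OH_induct) (auto simp: add.assoc[symmetric] intro: OH_add_tensor)

lemma OH_tensor: "a \<in> R \<Longrightarrow> tensor a z \<in> OH"
  using OH_add_tensor[of 0 a z] by simp

lemma OH_uminus: "x \<in> OH \<Longrightarrow> - x \<in> OH"
proof (induction x rule: OH_induct)
  case (add a z x)
  then show ?case using OH_add_tensor[OF add(3) R_uminus[OF add(1)], of z] by (simp add: tensor_uminus_left)
qed simp

lemma OH_diff: "x \<in> OH \<Longrightarrow> y \<in> OH \<Longrightarrow> x - y \<in> OH"
  using OH_add[of x "- y"] OH_uminus by simp

lemma OH_mult: "x \<in> OH \<Longrightarrow> y \<in> OH \<Longrightarrow> x * y \<in> OH"
proof (induction x rule: OH_induct)
  case (add a z x)
  have "tensor a z * y \<in> OH" using add.prems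
    by (induction y rule: OH_induct) (auto simp:
      distrib_left tensor_mult_tensor intro!: OH_add OH_tensor R_mult add)
  then show ?case using add by (simp add: distrib_right OH_add)
qed simp

lemma OH_invol: "x \<in> OH \<Longrightarrow> invol x \<in> OH"
  by (induction x rule: OH_induct) (auto simp: invol_add invol_tensor_simps intro!: OH_add OH_tensor R_invol)

lemma OH_sum: "(\<And>i. i \<in> A \<Longrightarrow> f i \<in> OH) \<Longrightarrow> sum f A \<in> OH"
  by (induction A rule: infinite_finite_induct) (auto intro: OH_add)

lemma OH_emb: "a \<in> R \<Longrightarrow> emb a \<in> OH"
  unfolding emb_def by (rule OH_tensor)

lemma OH_one [simp]: "1 \<in> OH"
  using OH_emb[of 1] by (simp add: emb_simps)

lemma OH_scale_Ints: assumes "q \<in> \<int>" "x \<in> OH" shows "q *\<^sub>Q x \<in> OH"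
  using assms(2,1) by (induction x rule: OH_induct) (auto simp:
    scaleQ_add_right scaleQ_tensor_simps intro!: OH_add OH_tensor R_scale_Ints)

lemma OH_denominator: "\<exists>d::nat. d > 0 \<and> of_nat d *\<^sub>Q x \<in> OH"
proof (induction x rule: tensor_induct)
  case (add a b x)
  then obtain d :: nat where d: "d > 0" "of_nat d *\<^sub>Q x \<in> OH" by blast
  obtain e :: nat where e: "e > 0" "of_nat e *\<^sub>Q a \<in> R" using R_denominator by blast
  have "of_nat (d * e) *\<^sub>Q (tensor a b + x) = of_nat d *\<^sub>Q tensor (of_nat e *\<^sub>Q a) b +
    of_nat e *\<^sub>Q (of_nat d *\<^sub>Q x)"
    by (simp add: scaleQ_add_right scaleQ_tensor_simps mult.commute)
  also have "\<dots> \<in> OH"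
    by (rule OH_add[OF OH_scale_Ints[OF Ints_of_nat OH_tensor[OF e(2)]] OH_scale_Ints[OF Ints_of_nat d(2)]])
  finally show ?case using d e by (intro exI[of _ "d * e"]) auto
qed (auto intro!: exI[of _ 1])

lemma OH_common_denominator: "finite A \<Longrightarrow> \<exists>d::nat. d > 0 \<and>
  (\<forall>x\<in>A. of_nat d *\<^sub>Q x \<in> OH)"
  by (rule common_denominator[OF OH_denominator OH_scale_Ints[OF Ints_of_nat]])

lemma OH_approx:
  assumes "x \<in> OH" "N > 0"
  shows "\<exists>a\<in>R. (1 / of_nat N) *\<^sub>Q (x - emb a) \<in> OH"
  using assms(1)
proof (induction x rule: OH_induct)
  case (add b z x)
  then obtain a where a: "a \<in> R" "(1 / of_nat N) *\<^sub>Q (x - emb a) \<in> OH" by blast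
  obtain k y where z: "z = of_int k + of_nat N * y" using zhat_approx[OF assms(2)] by blast
  have "tensor b z = emb (of_int k *\<^sub>Q b) + of_nat N *\<^sub>Q tensor b y"
    using tensor_of_int_right[of b k 1]
      by (simp add: z tensor_add_right tensor_of_nat_right emb_def scaleQ_tensor_simps)
  then have "(1 / of_nat N) *\<^sub>Q (x + tensor b z - emb (a + of_int k *\<^sub>Q b)) =
    (1 / of_nat N) *\<^sub>Q (x - emb a) + tensor b y"
    using assms(2) by (simp add: emb_simps(1) scaleQ_add_right scaleQ_diff_right)
  also have "\<dots> \<in> OH" using a add by (intro OH_add OH_tensor)
  finally show ?case using R_add[OF a(1) R_scale_Ints[OF Ints_of_int add(1)]] by blast
qed (auto intro!: bexI[of _ 0] simp: emb_simps)

lemma adele_approx: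
  assumes "N > 0"
  shows "\<exists>a. (1 / of_nat N) *\<^sub>Q (x - emb a) \<in> OH"
proof -
  obtain d :: nat where d: "d > 0" "of_nat d *\<^sub>Q x \<in> OH" using OH_denominator by blast
  then obtain a where "(1 / of_nat (d * N)) *\<^sub>Q (of_nat d *\<^sub>Q x - emb a) \<in> OH"
    using OH_approx[OF d(2), of "d * N"] assms by auto
  then have "(1 / of_nat N) *\<^sub>Q (x - emb ((1 / of_nat d) *\<^sub>Q a)) \<in> OH"
    using d(1) by (simp add: emb_simps scaleQ_diff_right mult.commute)
  then show ?thesis by blast
qed

lemma OH_trace: "x \<in> OH \<Longrightarrow> \<exists>z. x + invol x = tensor 1 z"
proof (induction x rule: OH_induct)
  case (add a z x)
  then obtain y where y: "x + invol x = tensor 1 y" by blast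
  obtain k where k: "trd a = of_int k" using trd_Ints[OF add(1)] by (elim Ints_cases)
  have "x + tensor a z + invol (x + tensor a z) = (x + invol x) + tensor (a + invol a) z"
    by (simp add: invol_add invol_tensor_simps tensor_add_left algebra_simps)
  also have "\<dots> = tensor 1 (y + of_int k * z)"
    by (simp add: y add_invol k tensor_add_right tensor_of_int_right scaleQ_tensor_simps)
  finally show ?case by blast
qed (auto intro!: exI[of _ 0])

text \<open>The rational identity is linear, so it extends to tensors with the trace written as
  \<open>x + invol x\<close>. Both versions are stated for the same \<open>e\<close>,
  \<open>k\<close>, \<open>D\<close>, so that rational and adelic arguments can share them.\<close>

lemma adele_trace_dual:
  "\<exists>(e :: nat \<Rightarrow> 'h) k (D::nat). D > 0 \<and> (\<forall>m<4. e m \<in> R) \<and>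
     (\<forall>x. of_nat D *\<^sub>Q x = (\<Sum>m<4. (of_int (k m) * trd (x * e m)) *\<^sub>Q e m)) \<and>
     (\<forall>x. of_nat D *\<^sub>Q x = (\<Sum>m<4. of_int (k m) *\<^sub>Q ((x * emb (e m) +
       invol (x * emb (e m))) * emb (e m))))"
proof -
  obtain e :: "nat \<Rightarrow> 'h" and k D where D: "D > 0" "\<forall>m<4. e m \<in> R"
    "\<And>x. of_nat D *\<^sub>Q x = (\<Sum>m<4. (of_int (k m) * trd (x * e m)) *\<^sub>Q e m)"
      using R_trace_dual by blast
  have "of_nat D *\<^sub>Q x = (\<Sum>m<4. of_int (k m) *\<^sub>Q ((x * emb (e m) +
    invol (x * emb (e m))) * emb (e m)))" for x
  proof (induction x rule: tensor_induct)
    case (add a b x)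
    have "tensor (a * c) b + tensor (invol (a * c)) b = trd (a * c) *\<^sub>Q tensor 1 b" for c
      by (simp add: scaleQ_tensor_simps flip: tensor_add_left add_invol)
    then have "(tensor a b * emb c + invol (tensor a b * emb c)) * emb c =
      trd (a * c) *\<^sub>Q tensor c b" for c
      by (simp add: emb_def tensor_mult_tensor invol_tensor_simps)
    then have "(\<Sum>m<4. of_int (k m) *\<^sub>Q ((tensor a b * emb (e m) +
      invol (tensor a b * emb (e m))) * emb (e m))) =
        tensor (\<Sum>m<4. (of_int (k m) * trd (a * e m)) *\<^sub>Q e m) b"
      by (simp only: tensor_sum_left scaleQ_scaleQ scaleQ_tensor_simps)
    also have "\<dots> = of_nat D *\<^sub>Q tensor a b" by (simp only: scaleQ_tensor_simps D(3))
    finally have "of_nat D *\<^sub>Q tensor a b =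
      (\<Sum>m<4. of_int (k m) *\<^sub>Q ((tensor a b * emb (e m) +
        invol (tensor a b * emb (e m))) * emb (e m)))"
      by (rule sym)
    then show ?case by (simp add: scaleQ_add_right distrib_right invol_add add sum.distrib algebra_simps)
  qed simp
  then show ?thesis using D by blast
qed

text \<open>The traces of \<open>x\<close> against the dual system lie in \<open>zhat\<close> and
  are divisible by every \<open>N\<close>, hence vanish, and they determine
  \<open>x\<close>.\<close>

lemma adele_zero_if_divisible:
  assumes "\<And>N::nat. N > 0 \<Longrightarrow> (1 / of_nat N) *\<^sub>Q x \<in> OH"
  shows "x = 0"
proof -
  obtain e :: "nat \<Rightarrow> 'h" and k and D :: nat where D: "D > 0" "\<forall>m<4. e m \<in> R"
    "of_nat D *\<^sub>Q x = (\<Sum>m<4. of_int (k m) *\<^sub>Q ((x * emb (e m) +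
      invol (x * emb (e m))) * emb (e m)))"
    using adele_trace_dual by blast
  have "x * emb (e m) + invol (x * emb (e m)) = 0" if m: "m < 4" for m
  proof -
    define w where "w = x * emb (e m) + invol (x * emb (e m))"
    have w: "\<exists>z. (1 / of_nat N) *\<^sub>Q w = tensor 1 z" if "N > 0" for N :: nat
    proof -
      have "(1 / of_nat N) *\<^sub>Q x * emb (e m) \<in> OH" using assms[OF that] D(2) m
        by (intro OH_mult OH_emb) auto
      from OH_trace[OF this] show ?thesis by (simp add: w_def scaleQ_add_right)
    qed
    obtain z where z: "w = tensor 1 z" using w[of 1] by auto
    have "z = 0"
    proof (rule zhat_divisible_imp_zero)
      fix N :: nat assume N: "N > 0"
      obtain y where "(1 / of_nat N) *\<^sub>Q w = tensor 1 y" using w[OF N] by blast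
      then have "of_nat N *\<^sub>Q ((1 / of_nat N) *\<^sub>Q w) = tensor 1 (of_nat N * y)"
        by (simp only: tensor_of_nat_right)
      then have "w = tensor 1 (of_nat N * y)" using N by simp
      then show "\<exists>y. z = of_nat N * y" using z tensor_one_inj by metis
    qed
    then show ?thesis using z by (simp add: w_def)
  qed
  then have "of_nat D *\<^sub>Q x = 0" using D(3) by simp
  then show ?thesis using D(1) by simp
qed

text \<open>By density \<open>a\<close> differs from an element of \<open>R\<close> by some
  \<open>b\<close> that is divisible by \<open>D\<close> in \<open>OH\<close>. The traces of such
  \<open>b\<close> are divisible by \<open>D\<close>, which compensates the factor \<open>D\<close>
  in recovering \<open>b\<close> from them.\<close>

lemma emb_in_OH_iff: "emb a \<in> OH \<longleftrightarrow> a \<in> R"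
proof
  assume a: "emb a \<in> OH"
  obtain e :: "nat \<Rightarrow> 'h" and k and D :: nat where D: "D > 0" "\<forall>m<4. e m \<in> R"
    "\<And>x. of_nat D *\<^sub>Q x = (\<Sum>m<4. (of_int (k m) * trd (x * e m)) *\<^sub>Q e m)"
    using adele_trace_dual by blast
  have *: "b \<in> R" if b: "(1 / of_nat D) *\<^sub>Q emb b \<in> OH" for b
  proof -
    have "trd (b * e m) / of_nat D \<in> \<int>" if m: "m < 4" for m
    proof -
      have "((1 / of_nat D) *\<^sub>Q emb b) * emb (e m) \<in> OH" using b D(2) m
        by (intro OH_mult OH_emb) auto
      from OH_trace[OF this] obtain z
        where "((1 / of_nat D) *\<^sub>Q emb b) * emb (e m) +
          invol (((1 / of_nat D) *\<^sub>Q emb b) * emb (e m)) = tensor 1 z" by blast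
      moreover have "((1 / of_nat D) *\<^sub>Q emb b) * emb (e m) +
        invol (((1 / of_nat D) *\<^sub>Q emb b) * emb (e m)) =
          emb ((1 / of_nat D) *\<^sub>Q (b * e m) +
            invol ((1 / of_nat D) *\<^sub>Q (b * e m)))" by (simp add: emb_simps invol_mult)
      moreover have "\<dots> = (trd (b * e m) / of_nat D) *\<^sub>Q 1" unfolding add_invol
        by (simp add: trd_scaleQ emb_simps)
      ultimately show ?thesis using emb_scaleQ_one_eq_tensor by metis
    qed
    then have "(\<Sum>m<4. of_int (k m) *\<^sub>Q ((trd (b * e m) / of_nat D) *\<^sub>Q e m)) \<in> R"
      using D(2) by (intro R_sum) (metis R_scale_Ints Ints_of_int lessThan_iff)
    also have "(\<Sum>m<4. of_int (k m) *\<^sub>Q ((trd (b * e m) / of_nat D) *\<^sub>Q e m)) =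
      (1 / of_nat D) *\<^sub>Q of_nat D *\<^sub>Q b"
      unfolding D(3) by (simp add: scaleQ_sum_right)
    finally show ?thesis using D(1) by simp
  qed
  obtain b where b: "b \<in> R" "(1 / of_nat D) *\<^sub>Q (emb a - emb b) \<in> OH"
    using OH_approx[OF a D(1)] by blast
  then have "a - b \<in> R" using *[of "a - b"] by (simp add: emb_simps)
  then show "a \<in> R" using R_add[OF _ b(1), of "a - b"] by simp
qed (rule OH_emb)

text \<open>Completeness, reduced to \<open>zhat_series\<close>: along each generator of
  \<open>R\<close> the increments form a factorial series.\<close>

lemma OH_limit:
  assumes "\<And>k. a k \<in> R" "\<And>k. (1 / of_nat (fact k)) *\<^sub>Q (a (Suc k) - a k) \<in> R"
  shows "\<exists>x\<in>OH. \<forall>k. (1 / of_nat (fact k)) *\<^sub>Q (x - emb (a k)) \<in> OH"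
proof -
  obtain S where S: "finite S" "S \<subseteq> R" "R = int_mod.span S" using R_generators by blast
  have "\<exists>n. (1 / of_nat (fact k)) *\<^sub>Q (a (Suc k) - a k) =
    (\<Sum>s\<in>S. of_int (n s) * s)" for k
    using assms(2)[of k] S by (auto simp: int_mod.span_finite)
  then obtain n where n: "\<And>k. (1 / of_nat (fact k)) *\<^sub>Q (a (Suc k) - a k) =
    (\<Sum>s\<in>S. of_int (n k s) * s)" by metis
  have diff: "a (Suc k) - a k = (\<Sum>s\<in>S. of_int (fact k * n k s) *\<^sub>Q s)" for k
  proof -
    have "a (Suc k) - a k = of_nat (fact k) *\<^sub>Q ((1 / of_nat (fact k)) *\<^sub>Q (a (Suc k) -
      a k))" by simp
    also have "\<dots> = (\<Sum>s\<in>S. of_int (fact k * n k s) *\<^sub>Q s)" unfolding n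
      by (simp add: scaleQ_sum_right of_int_mult_scaleQ)
    finally show ?thesis .
  qed
  have a: "a m = a 0 + (\<Sum>s\<in>S. of_int (\<Sum>k<m. fact k * n k s) *\<^sub>Q s)" for m
  proof (induction m)
    case (Suc m)
    have "a (Suc m) = a m + (\<Sum>s\<in>S. of_int (fact m * n m s) *\<^sub>Q s)" using diff[of m]
      by (simp add: algebra_simps)
    then show ?case using Suc by (simp add: scaleQ_add_left sum.distrib add.assoc)
  qed simp
  obtain \<zeta> :: "'h \<Rightarrow> zhat"
    where \<zeta>: "\<And>s m. \<exists>y. \<zeta> s = of_int (\<Sum>k<m. fact k * n k s) +
      of_nat (fact m) * y"
    using zhat_series[of "\<lambda>k. n k _"] by metis
  define x where "x = emb (a 0) + (\<Sum>s\<in>S. tensor s (\<zeta> s))"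
  have "x \<in> OH" unfolding x_def using S(2) assms(1) by (intro OH_add OH_sum OH_emb OH_tensor) auto
  moreover have "(1 / of_nat (fact m)) *\<^sub>Q (x - emb (a m)) \<in> OH" for m
  proof -
    obtain y where y: "\<And>s. \<zeta> s = of_int (\<Sum>k<m. fact k * n k s) + of_nat (fact m) * y s"
      using \<zeta>[of _ m] by metis
    have "tensor s (\<zeta> s) = emb (of_int (\<Sum>k<m. fact k * n k s) *\<^sub>Q s) +
      of_nat (fact m) *\<^sub>Q tensor s (y s)" for s
      using tensor_of_int_right[of s "\<Sum>k<m. fact k * n k s" "1::zhat"]
      by (simp only: y tensor_add_right tensor_of_nat_right emb_def scaleQ_tensor_simps mult_1_right)
    then have "x - emb (a m) = of_nat (fact m) *\<^sub>Q (\<Sum>s\<in>S. tensor s (y s))"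
      unfolding x_def a[of m] by (simp only: emb_simps sum.distrib scaleQ_sum_right) simp
    then have "(1 / of_nat (fact m)) *\<^sub>Q (x - emb (a m)) = (\<Sum>s\<in>S. tensor s (y s))" by simp
    also have "\<dots> \<in> OH" using S(2) by (intro OH_sum OH_tensor) auto
    finally show ?thesis .
  qed
  ultimately show ?thesis by blast
qed

text \<open>An approximation \<open>a\<close> of \<open>x\<close> is symmetrised to half of
  \<open>a + invol a\<close>; approximating modulo \<open>2 * N\<close> makes up for the division by
  2. The result is a fixed element of \<open>R\<close>, hence an integer.\<close>

lemma OH_fixed_approx:
  assumes "x \<in> OH" "invol x = x" "N > 0"
  shows "\<exists>k. (1 / of_nat N) *\<^sub>Q (x - of_int k) \<in> OH"
proof -
  obtain a where a: "a \<in> R" "(1 / of_nat (2 * N)) *\<^sub>Q (x - emb a) \<in> OH" (is "?w \<in> OH")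
    using OH_approx[OF assms(1), of "2 * N"] assms(3) by auto
  define b where "b = (1 / of_nat (2 * N)) *\<^sub>Q (a - invol a)"
  have "invol ?w - ?w = emb b"
    using assms(2) by (simp add: b_def invol_diff emb_simps scaleQ_diff_right)
  then have "emb b \<in> OH" using OH_diff[OF OH_invol[OF a(2)] a(2)] by simp
  then have b: "b \<in> R" by (simp add: emb_in_OH_iff)
  define a0 where "a0 = a - of_nat N *\<^sub>Q b"
  have "a0 \<in> R" unfolding a0_def by (rule R_diff[OF a(1) R_scale_Ints[OF Ints_of_nat b]])
  moreover have "a0 = (1/2) *\<^sub>Q (a + invol a)"
  proof -
    have "a0 = a - (1/2) *\<^sub>Q (a - invol a)" using assms(3) by (simp add: a0_def b_def)
    also have "\<dots> = (1 - 1/2) *\<^sub>Q a + (1/2) *\<^sub>Q invol a"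
      by (simp only: scaleQ_diff_right scaleQ_diff_left scaleQ_one) simp
    finally show ?thesis by (simp add: scaleQ_add_right)
  qed
  then have "invol a0 = a0" by (simp add: invol_add add.commute)
  ultimately obtain k where k: "a0 = of_int k" using R_fixed by blast
  have "of_int k = emb a - of_nat N *\<^sub>Q emb b" using arg_cong[OF k, of emb]
    by (simp add: a0_def emb_simps)
  then have "(1 / of_nat N) *\<^sub>Q (x - of_int k) = 2 *\<^sub>Q ?w + emb b"
    using assms(3) by (simp add: scaleQ_diff_right)
  also have "\<dots> \<in> OH" by (rule OH_add[OF OH_scale_Ints[OF _ a(2)] OH_emb[OF b]]) simp
  finally show ?thesis by blast
qed

text \<open>After clearing denominators, fixed elements are limits of integers, so their commutators
  are divisible by every \<open>N\<close>.\<close>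

lemma adele_fixed_central:
  assumes "invol x = x"
  shows "x * y = y * (x :: 'h adeles)"
proof -
  obtain d :: nat where d: "d > 0" "of_nat d *\<^sub>Q x \<in> OH" "of_nat d *\<^sub>Q y \<in> OH"
    using OH_common_denominator[of "{x, y}"] by auto
  define x' where "x' = of_nat d *\<^sub>Q x"
  define y' where "y' = of_nat d *\<^sub>Q y"
  have "x' * y' - y' * x' = 0"
  proof (rule adele_zero_if_divisible)
    fix N :: nat assume N: "N > 0"
    have "invol x' = x'" using assms by (simp add: x'_def)
    then obtain k where k: "(1 / of_nat N) *\<^sub>Q (x' - of_int k) \<in> OH"
      using OH_fixed_approx[of x' N] d N by (auto simp: x'_def)
    have "(1 / of_nat N) *\<^sub>Q (x' * y' - y' * x') = (1 / of_nat N) *\<^sub>Q (x' - of_int k) * y' -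
      y' * (1 / of_nat N) *\<^sub>Q (x' - of_int k)"
      by (simp add: scaleQ_diff_right algebra_simps mult_of_int_commute)
    also have "\<dots> \<in> OH" using k d by (intro OH_diff OH_mult) (auto simp: y'_def)
    finally show "(1 / of_nat N) *\<^sub>Q (x' * y' - y' * x') \<in> OH" .
  qed
  then have "of_nat d *\<^sub>Q of_nat d *\<^sub>Q (x * y) =
    of_nat d *\<^sub>Q of_nat d *\<^sub>Q (y * x)" by (simp add: x'_def y'_def)
  then show ?thesis using d(1) by simp
qed

end

section \<open>Matrices over the adeles\<close>

lemma matrix_vector_mult_nth: "(A *v x) $ i = (\<Sum>j\<in>UNIV. A $ i $ j * x $ j)"
  by (simp add: matrix_vector_mult_def)

lemma matrix_matrix_mult_nth: "(A ** B) $ i $ j = (\<Sum>k\<in>UNIV. A $ i $ k * B $ k $ j)"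
  by (simp add: matrix_matrix_mult_def)

lemma mat_nth: "mat l $ i $ j = (if i = j then l else 0)"
  by (simp add: mat_def)

lemma mat_mult_nth: "(mat l ** A) $ i $ j = l * (A $ i $ j :: 'a::ring_1)"
  by (simp add: matrix_matrix_mult_nth mat_nth if_distrib[of "\<lambda>x. x * _"] cong: if_cong)

lemma mult_mat_nth: "(A ** mat l) $ i $ j = (A $ i $ j :: 'a::ring_1) * l"
  by (simp add: matrix_matrix_mult_nth mat_nth if_distrib[of "\<lambda>x. _ * x"] cong: if_cong)

lemma mat_vector_mult_nth: "(mat l *v x) $ i = l * (x $ i :: 'a::ring_1)"
  by (simp add: matrix_vector_mult_nth mat_nth if_distrib[of "\<lambda>x. x * _"] cong: if_cong)

lemma matrix_vector_scaleQ: "A *v (q *\<^sub>Q x) = q *\<^sub>Q (A *v (x :: 'a::rat_algebra_1 ^ 'n))"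
  by (simp add: vec_eq_iff matrix_vector_mult_nth scaleQ_sum_right)

lemma matrix_scaleQ_vector: "(q *\<^sub>Q A) *v x = q *\<^sub>Q (A *v (x :: 'a::rat_algebra_1 ^ 'n))"
  by (simp add: vec_eq_iff matrix_vector_mult_nth scaleQ_sum_right)

lemma matrix_vector_mult_axis: "(A *v axis j 1) $ i = (A $ i $ j :: 'a::ring_1)"
  by (simp add: matrix_vector_mult_nth axis_def if_distrib[of "\<lambda>x. _ * x"] cong: if_cong)

lemma dagger_nth: "dagger M $ i $ j = invol (M $ j $ i)"
  by (simp add: dagger_def)

lemma dagger_mult: "dagger (A ** B) = dagger B ** dagger A"
  by (simp add: vec_eq_iff dagger_nth matrix_matrix_mult_nth invol_sum invol_mult)

definition sform :: "'a::involution_ring ^ 'n \<Rightarrow> 'a ^ 'n \<Rightarrow> 'a"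
  where "sform x y = (\<Sum>i\<in>UNIV. invol (x $ i) * y $ i)"

lemma sform_add_right: "sform x (y + z) = sform x y + sform x z"
  by (simp add: sform_def distrib_left sum.distrib)

lemma sform_add_left: "sform (x + z) y = sform x y + sform z y"
  by (simp add: sform_def distrib_right invol_add sum.distrib)

lemma sform_scaleQ: "sform x (q *\<^sub>Q (y :: 'a::{rat_algebra_1,involution_ring} ^ 'n)) =
  q *\<^sub>Q sform x y"
  "sform (q *\<^sub>Q x) y = q *\<^sub>Q sform x y"
  by (simp_all add: sform_def scaleQ_sum_right)

lemma invol_sform: "invol (sform x y) = sform y x"
  by (simp add: sform_def invol_sum invol_mult)

lemma sform_matrix: "sform (M *v w) v = sform w (dagger M *v v)"
proof -
  have "sform (M *v w) v = (\<Sum>i\<in>UNIV. \<Sum>j\<in>UNIV. invol (w $ j) * (invol (M $ i $ j) * v $ i))"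
    by (simp add: sform_def matrix_vector_mult_nth invol_sum invol_mult sum_distrib_right mult.assoc)
  also have "\<dots> = (\<Sum>j\<in>UNIV. \<Sum>i\<in>UNIV.
    invol (w $ j) * (invol (M $ i $ j) * v $ i))" by (rule sum.swap)
  also have "\<dots> = sform w (dagger M *v v)"
    by (simp add: sform_def matrix_vector_mult_nth dagger_nth sum_distrib_left)
  finally show ?thesis .
qed

lemma sform_column: "sform (M *v axis j 1) v = (dagger M *v v) $ j"
  by (simp only: sform_def matrix_vector_mult_axis) (simp add: matrix_vector_mult_nth dagger_nth)

lemma dagger_mult_nth: "(dagger M ** M) $ i $ j = sform (M *v axis i 1) (M *v axis j 1)"
  by (simp add: sform_def matrix_matrix_mult_nth dagger_nth matrix_vector_mult_axis)

lemma adele_vec_nth [simp]: "adele_vec x $ i = emb (x $ i)"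
  by (simp add: adele_vec_def emb_def)

lemma adele_vec_simps:
  "adele_vec (x + y) = adele_vec x + adele_vec y" "adele_vec (x - y) = adele_vec x - adele_vec y"
  "adele_vec (q *\<^sub>Q x) = q *\<^sub>Q adele_vec x" "adele_vec 0 = 0"
  by (simp_all add: vec_eq_iff emb_simps)

lemma emb_herm: "emb (herm c x y) = c *\<^sub>Q sform (adele_vec x) (adele_vec y)"
  by (simp add: herm_def sform_def emb_simps)

section \<open>Integral vectors and invertible adelic matrices\<close>

context quaternion_order
begin

definition OV :: "('h adeles ^ 'n) set"
  where "OV = {w. \<forall>i. w $ i \<in> OH}"

lemma OV_add: "v \<in> OV \<Longrightarrow> w \<in> OV \<Longrightarrow> v + w \<in> OV"
  by (auto simp: OV_def intro: OH_add)

lemma OV_diff: "v \<in> OV \<Longrightarrow> w \<in> OV \<Longrightarrow> v - w \<in> OV"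
  by (auto simp: OV_def intro: OH_diff)

lemma OV_scale_Ints: "q \<in> \<int> \<Longrightarrow> w \<in> OV \<Longrightarrow> q *\<^sub>Q w \<in> OV"
  by (auto simp: OV_def intro: OH_scale_Ints)

lemma OV_axis: "axis i 1 \<in> OV"
  by (auto simp: OV_def axis_def)

lemma OV_matrix: "(\<And>i j. A $ i $ j \<in> OH) \<Longrightarrow> w \<in> OV \<Longrightarrow>
  A *v w \<in> OV"
  by (auto simp: OV_def matrix_vector_mult_nth intro!: OH_sum OH_mult)

lemma OV_adele_vec: "adele_vec x \<in> OV \<longleftrightarrow> (\<forall>i. x $ i \<in> R)"
  by (simp add: OV_def emb_in_OH_iff)

lemma sform_OH: "v \<in> OV \<Longrightarrow> w \<in> OV \<Longrightarrow> sform v w \<in> OH"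
  by (auto simp: sform_def OV_def intro!: OH_sum OH_mult OH_invol)

lemma OV_denominator: "\<exists>d::nat. d > 0 \<and> of_nat d *\<^sub>Q (w :: 'h adeles ^ 'n) \<in> OV"
proof -
  obtain d :: nat where "d > 0"
    "\<forall>x\<in>range (\<lambda>i. w $ i). of_nat d *\<^sub>Q x \<in> OH"
      using OH_common_denominator[of "range (\<lambda>i. w $ i)"] by auto
  then show ?thesis by (intro exI[of _ d]) (auto simp: OV_def)
qed

lemma vec_denominator: "\<exists>d::nat. d > 0 \<and>
  (\<forall>i. of_nat d *\<^sub>Q ((x :: 'h ^ 'n) $ i) \<in> R)"
proof -
  obtain d :: nat where "d > 0" "\<forall>y\<in>range (\<lambda>i. x $ i). of_nat d *\<^sub>Q y \<in> R"
    using R_common_denominator[of "range (\<lambda>i. x $ i)"] by auto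
  then show ?thesis by (intro exI[of _ d]) auto
qed

lemma matrix_denominator: "\<exists>d::nat. d > 0 \<and>
  (\<forall>i j. of_nat d *\<^sub>Q ((A :: 'h adeles ^ 'n ^ 'n) $ i $ j) \<in> OH)"
proof -
  obtain d :: nat where "d > 0"
    "\<forall>x\<in>range (\<lambda>(i, j). A $ i $ j). of_nat d *\<^sub>Q x \<in> OH"
    using OH_common_denominator[of "range (\<lambda>(i, j). A $ i $ j)"] by auto
  then show ?thesis by (intro exI[of _ d]) auto
qed

lemma OV_approx:
  assumes "N > 0"
  shows "\<exists>y. (1 / of_nat N) *\<^sub>Q ((w :: 'h adeles ^ 'n) - adele_vec y) \<in> OV"
proof -
  have "\<forall>i. \<exists>a. (1 / of_nat N) *\<^sub>Q (w $ i - emb a) \<in> OH"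
    using adele_approx[OF assms] by blast
  from choice[OF this] obtain a where "\<And>i. (1 / of_nat N) *\<^sub>Q (w $ i - emb (a i)) \<in> OH"
    by blast
  then show ?thesis by (intro exI[of _ "\<chi> i. a i"]) (simp add: OV_def)
qed

lemma divisible_iterate:
  fixes v :: "'h adeles ^ 'n"
  assumes "p > 0" "\<And>i j. Y $ i $ j \<in> OH" "v = of_nat p *\<^sub>Q (Y *v v)"
    "of_nat e *\<^sub>Q v \<in> OV"
  shows "(of_nat e / of_nat p ^ k) *\<^sub>Q v \<in> OV"
proof (induction k)
  case (Suc k)
  have "(of_nat e / of_nat p ^ Suc k) *\<^sub>Q v =
    (of_nat e / of_nat p ^ Suc k) *\<^sub>Q (of_nat p *\<^sub>Q (Y *v v))"
    using assms(3) by simp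
  also have "\<dots> = Y *v ((of_nat e / of_nat p ^ k) *\<^sub>Q v)" using assms(1)
    by (simp add: matrix_vector_scaleQ)
  finally show ?case using OV_matrix[OF assms(2) Suc] by simp
qed (use assms in simp)

text \<open>Needed because the approximation argument for matrices works at one prime at a time,
  with a denominator \<open>e\<close> that depends on the prime.\<close>

lemma adele_zero_if_primewise_divisible:
  assumes "\<And>p. prime (p::nat) \<Longrightarrow> \<exists>e::nat. e > 0 \<and>
    (\<forall>k. (of_nat e / of_nat p ^ k) *\<^sub>Q x \<in> OH)"
  shows "x = 0"
proof -
  obtain s :: nat where s: "s > 0" "of_nat s *\<^sub>Q x \<in> OH" using OH_denominator by blast
  define y where "y = of_nat s *\<^sub>Q x"
  have "(1 / of_nat N) *\<^sub>Q y \<in> OH" if "N > 0" for N :: nat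
    using that
  proof (induction N rule: nat_coprime_induct)
    case (prime_power p k)
    obtain e :: nat where e: "e > 0" "\<And>k. (of_nat e / of_nat p ^ k) *\<^sub>Q x \<in> OH"
      using assms[OF prime_power] by blast
    have p: "p > 0" "\<not> is_unit p" using prime_power prime_gt_0_nat not_prime_1 by auto
    obtain e' where e': "e = p ^ multiplicity p e * e'" "\<not> p dvd e'"
      using multiplicity_decompose'[of e p] e(1) p(2) by (metis not_gr0)
    \<comment> \<open>The \<open>p\<close>-part of \<open>e\<close> is absorbed by the larger
      exponent \<open>Suc k + r\<close>; the part \<open>e'\<close> prime to \<open>p\<close> is
      removed by Bezout, using that \<open>y\<close> itself is integral.\<close>
    define r where "r = multiplicity p e"
    have "(of_nat e / of_nat p ^ (Suc k + r)) *\<^sub>Q x \<in> OH" by (rule e)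
    moreover have "(of_nat e :: rat) / of_nat p ^ (Suc k + r) = of_nat e' / of_nat p ^ Suc k"
    proof -
      have "(of_nat e :: rat) = of_nat p ^ r * of_nat e'" using e'(1) unfolding r_def
        by (metis of_nat_mult of_nat_power)
      then show ?thesis using p(1) by (simp add: power_add)
    qed
    ultimately have "of_nat s *\<^sub>Q (of_nat e' / of_nat p ^ Suc k) *\<^sub>Q x \<in> OH"
      using OH_scale_Ints[OF Ints_of_nat] by metis
    then have 1: "(of_nat e' / of_nat (p ^ Suc k)) *\<^sub>Q y \<in> OH" by (simp add: y_def mult.commute)
    have "coprime p e'" using prime_imp_coprime[OF prime_power e'(2)] .
    then have "coprime (p ^ Suc k) e'" by (rule coprime_power_left_iff[THEN iffD2, OF disjI1])
    then obtain u v where uv: "u * int (p ^ Suc k) + v * int e' = 1"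
      by (metis bezout_int coprime_iff_gcd_eq_1 coprime_int_iff)
    define P where "P = p ^ Suc k"
    have P: "P > 0" using p by (simp add: P_def)
    have "(1::rat) / of_nat P = of_int (u * int P + v * int e') / of_nat P" using uv unfolding P_def
      by (simp only: of_int_1)
    also have "\<dots> = of_int u + of_int v * (of_nat e' / of_nat P)" using P by (simp add: field_simps)
    finally have "(1 / of_nat P) *\<^sub>Q y = of_int u *\<^sub>Q y +
      of_int v *\<^sub>Q ((of_nat e' / of_nat P) *\<^sub>Q y)"
      by (simp only: scaleQ_add_left scaleQ_scaleQ)
    also have "\<dots> \<in> OH"
      by (rule OH_add[OF OH_scale_Ints[OF Ints_of_int s(2)[folded y_def]] OH_scale_Ints[OF Ints_of_int 1[folded P_def]]])
    finally show ?case unfolding P_def .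
  next
    case (coprime m n)
    show ?case by (rule coprime_divide_closed[OF _ _ coprime]) (auto intro: OH_add OH_scale_Ints)
  qed (use s in \<open>simp add: y_def\<close>)
  then have "y = 0" by (rule adele_zero_if_divisible)
  then show ?thesis using s(1) by (simp add: y_def)
qed

text \<open>
  Approximate \<open>M\<close> by a rational matrix \<open>M0\<close> so closely that \<open>X ** M0 = 1 - p Y\<close> with \<open>Y\<close> integral.
  Then \<open>M0\<close> is injective, hence invertible over the rational quaternion algebra, and every column
  \<open>g\<close> of \<open>1 - M ** X\<close> is killed by \<open>X\<close>, so \<open>v = M0\<inverse> g\<close> satisfies \<open>v = p Y v\<close> and is
  divisible by all powers of \<open>p\<close>.
\<close>

lemma left_inverse_imp_right_inverse:
  fixes X M :: "'h adeles ^ 'n ^ 'n"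
  assumes XM: "X ** M = mat 1"
  shows "M ** X = mat 1"
proof -
  have "g = 0" if g: "X *v g = 0" for g
  proof -
    have "g $ i = 0" for i
    proof (rule adele_zero_if_primewise_divisible)
      fix p :: nat assume p: "prime p"
      have p0: "p > 0" "p \<ge> 2" using p prime_gt_0_nat prime_ge_2_nat by auto
      obtain d :: nat where d: "d > 0" "\<And>i j. of_nat d *\<^sub>Q (X $ i $ j) \<in> OH"
        using matrix_denominator[of X] by blast
      \<comment> \<open>The factor \<open>d\<close> clears the denominators of \<open>X\<close>, so
        the error is still divisible by \<open>p\<close> after multiplication by
        \<open>X\<close>.\<close>
      have "\<exists>a. (1 / of_nat (p * d)) *\<^sub>Q (M $ i $ j - emb a) \<in> OH" for i j
        using adele_approx[of "p * d"] p0 d by simp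
      then obtain a where a: "\<And>i j. (1 / of_nat (p * d)) *\<^sub>Q (M $ i $ j -
        emb (a i j)) \<in> OH" by metis
      define M0 :: "'h ^ 'n ^ 'n" where "M0 = (\<chi> i j. a i j)"
      define M1 :: "'h adeles ^ 'n ^ 'n" where "M1 = (\<chi> i j. emb (a i j))"
      define E where "E = (1 / of_nat (p * d)) *\<^sub>Q (M - M1)"
      define Y where "Y = (of_nat d *\<^sub>Q X) ** E"
      have Y: "Y $ i $ j \<in> OH" for i j
        unfolding Y_def matrix_matrix_mult_nth using a d by (intro OH_sum OH_mult) (auto simp: E_def M1_def)
      have XM1: "X *v (M1 *v v) = v - of_nat p *\<^sub>Q (Y *v v)" for v
      proof -
        have "of_nat p *\<^sub>Q (Y *v v) = of_nat p *\<^sub>Q ((of_nat d *\<^sub>Q X) *v (E *v v))"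
          by (simp add: Y_def matrix_vector_mul_assoc)
        also have "\<dots> = X *v (of_nat (p * d) *\<^sub>Q (E *v v))"
          by (simp add: matrix_scaleQ_vector matrix_vector_scaleQ)
        also have "of_nat (p * d) *\<^sub>Q (E *v v) = M *v v - M1 *v v"
          using p0 d by (simp add: E_def matrix_scaleQ_vector matrix_vector_mult_diff_rdistrib)
        also have "X *v (M *v v - M1 *v v) = X *v (M *v v) - X *v (M1 *v v)"
          by (rule matrix_vector_mult_diff_distrib)
        also have "X *v (M *v v) = v" by (simp add: matrix_vector_mul_assoc XM)
        finally show ?thesis by simp
      qed
      have M01: "adele_vec (M0 *v v) = M1 *v adele_vec v" for v
        by (simp add: vec_eq_iff matrix_vector_mult_nth M0_def M1_def emb_simps)
      \<comment> \<open>For a rational vector, divisibility by all powers of the single prime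
        \<open>p\<close> already forces zero; for an adelic one it would not.\<close>
      have ker: "v = 0" if v: "M0 *v v = 0" for v
      proof -
        have "X *v (M1 *v adele_vec v) = 0" using M01[of v] v
          by (simp add: adele_vec_simps matrix_vector_mult_nth vec_eq_iff)
        then have eq: "adele_vec v = of_nat p *\<^sub>Q (Y *v adele_vec v)" using XM1[of "adele_vec v"]
          by simp
        obtain e :: nat where e: "e > 0" "\<And>i. of_nat e *\<^sub>Q (v $ i) \<in> R"
          using vec_denominator[of v] by blast
        have "of_nat e *\<^sub>Q adele_vec v \<in> OV"
          using e(2) OV_adele_vec[of "of_nat e *\<^sub>Q v"] by (simp add: adele_vec_simps)
        from divisible_iterate[OF p0(1) Y eq this] have "(of_nat e / of_nat p ^ k) *\<^sub>Q
          adele_vec v \<in> OV" for k .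
        then have "(of_nat e / of_nat p ^ k) *\<^sub>Q v $ i \<in> R" for k i
          using OV_adele_vec[of "(of_nat e / of_nat p ^ k) *\<^sub>Q v"] by (simp add: adele_vec_simps)
        then have "of_nat e *\<^sub>Q v $ i = 0" for i
          by (intro zero_if_powers_divide_R[OF p0(2)]) simp
        then show ?thesis using e(1) by (simp add: vec_eq_iff)
      qed
      have "surj (\<lambda>v. M0 *v v)"
      proof (rule rat_vec_additive_inj_imp_surj)
        show "inj (\<lambda>v. M0 *v v)"
        proof (rule injI)
          fix x y assume "M0 *v x = M0 *v y"
          then have "M0 *v (x - y) = 0" by (simp add: matrix_vector_mult_diff_distrib)
          then show "x = y" using ker by fastforce
        qed
      qed (rule matrix_vector_right_distrib)
      then have "\<exists>q. M0 *v q = axis j 1" for j by (metis surjD)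
      then obtain q where q: "\<And>j. M0 *v q j = axis j 1" by metis
      \<comment> \<open>The columns are rational preimages of the unit vectors under
        \<open>M0\<close>.\<close>
      define Q :: "'h adeles ^ 'n ^ 'n" where "Q = (\<chi> i j. emb (q j $ i))"
      have "M1 ** Q = mat 1"
      proof (subst vec_eq_iff, intro allI, subst vec_eq_iff, intro allI)
        fix i j
        have "(M1 ** Q) $ i $ j = emb ((M0 *v q j) $ i)"
          by (simp add: matrix_matrix_mult_nth M1_def M0_def Q_def matrix_vector_mult_nth emb_simps)
        also have "\<dots> = mat 1 $ i $ j" by (auto simp: q mat_nth axis_def emb_simps)
        finally show "(M1 ** Q) $ i $ j = mat 1 $ i $ j" .
      qed
      define v where "v = Q *v g"
      have M1v: "M1 *v v = g" by (simp add: v_def matrix_vector_mul_assoc \<open>M1 ** Q = mat 1\<close>)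
      then have eq: "v = of_nat p *\<^sub>Q (Y *v v)" using XM1[of v] g by simp
      obtain e :: nat where e: "e > 0" "of_nat e *\<^sub>Q v \<in> OV" using OV_denominator by blast
      obtain t :: nat where t: "t > 0" "\<And>i j. of_nat t *\<^sub>Q (M1 $ i $ j) \<in> OH"
        using matrix_denominator[of M1] by blast
      have "(of_nat (t * e) / of_nat p ^ k) *\<^sub>Q g $ i \<in> OH" for k
      proof -
        have "(of_nat t *\<^sub>Q M1) *v ((of_nat e / of_nat p ^ k) *\<^sub>Q v) \<in> OV"
          using t(2) by (intro OV_matrix divisible_iterate[OF p0(1) Y eq e(2)]) auto
        moreover have "(of_nat t *\<^sub>Q M1) *v ((of_nat e / of_nat p ^ k) *\<^sub>Q v) =
          (of_nat (t * e) / of_nat p ^ k) *\<^sub>Q g"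
          by (simp add: matrix_scaleQ_vector matrix_vector_scaleQ M1v)
        ultimately show ?thesis by (simp add: OV_def)
      qed
      then show "\<exists>e::nat. e > 0 \<and>
        (\<forall>k. (of_nat e / of_nat p ^ k) *\<^sub>Q g $ i \<in> OH)"
        using t(1) e(1) by (intro exI[of _ "t * e"]) auto
    qed
    then show ?thesis by (simp add: vec_eq_iff)
  qed
  note inj = this
  show ?thesis
  proof (subst matrix_eq, intro allI)
    fix v
    have "X *v ((M ** X) *v v - v) = 0"
      by (simp add: matrix_vector_mult_diff_distrib matrix_vector_mul_assoc matrix_mul_assoc XM)
    then show "(M ** X) *v v = mat 1 *v v" using inj by fastforce
  qed
qed

lemma GU_UNIV_E:
  assumes "M \<in> GU (UNIV :: 'h adeles set)"
  obtains l m where "invol l = l" "invol m = m" "l * m = 1" "m * l = 1" "dagger M ** M = mat l"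
    "(mat m ** dagger M) ** M = mat 1" "M ** (mat m ** dagger M) = mat 1"
proof -
  obtain l m where lm: "invol l = l" "invol m = m" "l * m = 1" "m * l = 1" "dagger M ** M = mat l"
    using assms by (auto simp: GU_def fixed_ring_def)
  have "(mat m ** dagger M) ** M = mat m ** mat l" by (simp add: lm(5) flip: matrix_mul_assoc)
  also have "\<dots> = mat 1" using lm(4) by (auto simp: vec_eq_iff mat_mult_nth mat_nth)
  finally have "(mat m ** dagger M) ** M = mat 1" .
  then show ?thesis using that lm left_inverse_imp_right_inverse by blast
qed

lemma sform_GU:
  assumes "invol l = l" "dagger M ** M = mat l"
  shows "sform (M *v w) (M *v v) = l * sform w (v :: 'h adeles ^ 'n)"
proof -
  have "sform (M *v w) (M *v v) = sform w (mat l *v v)"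
    by (simp add: sform_matrix matrix_vector_mul_assoc assms(2))
  also have "\<dots> = (\<Sum>i\<in>UNIV. invol (w $ i) * l * v $ i)"
    by (simp add: sform_def mat_vector_mult_nth mult.assoc)
  also have "\<dots> = l * sform w v"
    using adele_fixed_central[OF assms(1)] by (simp add: sform_def sum_distrib_left mult.assoc[symmetric])
  finally show ?thesis .
qed

section \<open>The lattices \<open>kappa R M\<close> and their cosets\<close>

lemma kappa_iff: "x \<in> kappa R M \<longleftrightarrow> (\<exists>w\<in>OV. adele_vec x = M *v w)"
  by (auto simp: kappa_def OV_def)

lemma kappa_add: "x \<in> kappa R M \<Longrightarrow> y \<in> kappa R M \<Longrightarrow> x +
  y \<in> kappa R M"
  unfolding kappa_iff by (metis OV_add adele_vec_simps(1) matrix_vector_right_distrib)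

lemma kappa_zero: "0 \<in> kappa R M"
  unfolding kappa_iff by (intro bexI[of _ 0]) (auto simp:
    adele_vec_simps vec_eq_iff matrix_vector_mult_nth OV_def emb_simps)

lemma kappa_right_scale:
  assumes "x \<in> kappa R M" "a \<in> R"
  shows "right_scale x a \<in> kappa R M"
proof -
  obtain w where w: "w \<in> OV" "adele_vec x = M *v w" using assms by (auto simp: kappa_iff)
  have "emb (x $ i) = (M *v w) $ i" for i using w(2) by (simp add: vec_eq_iff)
  then have "adele_vec (right_scale x a) = M *v (\<chi> i. w $ i * emb a)"
    by (simp add: vec_eq_iff emb_simps matrix_vector_mult_nth sum_distrib_right mult.assoc)
  moreover have "(\<chi> i. w $ i * emb a) \<in> OV" using w(1) assms(2)
    by (auto simp: OV_def intro!: OH_mult OH_emb)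
  ultimately show ?thesis by (auto simp: kappa_iff)
qed

lemma kappa_sum: "(\<And>i. i \<in> A \<Longrightarrow> f i \<in> kappa R M) \<Longrightarrow>
  sum f A \<in> kappa R M"
  by (induction A rule: infinite_finite_induct) (auto intro: kappa_add kappa_zero)

lemma GU_contains_multiple:
  assumes "M \<in> GU (UNIV :: 'h adeles set)"
  shows "\<exists>N::nat. N > 0 \<and> (\<forall>v\<in>OV. of_nat N *\<^sub>Q v \<in> (*v) M ` OV)"
proof -
  obtain l m where "M ** (mat m ** dagger M) = mat 1" using GU_UNIV_E[OF assms] by metis
  then obtain X where X: "M ** X = mat 1" by blast
  obtain N :: nat where N: "N > 0" "\<And>i j. of_nat N *\<^sub>Q (X $ i $ j) \<in> OH"
    using matrix_denominator[of X] by blast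
  have "of_nat N *\<^sub>Q v \<in> (*v) M ` OV" if v: "v \<in> OV" for v
  proof
    show "(of_nat N *\<^sub>Q X) *v v \<in> OV" using N(2) v by (intro OV_matrix) auto
    have "(of_nat N *\<^sub>Q X) *v v = of_nat N *\<^sub>Q (X *v v)" by (rule matrix_scaleQ_vector)
    then show "of_nat N *\<^sub>Q v = M *v ((of_nat N *\<^sub>Q X) *v v)"
      by (simp add: matrix_vector_scaleQ matrix_vector_mul_assoc X)
  qed
  then show ?thesis using N(1) by blast
qed

text \<open>Density of the lattice in its completion. A rational approximation modulo
  \<open>N' * N\<close> leaves an error in the image of the integral vectors under \<open>M\<close>,
  by choice of \<open>N'\<close>, so the approximating vector lies in that image as well.\<close>

lemma kappa_approx:
  assumes "M \<in> GU (UNIV :: 'h adeles set)" "w \<in> OV" "N > 0"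
  shows "\<exists>y\<in>kappa R M. (1 / of_nat N) *\<^sub>Q (M *v w - adele_vec y) \<in> OV"
proof -
  obtain N' :: nat where N': "N' > 0"
    "\<And>v. v \<in> OV \<Longrightarrow> of_nat N' *\<^sub>Q v \<in> (*v) M ` OV"
      using GU_contains_multiple[OF assms(1)] by blast
  obtain y where y: "(1 / of_nat (N' * N)) *\<^sub>Q (M *v w - adele_vec y) \<in> OV" (is "?v \<in> OV")
    using OV_approx[of "N' * N"] N' assms by auto
  have "of_nat N *\<^sub>Q ?v \<in> OV" by (rule OV_scale_Ints[OF Ints_of_nat y])
  then have "of_nat N' *\<^sub>Q of_nat N *\<^sub>Q ?v \<in> (*v) M ` OV" by (rule N')
  then obtain w' where w': "w' \<in> OV" "of_nat N' *\<^sub>Q of_nat N *\<^sub>Q ?v = M *v w'" by blast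
  have "of_nat N' *\<^sub>Q of_nat N *\<^sub>Q ?v = M *v w - adele_vec y" using N'(1) assms(3) by simp
  then have "adele_vec y = M *v (w - w')" using w'(2)
    by (simp add: matrix_vector_mult_diff_distrib algebra_simps)
  then have "y \<in> kappa R M" using OV_diff[OF assms(2) w'(1)] by (auto simp: kappa_iff)
  moreover have "(1 / of_nat N) *\<^sub>Q (M *v w - adele_vec y) \<in> OV"
    using OV_scale_Ints[OF Ints_of_nat y, of N'] N'(1) by simp
  ultimately show ?thesis by blast
qed

text \<open>The lattice determines its completion: a vector \<open>M *v w\<close> is a lattice
  vector plus a remainder that is small enough to lie in the other image.\<close>

lemma kappa_subset_imp_image_subset:
  assumes "M \<in> GU (UNIV :: 'h adeles set)" "M' \<in> GU UNIV" "kappa R M \<subseteq> kappa R M'"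
  shows "(*v) M ` OV \<subseteq> (*v) M' ` OV"
proof
  fix u assume "u \<in> (*v) M ` OV"
  then obtain w where w: "w \<in> OV" "u = M *v w" by blast
  obtain N :: nat where N: "N > 0"
    "\<And>v. v \<in> OV \<Longrightarrow> of_nat N *\<^sub>Q v \<in> (*v) M' ` OV"
      using GU_contains_multiple[OF assms(2)] by blast
  obtain y where y: "y \<in> kappa R M" "(1 / of_nat N) *\<^sub>Q (M *v w - adele_vec y) \<in> OV"
    using kappa_approx[OF assms(1) w(1) N(1)] by blast
  have "u - adele_vec y \<in> (*v) M' ` OV" using N(2)[OF y(2)] N(1) w(2) by simp
  then obtain w1 where w1: "w1 \<in> OV" "u - adele_vec y = M' *v w1" by blast
  obtain w2 where w2: "w2 \<in> OV" "adele_vec y = M' *v w2" using y(1) assms(3)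
    unfolding kappa_iff subset_iff by blast
  have "u = M' *v (w1 + w2)" using w1(2) w2(2) by (simp add: matrix_vector_right_distrib algebra_simps)
  then show "u \<in> (*v) M' ` OV" using OV_add[OF w1(1) w2(1)] by blast
qed

lemma kappa_subset_mult:
  assumes "U \<in> GU OH"
  shows "kappa R (M ** U) \<subseteq> kappa R M"
proof
  fix x assume "x \<in> kappa R (M ** U)"
  then obtain w where w: "w \<in> OV" "adele_vec x = (M ** U) *v w" by (auto simp: kappa_iff)
  have "U *v w \<in> OV" using assms w(1) by (intro OV_matrix) (auto simp: GU_def)
  then show "x \<in> kappa R M" using w(2) by (auto simp: kappa_iff simp flip: matrix_vector_mul_assoc)
qed

lemma one_in_GU_OH: "mat 1 \<in> GU OH"
proof -
  have "dagger (mat 1) ** mat 1 = (mat 1 :: 'h adeles ^ 'n ^ 'n)"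
    by (auto simp: vec_eq_iff dagger_nth mat_nth invol_one)
  then show ?thesis unfolding GU_def fixed_ring_def by (auto simp: mat_nth intro!: exI[of _ 1])
qed

lemma GU_OH_mult:
  assumes "U \<in> GU OH" "V \<in> GU OH"
  shows "U ** V \<in> GU OH"
proof -
  obtain l m where l: "l \<in> OH" "invol l = l" "m \<in> OH" "invol m = m" "l * m = 1" "m * l = 1"
    "dagger U ** U = mat l" "\<And>i j. U $ i $ j \<in> OH"
    using assms(1) by (auto simp: GU_def fixed_ring_def)
  obtain l' m' where l': "l' \<in> OH" "invol l' = l'" "m' \<in> OH" "invol m' = m'" "l' * m' = 1"
    "m' * l' = 1" "dagger V ** V = mat l'" "\<And>i j. V $ i $ j \<in> OH"
    using assms(2) by (auto simp: GU_def fixed_ring_def)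
  have central: "l * x = x * l" "m * x = x * m" for x using adele_fixed_central l by auto
  have "dagger (U ** V) ** (U ** V) = dagger V ** (mat l ** V)"
    by (simp add: dagger_mult l(7)[symmetric] matrix_mul_assoc)
  also have "mat l ** V = V ** mat l" by (simp add: vec_eq_iff mat_mult_nth mult_mat_nth central)
  also have "dagger V ** (V ** mat l) = mat (l' * l)"
    by (auto simp: matrix_mul_assoc l'(7) vec_eq_iff mult_mat_nth mat_nth)
  finally have 1: "dagger (U ** V) ** (U ** V) = mat (l' * l)" .
  have 2: "(l' * l) * (m * m') = 1" "(m * m') * (l' * l) = 1"
    using l(5,6) l'(5,6) by (metis mult.assoc mult_1_left)+
  have 3: "invol (l' * l) = l' * l" "invol (m * m') = m * m'"
    using l(2,4) l'(2,4) central(1)[of l'] central(2)[of m'] by (simp_all add: invol_mult)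
  show ?thesis
    unfolding GU_def fixed_ring_def mem_Collect_eq
  proof (intro conjI allI bexI)
    show "(U ** V) $ i $ j \<in> OH" for i j
      unfolding matrix_matrix_mult_nth using l l' by (intro OH_sum OH_mult) auto
    show "dagger (U ** V) ** (U ** V) = mat (l' * l)" by (rule 1)
    show "(l' * l) * (m * m') = 1" "(m * m') * (l' * l) = 1" by (fact 2)+
    show "m * m' \<in> {x \<in> OH. invol x = x}" "l' * l \<in> {x \<in> OH. invol x = x}" using 3 l l'
      by (auto intro: OH_mult)
  qed
qed

text \<open>The quotient \<open>U\<close> of \<open>M'\<close> by \<open>M\<close> and its inverse
  \<open>U'\<close> both have integral entries, because the completions agree; their multipliers are
  then integral and inverse to each other.\<close>

lemma kappa_eq_imp_coset_subset:
  assumes "M \<in> GU (UNIV :: 'h adeles set)" "M' \<in> GU UNIV" "kappa R M = kappa R M'"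
  shows "(\<lambda>U. M' ** U) ` GU OH \<subseteq> (\<lambda>U. M ** U) ` GU OH"
proof -
  obtain l m where l: "invol l = l" "invol m = m" "l * m = 1" "m * l = 1" "dagger M ** M = mat l"
    "(mat m ** dagger M) ** M = mat 1" "M ** (mat m ** dagger M) = mat 1" using GU_UNIV_E[OF assms(1)]
      by metis
  obtain l' m' where l': "invol l' = l'" "invol m' = m'" "l' * m' = 1" "m' * l' = 1"
    "dagger M' ** M' = mat l'"
    "(mat m' ** dagger M') ** M' = mat 1" "M' ** (mat m' ** dagger M') = mat 1"
      using GU_UNIV_E[OF assms(2)] by metis
  define X where "X = mat m ** dagger M"
  define X' where "X' = mat m' ** dagger M'"
  define U where "U = X ** M'"
  define U' where "U' = X' ** M"
  have MU: "M ** U = M'" "M' ** U' = M" using l(7) l'(7)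
    by (simp_all add: U_def U'_def X_def X'_def matrix_mul_assoc)
  \<comment> \<open>Column \<open>j\<close> of \<open>B\<close> is \<open>A *v w\<close> with
    \<open>w\<close> integral, and \<open>Z\<close> recovers \<open>w\<close> as column
    \<open>j\<close> of the product.\<close>
  have entries: "(Z ** B) $ i $ j \<in> OH"
    if Z: "Z ** A = mat 1" and sub: "(*v) B ` OV \<subseteq> (*v) A ` OV"
      for A B Z :: "'h adeles ^ 'n ^ 'n" and i j
  proof -
    obtain w where w: "w \<in> OV" "B *v axis j 1 = A *v w" using sub OV_axis[of j] by blast
    have "(Z ** B) *v axis j 1 = Z *v (A *v w)" using w(2) by (simp flip: matrix_vector_mul_assoc)
    also have "\<dots> = w" by (simp add: matrix_vector_mul_assoc Z)
    finally have "(Z ** B) $ i $ j = w $ i" by (metis matrix_vector_mult_axis)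
    then show ?thesis using w(1) by (simp add: OV_def)
  qed
  have U: "U $ i $ j \<in> OH" for i j
    unfolding U_def using l(6) kappa_subset_imp_image_subset[OF assms(2,1)] assms(3)
      by (intro entries) (auto simp: X_def)
  have U': "U' $ i $ j \<in> OH" for i j
    unfolding U'_def using l'(6) kappa_subset_imp_image_subset[OF assms(1,2)] assms(3)
      by (intro entries) (auto simp: X'_def)
  have gram: "dagger V ** V = mat (n * k')"
    if "invol k = k" "n * k = 1" "dagger A ** A = mat k" "dagger B ** B = mat k'" "A ** V = B"
      for A B V :: "'h adeles ^ 'n ^ 'n" and k n k'
  proof -
    have "mat k' = dagger V ** (mat k ** V)" using that(3,4,5) by (metis dagger_mult matrix_mul_assoc)
    also have "mat k ** V = V ** mat k" using adele_fixed_central[OF that(1)]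
      by (simp add: vec_eq_iff mat_mult_nth mult_mat_nth)
    also have "dagger V ** (V ** mat k) = (dagger V ** V) ** mat k" by (rule matrix_mul_assoc)
    also have "\<dots> = mat k ** (dagger V ** V)"
      using adele_fixed_central[OF that(1)]
        by (simp add: vec_eq_iff mat_mult_nth mult_mat_nth del: matrix_mul_assoc)
    finally have "mat n ** mat k' = (mat n ** mat k) ** (dagger V ** V)" by (simp add: matrix_mul_assoc)
    also have "mat n ** mat k = (mat 1 :: 'h adeles ^ 'n ^ 'n)" using that(2)
      by (auto simp: vec_eq_iff mat_mult_nth mat_nth)
    finally have "dagger V ** V = mat n ** mat k'" by simp
    also have "\<dots> = mat (n * k')" by (auto simp: vec_eq_iff mat_mult_nth mat_nth)
    finally show ?thesis .
  qed
  have gU: "dagger U ** U = mat (m * l')" by (rule gram[OF l(1,4,5) l'(5) MU(1)])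
  have gU': "dagger U' ** U' = mat (m' * l)" by (rule gram[OF l'(1,4,5) l(5) MU(2)])
  have diag: "k \<in> OH" if "dagger V ** V = mat k" "\<And>i j. V $ i $ j \<in> OH"
    for V :: "'h adeles ^ 'n ^ 'n" and k
  proof -
    fix i :: 'n
    have "(dagger V ** V) $ i $ i \<in> OH" for i
      unfolding matrix_matrix_mult_nth dagger_nth using that(2) by (intro OH_sum OH_mult OH_invol)
    then show ?thesis using that(1) by (simp add: mat_nth)
  qed
  have "m * l' \<in> OH" "m' * l \<in> OH" using diag gU gU' U U' by blast+
  moreover have "(m * l') * (m' * l) = 1" "(m' * l) * (m * l') = 1" using l(3,4) l'(3,4)
    by (metis mult.assoc mult_1_left)+
  moreover have "invol (m * l') = m * l'" "invol (m' * l) = m' * l"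
    using l(1,2) l'(1,2) adele_fixed_central[of m l'] adele_fixed_central[of l m']
      by (simp_all add: invol_mult)
  ultimately have "U \<in> GU OH" unfolding GU_def fixed_ring_def using U gU by blast
  then show ?thesis using GU_OH_mult MU(1) by (auto simp flip: matrix_mul_assoc intro!: imageI)
qed

text \<open>With \<open>z\<close> and \<open>z'\<close> the integral multiples of \<open>l\<close>
  and \<open>m\<close>, the product \<open>z * z'\<close> is the integer \<open>D\<close>. If
  \<open>k\<close> approximates \<open>z\<close> modulo \<open>D\<close>, then
  \<open>gcd k D\<close> is the rational part of \<open>z\<close>, and Bezout yields an integral
  inverse of the rest, with no product over primes.\<close>

lemma fixed_unit_decomposition:
  assumes "invol l = l" "invol m = m" "l * m = 1" "m * (l :: 'h adeles) = 1"
  shows "\<exists>q. q \<noteq> 0 \<and> (1 / q) *\<^sub>Q l \<in> OH \<and> q *\<^sub>Q m \<in> OH"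
proof -
  obtain d :: nat where d: "d > 0" "of_nat d *\<^sub>Q l \<in> OH" "of_nat d *\<^sub>Q m \<in> OH"
    using OH_common_denominator[of "{l, m}"] by auto
  define z where "z = of_nat d *\<^sub>Q l"
  define z' where "z' = of_nat d *\<^sub>Q m"
  define D where "D = d * d"
  have D: "D > 0" using d by (simp add: D_def)
  have zz: "z * z' = of_nat D *\<^sub>Q 1" using assms(3) by (simp add: z_def z'_def D_def)
  have "invol z = z" using assms(1) by (simp add: z_def)
  then obtain k where k: "(1 / of_nat D) *\<^sub>Q (z - of_int k) \<in> OH" (is "?y \<in> OH")
    using OH_fixed_approx[of z D] d D by (auto simp: z_def)
  have z: "z = of_int k *\<^sub>Q 1 + of_nat D *\<^sub>Q ?y" using D by (simp add: of_int_scaleQ_one)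
  define g where "g = gcd k (int D)"
  have g: "g > 0" using D by (simp add: g_def)
  obtain k' D' where kD: "k = g * k'" "int D = g * D'" "coprime k' D'"
    using gcd_coprime_exists[of k "int D"] g unfolding g_def by (metis mult.commute less_irrefl)
  obtain s t where st: "s * k' + t * D' = 1" using kD(3) by (metis bezout_int coprime_iff_gcd_eq_1)
  define u where "u = (1 / of_int g) *\<^sub>Q z"
  have DD: "(of_nat D :: rat) = of_int g * of_int D'" using kD(2) by (metis of_int_mult of_int_of_nat_eq)
  have u: "u = of_int k' *\<^sub>Q 1 + of_int D' *\<^sub>Q ?y"
    using g by (subst u_def, subst z) (simp add: scaleQ_add_right kD(1) DD)
  have uOH: "u \<in> OH" unfolding u
    by (rule OH_add[OF OH_scale_Ints[OF Ints_of_int OH_one] OH_scale_Ints[OF Ints_of_int k]])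
  have uz: "u * z' = of_int D' *\<^sub>Q 1" using zz g by (simp add: u_def DD)
  \<comment> \<open>Solves \<open>u * u' = s * k' + t * D' = 1\<close>, given that
    \<open>u * z'\<close> is \<open>D'\<close> and that \<open>u\<close> is \<open>k'\<close> plus
    \<open>D'\<close> times the integral error of the approximation.\<close>
  define u' where "u' = of_int s *\<^sub>Q 1 + z' * (of_int t *\<^sub>Q 1 - of_int s *\<^sub>Q ?y)"
  have u'OH: "u' \<in> OH" unfolding u'_def
    using d(3) by (intro OH_add OH_mult OH_diff OH_scale_Ints[OF Ints_of_int k] OH_scale_Ints[OF Ints_of_int OH_one]) (simp add: z'_def)
  have "u * u' = of_int s *\<^sub>Q u + (u * z') * (of_int t *\<^sub>Q 1 - of_int s *\<^sub>Q ?y)"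
    by (simp only: u'_def distrib_left mult.assoc mult_scaleQ_right mult_1_right)
  also have "\<dots> = of_int (s * k' + t * D') *\<^sub>Q 1"
    unfolding uz unfolding u by (simp add: scaleQ_add_right scaleQ_add_left scaleQ_diff_right mult.commute)
  finally have uu': "u * u' = 1" by (simp add: st)
  define q where "q = (of_int g :: rat) / of_nat d"
  have q: "q \<noteq> 0" using g d by (simp add: q_def)
  have "(1 / q) *\<^sub>Q l = u" using d(1) by (simp add: q_def u_def z_def)
  moreover have "q *\<^sub>Q m = u'"
  proof -
    have "(q *\<^sub>Q m) * u = 1" using \<open>(1 / q) *\<^sub>Q l = u\<close>[symmetric] q assms(4) by simp
    then have "(q *\<^sub>Q m) * (u * u') = u'" by (simp flip: mult.assoc)
    then show ?thesis by (simp add: uu')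
  qed
  ultimately show ?thesis using uOH u'OH q by metis
qed

lemma kappa_bounds:
  assumes "M \<in> GU (UNIV :: 'h adeles set)"
  obtains N d :: nat where "N > 0" "d > 0"
    "\<And>x. (\<And>i. x $ i \<in> R) \<Longrightarrow> of_nat N *\<^sub>Q x \<in> kappa R M"
    "\<And>x i. x \<in> kappa R M \<Longrightarrow> of_nat d *\<^sub>Q (x $ i) \<in> R"
proof -
  obtain N :: nat where N: "N > 0"
    "\<And>v. v \<in> OV \<Longrightarrow> of_nat N *\<^sub>Q v \<in> (*v) M ` OV"
      using GU_contains_multiple[OF assms] by blast
  obtain d :: nat where d: "d > 0" "\<And>i j. of_nat d *\<^sub>Q (M $ i $ j) \<in> OH"
    using matrix_denominator[of M] by blast
  have "of_nat N *\<^sub>Q x \<in> kappa R M" if "\<And>i. x $ i \<in> R" for x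
    using N(2)[of "adele_vec x"] that OV_adele_vec by (auto simp: kappa_iff adele_vec_simps)
  moreover have "of_nat d *\<^sub>Q (x $ i) \<in> R" if x: "x \<in> kappa R M" for x i
  proof -
    obtain w where w: "w \<in> OV" "adele_vec x = M *v w" using x by (auto simp: kappa_iff)
    have "(of_nat d *\<^sub>Q M) *v w \<in> OV" using d w by (intro OV_matrix) auto
    moreover have "(of_nat d *\<^sub>Q M) *v w = of_nat d *\<^sub>Q (M *v w)" by (rule matrix_scaleQ_vector)
    ultimately have "adele_vec (of_nat d *\<^sub>Q x) \<in> OV" using w(2) by (simp add: adele_vec_simps)
    then show ?thesis by (simp add: OV_adele_vec)
  qed
  ultimately show ?thesis using that N(1) d(1) by blast
qed

lemma vec_eq_sum_axis: "of_nat N *\<^sub>Q x =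
  (\<Sum>i\<in>UNIV. right_scale (of_nat N *\<^sub>Q axis i 1) (x $ i :: 'h))"
  by (simp add: vec_eq_iff axis_def if_distrib[of "\<lambda>y. y * _"] if_distrib[of "\<lambda>y.
    _ *\<^sub>Q y"] cong: if_cong)

text \<open>The lattice contains \<open>N\<close> times the integral rational vectors and has
  finitely many classes modulo these, so class representatives together with the multiples of the
  unit vectors generate it.\<close>

lemma kappa_fg:
  fixes M :: "'h adeles ^ 'n ^ 'n"
  assumes "M \<in> GU (UNIV :: 'h adeles set)"
  shows "fg_right_submodule R (kappa R M)"
proof -
  obtain N d :: nat where Nd: "N > 0" "d > 0"
    "\<And>x. (\<And>i. x $ i \<in> R) \<Longrightarrow> of_nat N *\<^sub>Q x \<in> kappa R M"
    "\<And>x i. x \<in> kappa R M \<Longrightarrow> of_nat d *\<^sub>Q (x $ i) \<in> R"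
      using kappa_bounds[OF assms] by blast
  obtain cl :: "'h ^ 'n \<Rightarrow> 'n \<Rightarrow> 'h \<Rightarrow> int"
    where cl: "finite (cl ` kappa R M)"
    "\<forall>x\<in>kappa R M. \<forall>y\<in>kappa R M. cl x = cl y \<longrightarrow>
      (\<forall>i. ((1 / of_nat N) *\<^sub>Q (x - y)) $ i \<in> R)"
    using vec_mod_classes[OF Nd(1,2), of "kappa R M"] Nd(4) by blast
  define T where "T = inv_into (kappa R M) cl ` (cl ` kappa R M)"
  define S where "S = T \<union> range (\<lambda>i. of_nat N *\<^sub>Q axis i 1)"
  have S: "finite S" using cl(1) by (simp add: S_def T_def)
  have "S \<subseteq> kappa R M" using Nd(3) by (auto simp: S_def T_def axis_def intro!: inv_into_into)
  then have "right_span R S \<subseteq> kappa R M"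
    by (auto simp: right_span_def intro!: kappa_sum kappa_right_scale)
  moreover have "x \<in> right_span R S" if x: "x \<in> kappa R M" for x
  proof -
    define t where "t = inv_into (kappa R M) cl (cl x)"
    have t: "t \<in> T" "t \<in> kappa R M" "cl t = cl x" using x
      by (auto simp: t_def T_def inv_into_into f_inv_into_f)
    have r: "((1 / of_nat N) *\<^sub>Q (x - t)) $ i \<in> R" (is "?r $ i \<in> R") for i
      by (rule cl(2)[rule_format, OF x t(2) t(3)[symmetric]])
    have "of_nat N *\<^sub>Q ?r \<in> right_span R S"
      unfolding vec_eq_sum_axis[of N ?r] using r S
        by (intro right_span_sum right_span_right_scale right_span_base) (auto simp: S_def)
    then have "x - t \<in> right_span R S" using Nd(1) by simp
    moreover have "t \<in> right_span R S" using t(1) S by (intro right_span_base) (auto simp: S_def)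
    ultimately have "(x - t) + t \<in> right_span R S" by (rule right_span_add)
    then show ?thesis by simp
  qed
  ultimately show ?thesis unfolding fg_right_submodule_iff using S by blast
qed

text \<open>With \<open>q\<close> the rational part of the multiplier, \<open>c = 1 / q\<close>
  makes the form on coordinate vectors an integral unit times the standard form, which is integral
  and self-dual.\<close>

lemma kappa_principally_polarized:
  fixes M :: "'h adeles ^ 'n ^ 'n"
  assumes "M \<in> GU (UNIV :: 'h adeles set)"
  shows "principally_polarized R (kappa R M)"
proof -
  obtain l m where l: "invol l = l" "invol m = m" "l * m = 1" "m * l = 1" "dagger M ** M = mat l"
    "(mat m ** dagger M) ** M = mat 1" "M ** (mat m ** dagger M) = mat 1" using GU_UNIV_E[OF assms] by metis
  obtain q where q: "q \<noteq> 0" "(1 / q) *\<^sub>Q l \<in> OH" "q *\<^sub>Q m \<in> OH"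
    using fixed_unit_decomposition[OF l(1-4)] by blast
  define c where "c = 1 / q"
  have c: "c \<noteq> 0" using q(1) by (simp add: c_def)
  define K where "K = kappa R M"
  obtain N d :: nat where Nd: "N > 0" "d > 0"
    "\<And>x. (\<And>i. x $ i \<in> R) \<Longrightarrow> of_nat N *\<^sub>Q x \<in> K"
    "\<And>x i. x \<in> K \<Longrightarrow> of_nat d *\<^sub>Q (x $ i) \<in> R"
      using kappa_bounds[OF assms] unfolding K_def by blast
  have denominator: "\<exists>e::nat. e > 0 \<and> of_nat e *\<^sub>Q y \<in> K" for y
  proof -
    obtain e :: nat where e: "e > 0" "\<And>i. of_nat e *\<^sub>Q (y $ i) \<in> R"
      using vec_denominator[of y] by blast
    then have "of_nat N *\<^sub>Q (of_nat e *\<^sub>Q y) \<in> K" by (intro Nd(3)) simp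
    then show ?thesis using Nd(1) e(1) by (intro exI[of _ "N * e"]) auto
  qed
  have span: "rat_vector.span K = UNIV"
  proof -
    have "y \<in> rat_vector.span K" for y
    proof -
      obtain e :: nat where e: "e > 0" "of_nat e *\<^sub>Q y \<in> K" using denominator by blast
      then have "(1 / of_nat e) *\<^sub>Q of_nat e *\<^sub>Q y \<in> rat_vector.span K"
        by (intro rat_vector.span_scale rat_vector.span_base)
      then show ?thesis using e(1) by simp
    qed
    then show ?thesis by blast
  qed
  have integral: "herm c x y \<in> R" if xy: "x \<in> K" "y \<in> K" for x y
  proof -
    obtain w v where wv: "w \<in> OV" "adele_vec x = M *v w" "v \<in> OV" "adele_vec y = M *v v"
      using xy unfolding K_def kappa_iff by blast
    have "emb (herm c x y) = (c *\<^sub>Q l) * sform w v" by (simp add: emb_herm wv sform_GU[OF l(1,5)])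
    also have "\<dots> \<in> OH" using q(2) sform_OH[OF wv(1,3)] by (intro OH_mult) (auto simp: c_def)
    finally show ?thesis by (simp add: emb_in_OH_iff)
  qed
  have dual: "x \<in> K" if x: "\<And>y. y \<in> K \<Longrightarrow> herm c x y \<in> R" for x
  proof -
    define r where "r = c *\<^sub>Q (dagger M *v adele_vec x)"
    \<comment> \<open>Each column of \<open>M\<close> will be replaced by a lattice vector
      \<open>y\<close> up to \<open>N'\<close> times an integral vector; by this choice the
      remainder pairs integrally with \<open>c *\<^sub>Q adele_vec x\<close>.\<close>
    obtain N' :: nat where N': "N' > 0" "of_nat N' *\<^sub>Q (c *\<^sub>Q adele_vec x) \<in> OV"
      using OV_denominator by blast
    have "invol (r $ j) \<in> OH" for j
    proof -
      define u where "u = M *v axis j 1"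
      obtain y where y: "y \<in> K" "(1 / of_nat N') *\<^sub>Q (u - adele_vec y) \<in> OV" (is "?v \<in> OV")
        using kappa_approx[OF assms OV_axis[of j] N'(1)] unfolding K_def u_def by blast
      have "invol (r $ j) = c *\<^sub>Q invol ((dagger M *v adele_vec x) $ j)" by (simp add: r_def)
      also have "(dagger M *v adele_vec x) $ j = sform u (adele_vec x)" by (simp add: u_def sform_column)
      also have "invol (sform u (adele_vec x)) = sform (adele_vec x) u" by (rule invol_sform)
      also have "u = adele_vec y + of_nat N' *\<^sub>Q ?v" using N'(1) by simp
      also have "c *\<^sub>Q sform (adele_vec x) (adele_vec y + of_nat N' *\<^sub>Q ?v) =
          emb (herm c x y) + sform (of_nat N' *\<^sub>Q (c *\<^sub>Q adele_vec x)) ?v"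
        by (simp only: emb_herm sform_add_right sform_scaleQ scaleQ_add_right scaleQ_scaleQ mult_ac)
      also have "\<dots> \<in> OH" by (intro OH_add OH_emb x y(1) sform_OH N'(2) y(2))
      finally show ?thesis .
    qed
    then have "r $ j \<in> OH" for j by (metis OH_invol invol_invol)
    then have "mat (q *\<^sub>Q m) *v r \<in> OV" using OH_mult[OF q(3)]
      by (simp add: OV_def mat_vector_mult_nth)
    moreover have "adele_vec x = M *v (mat (q *\<^sub>Q m) *v r)"
    proof -
      have "mat (q *\<^sub>Q m) *v r = (mat m ** dagger M) *v adele_vec x"
        using q(1) by (simp add: vec_eq_iff mat_vector_mult_nth r_def c_def flip: matrix_vector_mul_assoc)
      then show ?thesis using l(7) by (simp add: matrix_vector_mul_assoc)
    qed
    ultimately show ?thesis by (auto simp: K_def kappa_iff)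
  qed
  have "unimodular_on R K (herm c)"
    unfolding unimodular_on_def
  proof (intro ballI ex_ex1I)
    fix f assume "f \<in> right_dual R K"
    then have f: "\<And>x. x \<in> K \<Longrightarrow> f x \<in> R"
      "\<And>x y. x \<in> K \<Longrightarrow> y \<in> K \<Longrightarrow> f (x + y) = f x + f y"
      "\<And>x a. x \<in> K \<Longrightarrow> a \<in> R \<Longrightarrow> f (right_scale x a) = f x * a"
        by (auto simp: right_dual_def)
    have "0 \<in> K" unfolding K_def by (rule kappa_zero)
    then have f0: "f 0 = 0" using f(2)[of 0 0] by simp
    have f_sum: "f (\<Sum>i\<in>A. g i) = (\<Sum>i\<in>A. f (g i))" if "\<And>i. g i \<in> K"
      for A :: "'n set" and g
      by (induction A rule: infinite_finite_induct) (use f0 f(2) that in \<open>auto simp: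
        K_def kappa_sum\<close>)
    define b where "b j = of_nat N *\<^sub>Q (axis j 1 :: 'h ^ 'n)" for j
    have b: "b j \<in> K" for j unfolding b_def by (intro Nd(3)) (simp add: axis_def)
    \<comment> \<open>The vector representing \<open>f\<close>, read off from the values of
      \<open>f\<close> at the multiples \<open>b j\<close> of the unit vectors.\<close>
    define x where "x = (\<chi> j. (1 / (c * of_nat N)) *\<^sub>Q invol (f (b j)))"
    have fx: "f y = herm c x y" if y: "y \<in> K" for y
    proof -
      \<comment> \<open>The functional is controlled only inside \<open>K\<close>; the multiple by
        \<open>N * d\<close> turns \<open>y\<close> into a combination of the \<open>b j\<close>
        with coefficients in \<open>R\<close>.\<close>
      have "of_nat (N * d) *\<^sub>Q f y = f y * of_int (int (N * d))" by (simp flip: of_int_scaleQ_one)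
      also have "\<dots> = f (right_scale y (of_int (int (N * d))))"
        using f(3)[OF y R_of_int[of "int (N * d)"]] by simp
      also have "right_scale y (of_int (int (N * d))) = of_nat N *\<^sub>Q (of_nat d *\<^sub>Q y)"
        unfolding of_int_scaleQ_one[symmetric] by (simp add: vec_eq_iff)
      also have "\<dots> = (\<Sum>j\<in>UNIV. right_scale (b j) (of_nat d *\<^sub>Q (y $ j)))"
        by (simp only: vec_eq_sum_axis[of N "of_nat d *\<^sub>Q y"] b_def scaleQ_vec_nth)
      also have "f \<dots> = (\<Sum>j\<in>UNIV. f (b j) * of_nat d *\<^sub>Q (y $ j))"
        using b Nd(4)[OF y] by (subst f_sum) (auto simp: f(3) K_def intro!: kappa_right_scale)
      also have "\<dots> = of_nat (N * d) *\<^sub>Q herm c x y"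
        using c Nd(1) by (simp add: herm_def x_def scaleQ_sum_right)
      finally show ?thesis using Nd(1,2) by simp
    qed
    then have "x \<in> K" using f(1) by (intro dual) metis
    then show "\<exists>x. x \<in> K \<and> (\<forall>y\<in>K. f y = herm c x y)" using fx by blast
  next
    fix f x x' assume xx: "x \<in> K \<and> (\<forall>y\<in>K. f y = herm c x y)"
      "x' \<in> K \<and> (\<forall>y\<in>K. f y = herm c x' y)"
    have "herm c (x - x') y = 0" for y
    proof -
      obtain e :: nat where e: "e > 0" "of_nat e *\<^sub>Q y \<in> K" using denominator by blast
      then have "herm c x (of_nat e *\<^sub>Q y) = herm c x' (of_nat e *\<^sub>Q y)" using xx by metis
      then show ?thesis using e(1) by (simp add: herm_scaleQ_right herm_diff_left)
    qed
    then have "x - x' = 0" by (rule herm_nondegenerate[OF c])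
    then show "x = x'" by simp
  qed
  then show ?thesis
    unfolding principally_polarized_def K_def[symmetric] using kappa_fg[OF assms] span c integral
      by (auto simp: K_def)
qed

end

section \<open>Realising a unimodular lattice by an adelic matrix\<close>

context unimodular_lattice
begin

text \<open>The columns of \<open>M\<close> are the limits of \<open>E k\<close>, taken after
  scaling by \<open>d\<close> into \<open>R\<close>; orthonormality makes the multiplier
  \<open>1 / c\<close>. Coordinates of \<open>y \<in> L\<close> are
  \<open>c *\<^sub>Q sform (b j) (adele_vec y)\<close>, integral because approximated by
  \<open>herm c (E k j) y\<close>. The other inclusion is self-duality.\<close>

lemma exists_GU_kappa: "\<exists>M \<in> GU UNIV. kappa R M = L"
proof -
  obtain E :: "nat \<Rightarrow> 'n \<Rightarrow> 'h ^ 'n" where E: "\<And>k. gram (fact k) UNIV (E k)"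
    "\<And>k i. (1 / of_nat (fact k)) *\<^sub>Q (E (Suc k) i - E k i) \<in> L" using gram_sequence by blast
  have EL: "E k i \<in> L" for k i using E(1) by (auto simp: gram_def)
  obtain d :: nat where d: "d > 0"
    "\<And>x i. x \<in> L \<Longrightarrow> of_nat d *\<^sub>Q (x $ i) \<in> R" using L_bounded by blast
  have lim: "\<exists>x\<in>OH. \<forall>k. (1 / of_nat (fact k)) *\<^sub>Q (x -
    emb (of_nat d *\<^sub>Q (E k j $ i))) \<in> OH" for i j
  proof (rule OH_limit)
    fix k
    show "of_nat d *\<^sub>Q (E k j $ i) \<in> R" using d(2) EL by blast
    show "(1 / of_nat (fact k)) *\<^sub>Q (of_nat d *\<^sub>Q (E (Suc k) j $ i) -
      of_nat d *\<^sub>Q (E k j $ i)) \<in> R"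
      using d(2)[OF E(2)[of k j], of i] by (simp add: scaleQ_diff_right mult.commute)
  qed
  have "\<forall>i. \<exists>f. \<forall>j. f j \<in> OH \<and>
    (\<forall>k. (1 / of_nat (fact k)) *\<^sub>Q (f j - emb (of_nat d *\<^sub>Q (E k j $ i))) \<in> OH)"
    using lim by (intro allI choice) blast
  from choice[OF this] obtain x
    where x: "\<And>i j. x i j \<in> OH"
      "\<And>i j k. (1 / of_nat (fact k)) *\<^sub>Q (x i j -
        emb (of_nat d *\<^sub>Q (E k j $ i))) \<in> OH" by blast
  define M :: "'h adeles ^ 'n ^ 'n" where "M = (\<chi> i j. (1 / of_nat d) *\<^sub>Q x i j)"
  define b where "b j = M *v axis j 1" for j
  have b_nth: "b j $ i = (1 / of_nat d) *\<^sub>Q x i j" for i j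
    by (simp add: b_def matrix_vector_mult_axis M_def)
  have b: "of_nat d *\<^sub>Q b j \<in> OV" for j using x(1) d(1) by (simp add: OV_def b_nth)
  have bE: "(of_nat d / of_nat (fact k)) *\<^sub>Q (b j - adele_vec (E k j)) \<in> OV" for j k
    using x(2)[of k _ j] d(1) by (simp add: OV_def b_nth emb_simps scaleQ_diff_right)
  have E': "of_nat d *\<^sub>Q adele_vec (E k j) \<in> OV" for j k
    using d(2)[OF EL] OV_adele_vec[of "of_nat d *\<^sub>Q E k j"] by (simp add: adele_vec_simps)
  obtain n :: nat where n: "n > 0" "of_nat n * c \<in> \<int>" using rat_common_denominator[of "{c}"] by auto
  have orthonormal: "c *\<^sub>Q sform (b i) (b j) = (if i = j then 1 else 0)" for i j
  proof -
    define \<delta> :: 'h where "\<delta> = (if i = j then 1 else 0)"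
    define t where "t = c *\<^sub>Q sform (b i) (b j) - emb \<delta>"
    \<comment> \<open>The factor \<open>n\<close> clears the denominator of \<open>c\<close>; one
      \<open>d\<close> cancels the \<open>1 / d\<close> in the error of approximation, the other
      makes \<open>E N i\<close> and \<open>b j\<close> integral.\<close>
    have "of_nat (n * d * d) *\<^sub>Q t = 0"
    proof (rule adele_zero_if_divisible)
      fix N :: nat assume N: "N > 0"
      define F where "F = (fact N :: nat)"
      define v where "v i = (of_nat d / of_nat F) *\<^sub>Q (b i - adele_vec (E N i))" for i
      have v: "v i \<in> OV" for i unfolding v_def F_def by (rule bE)
      have "N dvd F" unfolding F_def using N by (intro dvd_fact) auto
      then obtain F' where F': "F = F' * N" by (metis dvd_def mult.commute)
      have F0: "F > 0" "F' > 0" using F' F_def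
        by (metis fact_gt_zero, metis F_def fact_nonzero gr0I mult_zero_left)
      have G: "emb ((1 / of_nat F) *\<^sub>Q (herm c (E N i) (E N j) - \<delta>)) \<in> OH"
        using E(1)[of N] unfolding gram_def F_def \<delta>_def by (intro OH_emb) blast
      have bi: "b i = adele_vec (E N i) + (of_nat F / of_nat d) *\<^sub>Q v i" for i using d(1) F0
        by (simp add: v_def)
      have "sform (b i) (b j) = sform (adele_vec (E N i)) (b j) +
        (of_nat F / of_nat d) *\<^sub>Q sform (v i) (b j)"
        by (subst (1) bi) (simp only: sform_add_left sform_scaleQ)
      also have "sform (adele_vec (E N i)) (b j) = sform (adele_vec (E N i)) (adele_vec (E N j)) +
        (of_nat F / of_nat d) *\<^sub>Q sform (adele_vec (E N i)) (v j)"
        by (subst bi) (simp only: sform_add_right sform_scaleQ)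
      finally have "t = of_nat F *\<^sub>Q emb ((1 / of_nat F) *\<^sub>Q (herm c (E N i) (E N j) - \<delta>))
          + (c * of_nat F / of_nat d) *\<^sub>Q (sform (adele_vec (E N i)) (v j) + sform (v i) (b j))"
        using F0 by (simp add: t_def emb_herm emb_simps scaleQ_add_right)
      then have "of_nat (n * d * d) *\<^sub>Q t =
        of_nat F *\<^sub>Q (of_nat (n * d * d) *\<^sub>Q emb ((1 / of_nat F) *\<^sub>Q
          (herm c (E N i) (E N j) - \<delta>))
          + (of_nat n * c) *\<^sub>Q (sform (of_nat d *\<^sub>Q adele_vec (E N i)) (v j) +
            sform (v i) (of_nat d *\<^sub>Q b j)))" (is "_ = of_nat F *\<^sub>Q ?s")
        using d(1) by (simp add: sform_scaleQ scaleQ_add_right mult_ac)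
      then have "(1 / of_nat N) *\<^sub>Q of_nat (n * d * d) *\<^sub>Q t = of_nat F' *\<^sub>Q ?s"
        using N F' by simp
      also have "\<dots> \<in> OH"
        by (intro OH_scale_Ints[OF Ints_of_nat] OH_add OH_scale_Ints[OF Ints_of_nat G] OH_scale_Ints[OF n(2)] sform_OH E' v b)
      finally show "(1 / of_nat N) *\<^sub>Q of_nat (n * d * d) *\<^sub>Q t \<in> OH" .
    qed
    then have "t = 0" using n(1) d(1) by simp
    then show ?thesis by (simp add: t_def \<delta>_def emb_simps split: if_splits)
  qed
  define l :: "'h adeles" where "l = (1 / c) *\<^sub>Q 1"
  have l: "invol l = l" "l * (c *\<^sub>Q 1) = 1" "(c *\<^sub>Q 1) * l = 1" using c by (simp_all add: l_def)
  have MM: "dagger M ** M = mat l"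
  proof (subst vec_eq_iff, intro allI, subst vec_eq_iff, intro allI)
    fix i j
    have "(1 / c) *\<^sub>Q (c *\<^sub>Q sform (b i) (b j)) = mat l $ i $ j" unfolding orthonormal
      by (simp add: mat_nth l_def)
    then show "(dagger M ** M) $ i $ j = mat l $ i $ j" using c by (simp add: dagger_mult_nth b_def)
  qed
  have GU: "M \<in> GU UNIV"
    unfolding GU_def fixed_ring_def mem_Collect_eq
  proof (intro conjI allI bexI)
    show "dagger M ** M = mat l" "l * (c *\<^sub>Q 1) = 1" "(c *\<^sub>Q 1) * l = 1" by (fact MM l)+
  qed (use l in auto)
  have left: "(mat (c *\<^sub>Q 1) ** dagger M) ** M = mat 1"
    using l(3) by (auto simp: vec_eq_iff mat_mult_nth mat_nth MM simp flip: matrix_mul_assoc)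
  have right: "M ** (mat (c *\<^sub>Q 1) ** dagger M) = mat 1"
    by (rule left_inverse_imp_right_inverse[OF left])
  have L_sub: "y \<in> kappa R M" if y: "y \<in> L" for y
  proof -
    define w where "w = (mat (c *\<^sub>Q 1) ** dagger M) *v adele_vec y"
    obtain D :: nat where D: "D > 0" "of_nat D *\<^sub>Q (c *\<^sub>Q adele_vec y) \<in> OV"
      using OV_denominator by blast
    \<comment> \<open>Then \<open>d * D\<close> divides \<open>fact k\<close>, and the error
      \<open>F / d\<close> times \<open>v\<close> pairs integrally with
      \<open>c *\<^sub>Q adele_vec y\<close>.\<close>
    define k where "k = d * D"
    define F where "F = (fact k :: nat)"
    have "k dvd F" unfolding F_def k_def using d D by (intro dvd_fact) (auto simp: Suc_le_eq)
    then obtain F' where F': "F = F' * k" by (metis dvd_def mult.commute)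
    have F0: "F > 0" by (simp add: F_def)
    have "w $ j \<in> OH" for j
    proof -
      define v where "v = (of_nat d / of_nat F) *\<^sub>Q (b j - adele_vec (E k j))"
      have v: "v \<in> OV" unfolding v_def F_def by (rule bE)
      have "w $ j = c *\<^sub>Q sform (b j) (adele_vec y)"
        unfolding b_def sform_column by (simp add: w_def mat_vector_mult_nth flip: matrix_vector_mul_assoc)
      also have "b j = adele_vec (E k j) + (of_nat F / of_nat d) *\<^sub>Q v" using d(1) F0
        by (simp add: v_def)
      also have "c *\<^sub>Q sform (adele_vec (E k j) + (of_nat F / of_nat d) *\<^sub>Q v) (adele_vec y) =
          emb (herm c (E k j) y) + of_nat F' *\<^sub>Q sform v (of_nat D *\<^sub>Q (c *\<^sub>Q adele_vec y))"
        using d(1) by (simp add: sform_add_left sform_scaleQ scaleQ_add_right emb_herm F' k_def mult_ac)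
      also have "\<dots> \<in> OH"
        by (intro OH_add OH_emb integral EL y OH_scale_Ints[OF Ints_of_nat] sform_OH v D(2))
      finally show ?thesis .
    qed
    then have "w \<in> OV" by (simp add: OV_def)
    moreover have "adele_vec y = M *v w" by (simp add: w_def matrix_vector_mul_assoc right)
    ultimately show ?thesis by (auto simp: kappa_iff)
  qed
  have "y \<in> L" if y: "y \<in> kappa R M" for y
  proof (rule L_dual)
    fix z assume z: "z \<in> L"
    obtain w v where wv: "w \<in> OV" "adele_vec y = M *v w" "v \<in> OV" "adele_vec z = M *v v"
      using y L_sub[OF z] unfolding kappa_iff by blast
    have "emb (herm c y z) = sform w v" using c by (simp add: emb_herm wv sform_GU[OF l(1) MM] l_def)
    then have "emb (herm c y z) \<in> OH" using sform_OH[OF wv(1,3)] by simp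
    then show "herm c y z \<in> R" by (simp add: emb_in_OH_iff)
  qed
  then have "kappa R M = L" using L_sub by blast
  then show ?thesis using GU by blast
qed

end

section \<open>The bijection between cosets and principally polarized lattices\<close>

theorem theorem2p7:
  fixes R :: "'h::quaternion_algebra set"
  assumes "definite TYPE('h)" and "maximal_order R"
  shows "\<exists>\<Phi> :: ('h adeles ^ 'n ^ 'n) set \<Rightarrow> ('h ^ 'n::finite) set.
    bij_betw \<Phi> (left_cosets (GU UNIV) (GU (order_hat R))) {L. principally_polarized R L} \<and>
    (\<forall>M \<in> GU UNIV. \<Phi> ((\<lambda>U. M ** U) ` GU (order_hat R)) = kappa R M)"
proof -
  interpret maximal_quaternion_order R
    using assms(2) by unfold_locales (auto simp: maximal_order_def)
  define coset :: "'h adeles ^ 'n ^ 'n \<Rightarrow> ('h adeles ^ 'n ^ 'n) set"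
    where "coset M = (\<lambda>U. M ** U) ` GU OH" for M
  have coset_eq: "kappa R M \<subseteq> kappa R M'" if eq: "coset M = coset M'"
    for M M' :: "'h adeles ^ 'n ^ 'n"
  proof -
    have "M ** mat 1 \<in> coset M" unfolding coset_def using one_in_GU_OH by (rule imageI)
    then obtain U where "U \<in> GU OH" "M = M' ** U" using eq by (auto simp: coset_def)
    then show ?thesis using kappa_subset_mult by blast
  qed
  have kappa_eq: "coset M = coset M'" if "M \<in> GU UNIV" "M' \<in> GU UNIV" "kappa R M = kappa R M'"
    for M M' :: "'h adeles ^ 'n ^ 'n"
    unfolding coset_def
    by (intro subset_antisym kappa_eq_imp_coset_subset that) (simp_all add: that(3))
  \<comment> \<open>The value depends only on the coset by \<open>coset_eq\<close>, applied in both
    directions to the chosen representative.\<close>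
  define \<Phi> where "\<Phi> C = kappa R (SOME M. M \<in> GU UNIV \<and> C = coset M)" for C
  have \<Phi>: "\<Phi> (coset M) = kappa R M" if M: "M \<in> GU UNIV" for M :: "'h adeles ^ 'n ^ 'n"
  proof -
    have "\<exists>M'. M' \<in> GU UNIV \<and> coset M = coset M'" using M by blast
    then have "coset M = coset (SOME M'. M' \<in> GU UNIV \<and> coset M = coset M')"
      by (rule someI2_ex) blast
    then show ?thesis unfolding \<Phi>_def by (intro subset_antisym coset_eq) auto
  qed
  have cosets: "left_cosets (GU UNIV) (GU OH) = coset ` GU UNIV" by (simp add: left_cosets_def coset_def)
  have "bij_betw \<Phi> (coset ` GU UNIV) {L. principally_polarized R L}"
    unfolding bij_betw_def
  proof
    show "inj_on \<Phi> (coset ` GU UNIV)"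
    proof (rule inj_onI)
      fix C C' assume "C \<in> coset ` GU UNIV" "C' \<in> coset ` GU UNIV" and eq: "\<Phi> C = \<Phi> C'"
      then obtain M M' where M: "M \<in> GU UNIV" "C = coset M" "M' \<in> GU UNIV" "C' = coset M'" by blast
      have "kappa R M = kappa R M'" using eq unfolding M(2,4) \<Phi>[OF M(1)] \<Phi>[OF M(3)] .
      then show "C = C'" unfolding M(2,4) by (rule kappa_eq[OF M(1,3)])
    qed
    show "\<Phi> ` coset ` GU UNIV = {L. principally_polarized R L}"
    proof (intro subset_antisym subsetI)
      fix L assume "L \<in> \<Phi> ` coset ` GU UNIV"
      then obtain M where M: "M \<in> GU UNIV" "L = \<Phi> (coset M)" by blast
      then show "L \<in> {L. principally_polarized R L}"
        unfolding M(2) \<Phi>[OF M(1)] using kappa_principally_polarized by blast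
    next
      fix L :: "('h ^ 'n) set" assume "L \<in> {L. principally_polarized R L}"
      then obtain c where c: "fg_right_submodule R L" "rat_vector.span L = UNIV" "c \<noteq> 0"
        "\<forall>x\<in>L. \<forall>y\<in>L. herm c x y \<in> R" "unimodular_on R L (herm c)"
        by (auto simp: principally_polarized_def)
      then interpret unimodular_lattice R L c by unfold_locales auto
      obtain M where M: "M \<in> GU UNIV" "kappa R M = L" using exists_GU_kappa by blast
      have "\<Phi> (coset M) \<in> \<Phi> ` coset ` GU UNIV" using M(1) by blast
      then show "L \<in> \<Phi> ` coset ` GU UNIV" unfolding \<Phi>[OF M(1)] M(2) .
    qed
  qed
  then show ?thesis using \<Phi> unfolding cosets coset_def by blast
qed

end
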